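(* For each $\varrho\ge1$ (with $\varrho<\infty$) the operator that maps $f\in L^1(\gamma_\infty)$ to the function $x\mapsto\|\mathcal H_t^{\mathrm{glob}}f(x)\|_{v(\varrho),(0,1]}$, $x\in\mathbb R^n$, is of weak type $(1,1)$ with respect to the measure $\gamma_\infty$; that is, there is a constant $C$ such that $\gamma_\infty\{x:\|\mathcal H_t^{\mathrm{glob}}f(x)\|_{v(\varrho),(0,1]}>\alpha\}\le\frac C\alpha\|f\|_{L^1(\gamma_\infty)}$ for all $\alpha>0$ and all $f\in L^1(\gamma_\infty)$.
   Context: Let $n\ge1$, let $Q$ be a real, symmetric, positive definite $n\times n$ matrix and $B$ a real $n\times n$ matrix all of whose eigenvalues have negative real parts. For $0<t\le+\infty$ set $Q_t=\int_0^t e^{sB}Qe^{sB^*}\,ds$, and let $\gamma_\infty$ be the Gaussian probability measure on $\mathbb R^n$ with Lebesgue density $(2\pi)^{-n/2}(\det Q_\infty)^{-1/2}\exp(-\frac12\langle Q_\infty^{-1}x,x\rangle)$. Set $R(x)=\frac12\langle Q_\infty^{-1}x,x\rangle$, $D_t=Q_\infty e^{-tB^*}Q_\infty^{-1}$ and $$K_t(x,u)=\Big(\frac{\det Q_\infty}{\det Q_t}\Big)^{1/2}e^{R(x)}\exp\Big[-\tfrac12\big\langle(Q_t^{-1}-Q_\infty^{-1})(u-D_tx),\,u-D_tx\big\rangle\Big],\quad t>0$$ (the Mehler kernel of the Ornstein--Uhlenbeck semigroup $\mathcal H_tf(x)=\int K_t(x,u)f(u)\,d\gamma_\infty(u)$).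 Localization. Let $R_j=\{x\in\mathbb R^n: j\le R(x)\le j+1\}$ for $j=0,1,\dots$ and $R_j=\emptyset$ for $j<0$. Fix smooth functions $r_j\ge0$, $j\in\mathbb N=\{0,1,\dots\}$, with $\sum_{j\ge0}r_j(x)=1$ for all $x$, $\mathrm{supp}\,r_j\subseteq R_j\cup R_{j+1}$ and $|\nabla r_j(x)|\le C(1+|x|)$, and functions $\widetilde r_j\in C_0^\infty(\mathbb R^n)$ with values in $[0,1]$, $\widetilde r_j=1$ in $\bigcup_{\nu=j-1}^{j+2}R_\nu$, $\mathrm{supp}\,\widetilde r_j\subset\bigcup_{\nu=j-2}^{j+3}R_\nu$ and $|\nabla\widetilde r_j(x)|\le C(1+|x|)$, with $C$ depending only on $n,Q,B$. Set $\eta(x,u)=\sum_{j=0}^\infty\widetilde r_j(x)r_j(u)$ (so $0\le\eta\le1$). The global part is $\mathcal H_t^{\mathrm{glob}}f(x)=\int_{\mathbb R^n}K_t(x,u)(1-\eta(x,u))f(u)\,d\gamma_\infty(u)$. For $1\le\varrho<\infty$ and a real-valued function $\phi$ on an interval $I$, $\|\phi\|_{v(\varrho),I}=\sup\big(\sum_{i=1}^N|\phi(t_i)-\phi(t_{i-1})|^\varrho\big)^{1/\varrho}$, the supremum being over all finite increasing sequences $(t_i)_0^N$ of points in $I$; in the claim it is taken in the variable $t$. *)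

theory Defs
  imports "HOL-Analysis.Analysis"
begin

section \<open>Matrices\<close>

text \<open>The product \<open>*\<close>, hence also the library's power on \<^typ>\<open>real^'n^'n\<close>, is componentwise;
  the exponential below iterates the matrix product \<open>**\<close>.\<close>

definition mat_exp :: "real^'n^'n \<Rightarrow> real^'n^'n" where
  "mat_exp A = (\<Sum>k. (1 / fact k) *\<^sub>R ((\<lambda>M. A ** M) ^^ k) (mat 1))"

definition complex_eigenvalue :: "real^'n^'n \<Rightarrow> complex \<Rightarrow> bool" where
  "complex_eigenvalue A z \<longleftrightarrow>
     (\<exists>v::complex^'n. v \<noteq> 0 \<and> map_matrix complex_of_real A *v v = z *s v)"

definition symmetric_pos_def :: "real^'n^'n \<Rightarrow> bool" where
  "symmetric_pos_def A \<longleftrightarrow> transpose A = A \<and> (\<forall>x. x \<noteq> 0 \<longrightarrow> (A *v x) \<bullet> x > 0)"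

section \<open>The Gaussian measure and the Mehler kernel\<close>

text \<open>The argument \<open>t\<close> ranges over \<open>(0, \<infinity>]\<close>, so that \<open>t = \<infinity>\<close> gives the covariance of the
  invariant measure.\<close>

definition Qcov :: "real^'n^'n \<Rightarrow> real^'n^'n \<Rightarrow> ereal \<Rightarrow> real^'n^'n" where
  "Qcov Q B t = integral {s::real. 0 \<le> s \<and> ereal s \<le> t}
     (\<lambda>s. mat_exp (s *\<^sub>R B) ** Q ** mat_exp (s *\<^sub>R transpose B))"

definition Rquad :: "real^'n^'n \<Rightarrow> real^'n^'n \<Rightarrow> real^'n \<Rightarrow> real" where
  "Rquad Q B x = (1/2) * ((matrix_inv (Qcov Q B \<infinity>) *v x) \<bullet> x)"

definition gauss_inf :: "real^'n^'n \<Rightarrow> real^'n^'n \<Rightarrow> (real^'n) measure" where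
  "gauss_inf Q B = density lborel (\<lambda>x. ennreal
     ((2 * pi) powr (- real CARD('n) / 2) * det (Qcov Q B \<infinity>) powr (-1/2)
        * exp (- (1/2) * ((matrix_inv (Qcov Q B \<infinity>) *v x) \<bullet> x))))"

definition Dmat :: "real^'n^'n \<Rightarrow> real^'n^'n \<Rightarrow> real \<Rightarrow> real^'n^'n" where
  "Dmat Q B t =
     Qcov Q B \<infinity> ** mat_exp (- t *\<^sub>R transpose B) ** matrix_inv (Qcov Q B \<infinity>)"

definition mehler :: "real^'n^'n \<Rightarrow> real^'n^'n \<Rightarrow> real \<Rightarrow> real^'n \<Rightarrow> real^'n \<Rightarrow> real" where
  "mehler Q B t x u =
     (det (Qcov Q B \<infinity>) / det (Qcov Q B (ereal t))) powr (1/2) * exp (Rquad Q B x)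
     * exp (- (1/2) *
         (((matrix_inv (Qcov Q B (ereal t)) - matrix_inv (Qcov Q B \<infinity>))
             *v (u - Dmat Q B t *v x)) \<bullet> (u - Dmat Q B t *v x)))"

section \<open>Localization\<close>

text \<open>The index is an integer because \<open>j - 1\<close> and \<open>j - 2\<close> occur below. The condition
  \<open>0 \<le> j\<close> is needed: the inequalities alone would put the origin into the ring of index \<open>-1\<close>.\<close>

definition ring_set :: "real^'n^'n \<Rightarrow> real^'n^'n \<Rightarrow> int \<Rightarrow> (real^'n) set" where
  "ring_set Q B j =
     {x. 0 \<le> j \<and> real_of_int j \<le> Rquad Q B x \<and> Rquad Q B x \<le> real_of_int j + 1}"

definition supp :: "(real^'n \<Rightarrow> real) \<Rightarrow> (real^'n) set" where
  "supp f = closure {x. f x \<noteq> 0}"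

definition gradient :: "(real^'n \<Rightarrow> real) \<Rightarrow> real^'n \<Rightarrow> real^'n" where
  "gradient f x = (THE D. GDERIV f x :> D)"

text \<open>\<open>Ck k f\<close> says that \<open>f\<close> is of class \<open>C\<^sup>k\<close> on the whole space, by recursion on the
  partial derivatives.\<close>

fun Ck :: "nat \<Rightarrow> (real^'n \<Rightarrow> real) \<Rightarrow> bool" where
  "Ck 0 f \<longleftrightarrow> continuous_on UNIV f"
| "Ck (Suc k) f \<longleftrightarrow> (\<forall>x. f differentiable (at x)) \<and>
     (\<forall>i. Ck k (\<lambda>x. frechet_derivative f (at x) (axis i 1)))"

definition smooth :: "(real^'n \<Rightarrow> real) \<Rightarrow> bool" where
  "smooth f \<longleftrightarrow> (\<forall>k. Ck k f)"

definition eta :: "(nat \<Rightarrow> real^'n \<Rightarrow> real) \<Rightarrow> (nat \<Rightarrow> real^'n \<Rightarrow> real) \<Rightarrow>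
    real^'n \<Rightarrow> real^'n \<Rightarrow> real" where
  "eta r rt x u = (\<Sum>j. rt j x * r j u)"

definition H_glob :: "real^'n^'n \<Rightarrow> real^'n^'n \<Rightarrow>
    (nat \<Rightarrow> real^'n \<Rightarrow> real) \<Rightarrow> (nat \<Rightarrow> real^'n \<Rightarrow> real) \<Rightarrow>
    real \<Rightarrow> (real^'n \<Rightarrow> real) \<Rightarrow> real^'n \<Rightarrow> real" where
  "H_glob Q B r rt t f x =
     (LINT u | gauss_inf Q B. mehler Q B t x u * (1 - eta r rt x u) * f u)"

section \<open>Variation seminorm and weak type\<close>

definition variation_seminorm :: "real \<Rightarrow> real set \<Rightarrow> (real \<Rightarrow> real) \<Rightarrow> ennreal" where
  "variation_seminorm \<rho> I \<phi> =
     (SUP (N, t) \<in> {(N::nat, t::nat \<Rightarrow> real). (\<forall>i\<le>N. t i \<in> I) \<and> (\<forall>i<N. t i < t (Suc i))}.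
        ennreal ((\<Sum>i=1..N. \<bar>\<phi> (t i) - \<phi> (t (i - 1))\<bar> powr \<rho>) powr (1 / \<rho>)))"

text \<open>Measurability of the level sets is part of the notion, since \<^const>\<open>emeasure\<close> is \<open>0\<close> on
  non-measurable sets and the inequality alone would be void there.\<close>

definition weak_type_1_1 :: "'a measure \<Rightarrow> (('a \<Rightarrow> real) \<Rightarrow> 'a \<Rightarrow> ennreal) \<Rightarrow> bool" where
  "weak_type_1_1 M T \<longleftrightarrow>
     (\<exists>C>0. \<forall>f \<alpha>. integrable M f \<longrightarrow> 0 < \<alpha> \<longrightarrow>
        {x \<in> space M. T f x > ennreal \<alpha>} \<in> sets M \<and>
        emeasure M {x \<in> space M. T f x > ennreal \<alpha>} \<le> ennreal (C / \<alpha> * (LINT x|M. \<bar>f x\<bar>)))"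

end

theory Submission
  imports Defs "HOL-Computational_Algebra.Fundamental_Theorem_Algebra"
begin

text \<open>
  Why the operator is of weak type. Sums of \<open>\<rho>\<close>-th powers with \<open>\<rho> \<ge> 1\<close> are dominated by the
  1-variation, and the 1-variation in \<open>t\<close> of the global part at \<open>x\<close> is at most the integral of
  \<open>(1 - \<eta>(x,u)) \<bar>f(u)\<bar>\<close> times the integral over \<open>(0,1]\<close> of \<open>\<bar>\<partial>K\<^sub>t(x,u)/\<partial>t\<bar>\<close>. The statement is
  thereby reduced to one positive linear operator, which can be estimated through its kernel.

  \<^bold>\<open>The kernel.\<close> Put \<open>w = u - D\<^sub>t x\<close>. Since \<open>Q\<^sub>t\<close> is of size \<open>t\<close> and the difference of inverse
  covariances is at least \<open>c/t\<close>, the derivative \<open>\<partial>K\<^sub>t/\<partial>t\<close> is bounded by a multiple of \<open>e\<^bsup>R(x)\<^esup> t\<^bsup>-n/2\<^esup>\<close> times a Gaussian in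
  \<open>w/\<surd>t\<close> times \<open>1/t + \<bar>w\<bar>\<^sup>2/t\<^sup>2 + \<bar>w\<bar>\<bar>x\<bar>/t\<close>. Where \<open>1 - \<eta>(x,u)\<close> does not vanish, \<open>R(x)\<close> and \<open>R(u)\<close>
  differ by at least 1, so \<open>\<bar>u - x\<bar> \<ge> \<delta>/(1 + \<bar>x\<bar>)\<close>; as \<open>D\<^sub>t x\<close> moves at speed at most comparable to \<open>\<bar>x\<bar>\<close>, it follows
  that \<open>\<bar>w\<bar> + \<surd>t\<close> is never much smaller than \<open>1/(1 + \<bar>x\<bar>)\<close>. Hence (\<open>mehler_deriv_global\<close>)
  \<open>\<bar>\<partial>K\<^sub>t/\<partial>t\<bar> \<le> C e\<^bsup>R(x)\<^esup> (1 + \<bar>x\<bar>) (1/(1 + \<bar>x\<bar>) + \<bar>w\<bar>)\<^bsup>-n-1\<^esup>\<close>, a weight that lives on a tube around the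
  trajectory of \<open>x\<close>.

  \<^bold>\<open>The tube operator.\<close> The integral of this weight over \<open>t\<close> and over \<open>\<bar>f\<bar>\<close> has the form \<open>e\<^bsup>R(x)\<^esup> g(x)\<close>,
  and its weak type is proved in \<open>tube_operator_weak_type\<close>. On the set \<open>A\<close> where \<open>e\<^bsup>R\<^esup> g > \<alpha>\<close> one has
  \<open>e\<^bsup>-R\<^esup> < g/\<alpha>\<close>. Along a piece of trajectory of unit duration the function \<open>g\<close> stays below one
  and the same number, a multiple of the analogue of \<open>g\<close> for tubes of twice the duration, while \<open>R\<close> increases at speed at least \<open>\<kappa>\<bar>x\<bar>\<^sup>2\<close>. The integral of \<open>e\<^bsup>-R\<^esup>\<close> over
  the part of the piece that lies in \<open>A\<close> is therefore governed by the first point of \<open>A\<close>, and is at most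
  a multiple of that number divided by \<open>\<alpha>(1 + \<bar>x\<bar>\<^sup>2)\<close>. Averaging over the flow and exchanging integrals, everything comes
  down to the uniform bound, in \<open>u\<close> and \<open>t\<close>, of the integral of
  \<open>(1 + \<bar>y\<bar>)\<^bsup>-1\<^esup> (1/(1 + \<bar>y\<bar>) + \<bar>u - D\<^sub>t y\<bar>)\<^bsup>-n-1\<^esup>\<close> over \<open>y\<close>, which holds by scaling
  (\<open>nn_integral_tube_weight_le\<close>).

  \<^bold>\<open>The flow.\<close> The growth of \<open>R\<close> along trajectories and the gap between the inverse covariances rest on the identity
  \<open>Q\<^sub>\<infinity> = Q\<^sub>t + e\<^bsup>tB\<^esup> Q\<^sub>\<infinity> e\<^bsup>tB*\<^esup>\<close> (\<open>Qi_minus_Qt\<close>), whose very meaning requires that \<open>e\<^bsup>sB\<^esup>\<close> decays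
  exponentially. That is where the eigenvalue hypothesis enters (\<open>mat_exp_decay\<close>).
\<close>

section \<open>The matrix exponential\<close>

lemma bounded_bilinear_matrix_mult:
  "bounded_bilinear ((**) :: real^'n^'m \<Rightarrow> real^'p^'n \<Rightarrow> real^'p^'m)"
  by (rule bilinear_conv_bounded_bilinear[THEN iffD1])
    (simp add: bilinear_def linear_iff matrix_matrix_mult_def vec_eq_iff sum.distrib distrib_left distrib_right sum_distrib_left mult_ac)

interpretation mm: bounded_bilinear "(**) :: real^'n^'m \<Rightarrow> real^'p^'n \<Rightarrow> real^'p^'m"
  by (rule bounded_bilinear_matrix_mult)

lemma bounded_bilinear_matrix_vector_mult:
  "bounded_bilinear ((*v) :: real^'n^'m \<Rightarrow> real^'n \<Rightarrow> real^'m)"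
  by (rule bilinear_conv_bounded_bilinear[THEN iffD1])
    (simp add: bilinear_def linear_iff matrix_vector_mult_def vec_eq_iff sum.distrib distrib_left distrib_right sum_distrib_left mult_ac)

interpretation mv: bounded_bilinear "(*v) :: real^'n^'m \<Rightarrow> real^'n \<Rightarrow> real^'m"
  by (rule bounded_bilinear_matrix_vector_mult)

lemma bounded_linear_entry: "bounded_linear (\<lambda>M :: real^'n^'m. M $ i $ j)"
  using bounded_linear_compose[OF bounded_linear_vec_nth[of j] bounded_linear_vec_nth[of i]] .

lemma bounded_linear_transpose: "bounded_linear (transpose :: real^'n^'m \<Rightarrow> real^'m^'n)"
  by (rule linear_conv_bounded_linear[THEN iffD1]) (auto simp: linear_iff transpose_def vec_eq_iff)

text \<open>Reduces derivatives of matrix functions to real calculus, where power series can be differentiated.\<close>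
lemma has_vector_derivative_entrywise:
  fixes f :: "real \<Rightarrow> real^'n^'m"
  assumes "\<And>i j. ((\<lambda>t. f t $ i $ j) has_real_derivative (f' $ i $ j)) (at t)"
  shows "(f has_vector_derivative f') (at t)"
  unfolding has_vector_derivative_def
proof (subst has_derivative_componentwise_within, rule ballI)
  fix b :: "real^'n^'m"
  assume "b \<in> Basis"
  then obtain i j where b: "b = axis i (axis j 1)"
    unfolding Basis_vec_def by auto
  have "((\<lambda>t. f t $ i $ j) has_derivative (\<lambda>x. x * f' $ i $ j)) (at t)"
    by (rule has_derivative_eq_rhs[OF assms[of i j, unfolded has_field_derivative_def]]) (auto simp: fun_eq_iff)
  then show "((\<lambda>x. f x \<bullet> b) has_derivative (\<lambda>x. x *\<^sub>R f' \<bullet> b)) (at t)"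
    by (simp add: b inner_axis)
qed

lemma has_real_derivative_entry:
  fixes f :: "real \<Rightarrow> real^'n^'m"
  assumes "(f has_vector_derivative f') (at t within S)"
  shows "((\<lambda>t. f t $ i $ j) has_real_derivative (f' $ i $ j)) (at t within S)"
  using bounded_linear.has_vector_derivative[OF bounded_linear_entry assms, of i j]
  by (simp add: has_real_derivative_iff_has_vector_derivative)

text \<open>Powers for the matrix product; the overloaded power on matrices is componentwise.\<close>
definition mpow :: "real^'n^'n \<Rightarrow> nat \<Rightarrow> real^'n^'n" where
  "mpow A k = ((\<lambda>M. A ** M) ^^ k) (mat 1)"

lemma mpow_0[simp]: "mpow A 0 = mat 1"
  and mpow_Suc: "mpow A (Suc k) = A ** mpow A k"
  by (simp_all add: mpow_def)

lemma mpow_Suc': "mpow A (Suc k) = mpow A k ** A"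
proof (induction k)
  case (Suc k)
  have "mpow A (Suc (Suc k)) = A ** mpow A (Suc k)" by (rule mpow_Suc)
  also have "\<dots> = (A ** mpow A k) ** A" by (simp only: Suc matrix_mul_assoc)
  finally show ?case by (simp only: mpow_Suc)
qed (simp add: mpow_Suc)

lemma mpow_scaleR: "mpow (t *\<^sub>R A) k = t ^ k *\<^sub>R mpow A k"
  by (induction k) (simp_all add: mpow_Suc mm.scaleR_left mm.scaleR_right)

lemma mpow_transpose: "mpow (transpose A) k = transpose (mpow A k)"
proof (induction k)
  case (Suc k)
  have "mpow (transpose A) (Suc k) = transpose A ** transpose (mpow A k)" by (simp only: mpow_Suc Suc)
  also have "\<dots> = transpose (mpow A (Suc k))" by (simp only: mpow_Suc' matrix_transpose_mul)
  finally show ?case .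
qed simp

lemma summable_mat_exp:
  fixes A :: "real^'n^'n"
  shows "summable (\<lambda>k. (1 / fact k) *\<^sub>R mpow A k)"
proof -
  obtain K where K: "0 < K" "\<And>a b. norm (a ** b :: real^'n^'n) \<le> norm a * norm (b :: real^'n^'n) * K"
    using mm.pos_bounded by blast
  have n: "norm (mpow A k) \<le> (norm A * K) ^ k * norm (mat 1 :: real^'n^'n)" for k
  proof (induction k)
    case (Suc k)
    have "norm (mpow A (Suc k)) \<le> norm A * norm (mpow A k) * K"
      unfolding mpow_Suc by (rule K)
    also have "\<dots> \<le> norm A * ((norm A * K) ^ k * norm (mat 1 :: real^'n^'n)) * K"
      using K Suc by (intro mult_right_mono mult_left_mono) auto
    finally show ?case by (simp add: mult_ac)
  qed simp
  have "summable (\<lambda>k. norm (mat 1 :: real^'n^'n) * (inverse (fact k) * (norm A * K) ^ k))"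
    by (intro summable_mult summable_exp)
  then show ?thesis
  proof (rule summable_comparison_test')
    fix k :: nat
    show "norm ((1 / fact k) *\<^sub>R mpow A k) \<le> norm (mat 1 :: real^'n^'n) * (inverse (fact k) * (norm A * K) ^ k)"
      using n[of k] by (simp add: divide_inverse mult_ac mult_left_mono)
  qed
qed

lemma mat_exp_altdef: "mat_exp A = (\<Sum>k. (1 / fact k) *\<^sub>R mpow A k)"
  by (simp add: mat_exp_def mpow_def)

lemma bounded_linear_mat_exp:
  assumes "bounded_linear f"
  shows "f (mat_exp A) = (\<Sum>k. f ((1 / fact k) *\<^sub>R mpow A k))" "summable (\<lambda>k. f ((1 / fact k) *\<^sub>R mpow A k))"
  unfolding mat_exp_altdef
  using bounded_linear.suminf[OF assms summable_mat_exp] bounded_linear.summable[OF assms summable_mat_exp] by auto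

lemma mat_exp_commute: "A ** mat_exp A = mat_exp A ** A"
proof -
  have "bounded_linear (\<lambda>M. A ** M)" "bounded_linear (\<lambda>M. M ** A)"
    by (rule mm.bounded_linear_right mm.bounded_linear_left)+
  note this[THEN bounded_linear_mat_exp(1), of A]
  then show ?thesis
    by (simp only: mm.scaleR_left mm.scaleR_right mpow_Suc[symmetric] mpow_Suc'[symmetric])
qed

lemma mat_exp_transpose: "mat_exp (transpose A) = transpose (mat_exp A)"
proof -
  have tr: "transpose (c *\<^sub>R M) = c *\<^sub>R transpose M" for c and M :: "real^'n^'n"
    by (simp add: transpose_def vec_eq_iff)
  show ?thesis
    unfolding bounded_linear_mat_exp(1)[OF bounded_linear_transpose]
    by (simp add: mat_exp_altdef mpow_transpose tr)
qed

lemma mat_exp_scaleR_derivative: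
  "((\<lambda>t. mat_exp (t *\<^sub>R A)) has_vector_derivative (A ** mat_exp (t *\<^sub>R A))) (at t)"
proof (rule has_vector_derivative_entrywise)
  fix i j
  define c where "c k = mpow A k $ i $ j / fact k" for k
  have e: "mat_exp (s *\<^sub>R A) $ i $ j = (\<Sum>k. c k * s ^ k)" "summable (\<lambda>k. c k * s ^ k)" for s
    using bounded_linear_mat_exp[OF bounded_linear_entry[of i j], of "s *\<^sub>R A"]
    by (simp_all add: mpow_scaleR c_def mult_ac)
  have "bounded_linear (\<lambda>M. (A ** M) $ i $ j)"
    using bounded_linear_compose[OF bounded_linear_entry mm.bounded_linear_right] .
  from bounded_linear_mat_exp(1)[OF this, of "t *\<^sub>R A"]
  have "(A ** mat_exp (t *\<^sub>R A)) $ i $ j = (\<Sum>k. diffs c k * t ^ k)"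
    by (simp add: mpow_scaleR mm.scaleR_right diffs_def c_def mult_ac divide_simps flip: mpow_Suc)
  then show "((\<lambda>t. mat_exp (t *\<^sub>R A) $ i $ j) has_real_derivative (A ** mat_exp (t *\<^sub>R A)) $ i $ j) (at t)"
    using termdiffs_strong_converges_everywhere[of c t] e by simp
qed

lemma mat_exp_0[simp]: "mat_exp 0 = (mat 1 :: real^'n^'n)"
proof -
  have m: "mpow (0 :: real^'n^'n) k = (if k = 0 then mat 1 else 0)" for k
    by (cases k) (simp_all add: mpow_Suc mm.zero_left)
  have "mat_exp (0 :: real^'n^'n) = (\<Sum>k\<in>{0}. (1 / fact k) *\<^sub>R mpow (0 :: real^'n^'n) k)"
    unfolding mat_exp_altdef by (rule suminf_finite) (auto simp: m)
  then show ?thesis by simp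
qed

lemma mat_exp_scaleR_commute: "A ** mat_exp (t *\<^sub>R A) = mat_exp (t *\<^sub>R A) ** A"
proof (cases "t = 0")
  case False
  have "t *\<^sub>R (A ** mat_exp (t *\<^sub>R A)) = t *\<^sub>R (mat_exp (t *\<^sub>R A) ** A)"
    using mat_exp_commute[of "t *\<^sub>R A"] by (simp add: mm.scaleR_left mm.scaleR_right)
  then show ?thesis using False by simp
qed simp

lemma mat_exp_scaleR_chain:
  assumes "(g has_real_derivative g') (at t)"
  shows "((\<lambda>t. mat_exp (g t *\<^sub>R A)) has_vector_derivative (g' *\<^sub>R (A ** mat_exp (g t *\<^sub>R A)))) (at t)"
  using vector_diff_chain_at[OF assms[unfolded has_real_derivative_iff_has_vector_derivative] mat_exp_scaleR_derivative]
  by (simp add: o_def)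

text \<open>The left side has derivative zero in \<open>t\<close>, because \<open>A\<close> commutes with its exponentials. This identity contains both the inverse and the group law.\<close>
lemma mat_exp_scaleR_minus_add: "mat_exp ((- t) *\<^sub>R A) ** mat_exp ((s + t) *\<^sub>R A) = mat_exp (s *\<^sub>R A)"
proof -
  define F where "F t = mat_exp ((- t) *\<^sub>R A) ** mat_exp ((s + t) *\<^sub>R A)" for t
  have "(F has_vector_derivative 0) (at t)" for t
  proof -
    have "((\<lambda>t. mat_exp ((- t) *\<^sub>R A)) has_vector_derivative ((- 1) *\<^sub>R (A ** mat_exp ((- t) *\<^sub>R A)))) (at t)"
      by (rule mat_exp_scaleR_chain) (auto intro!: derivative_eq_intros)
    moreover have "((\<lambda>t. mat_exp ((s + t) *\<^sub>R A)) has_vector_derivative (1 *\<^sub>R (A ** mat_exp ((s + t) *\<^sub>R A)))) (at t)"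
      by (rule mat_exp_scaleR_chain) (auto intro!: derivative_eq_intros)
    ultimately have "(F has_vector_derivative (mat_exp ((- t) *\<^sub>R A) ** (1 *\<^sub>R (A ** mat_exp ((s + t) *\<^sub>R A)))
        + ((- 1) *\<^sub>R (A ** mat_exp ((- t) *\<^sub>R A))) ** mat_exp ((s + t) *\<^sub>R A))) (at t)"
      unfolding F_def by (rule mm.has_vector_derivative)
    moreover have "mat_exp ((- t) *\<^sub>R A) ** (1 *\<^sub>R (A ** mat_exp ((s + t) *\<^sub>R A)))
        + ((- 1) *\<^sub>R (A ** mat_exp ((- t) *\<^sub>R A))) ** mat_exp ((s + t) *\<^sub>R A) = 0"
      unfolding mat_exp_scaleR_commute[of A "- t"] mm.scaleR_left matrix_mul_assoc scaleR_one by simp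
    ultimately show ?thesis by (simp only:)
  qed
  then obtain c where "\<And>t. F t = c"
    using has_vector_derivative_zero_constant[of UNIV F] by auto
  then have "F t = F 0" by metis
  then show ?thesis by (simp add: F_def)
qed

lemma mat_exp_scaleR_minus: "mat_exp ((- t) *\<^sub>R A) ** mat_exp (t *\<^sub>R A) = mat 1"
  using mat_exp_scaleR_minus_add[of t A 0] by simp

lemma mat_exp_scaleR_add: "mat_exp ((s + t) *\<^sub>R A) = mat_exp (s *\<^sub>R A) ** mat_exp (t *\<^sub>R A)"
proof -
  have "mat_exp (s *\<^sub>R A) ** mat_exp (t *\<^sub>R A) = mat_exp (s *\<^sub>R A) ** (mat_exp ((- s) *\<^sub>R A) ** mat_exp ((t + s) *\<^sub>R A))"
    by (simp only: mat_exp_scaleR_minus_add)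
  also have "\<dots> = (mat_exp ((- (- s)) *\<^sub>R A) ** mat_exp ((- s) *\<^sub>R A)) ** mat_exp ((t + s) *\<^sub>R A)"
    by (simp add: matrix_mul_assoc)
  also have "\<dots> = mat_exp ((t + s) *\<^sub>R A)" by (simp only: mat_exp_scaleR_minus matrix_mul_lid)
  finally show ?thesis by (simp add: add.commute)
qed

lemma continuous_on_mat_exp: "continuous_on S (\<lambda>t. mat_exp (t *\<^sub>R A))"
  by (intro continuous_at_imp_continuous_on ballI has_vector_derivative_continuous[OF mat_exp_scaleR_derivative])

section \<open>Exponential decay under the eigenvalue condition\<close>

text \<open>Integrate \<open>(e\<^bsup>-ls\<^esup> y)' = e\<^bsup>-ls\<^esup> w\<close>: this derivative grows at most like \<open>e\<^bsup>(\<mu>-d)s\<^esup>\<close> with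
  \<open>\<mu> = - Re l\<close>, and so does its primitive.\<close>
lemma decay_of_scalar_ode:
  fixes y w :: "real \<Rightarrow> complex"
  assumes y: "\<And>s. (y has_vector_derivative (l * y s + w s)) (at s)"
    and w: "\<And>s. 0 \<le> s \<Longrightarrow> norm (w s) \<le> C * exp (- c * s)" and c: "0 < c" and l: "Re l < 0"
  shows "\<exists>C' c'. 0 < c' \<and> (\<forall>s\<ge>0. norm (y s) \<le> C' * exp (- c' * s))"
proof -
  define \<mu> where "\<mu> = - Re l"
  \<comment> \<open>A rate strictly below \<open>\<mu>\<close>, so that the comparison function is a genuine primitive without a polynomial factor.\<close>
  define d where "d = min c \<mu> / 2"
  have d: "0 < d" "d \<le> c" "d < \<mu>" using c l by (auto simp: d_def \<mu>_def min_def)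
  have C0: "0 \<le> C" using w[of 0] by (simp, meson norm_ge_zero order_trans)
  define z where "z s = exp (of_real s * (- l)) * y s" for s
  have z': "(z has_vector_derivative (exp (of_real s * (- l)) * w s)) (at s)" for s
  proof -
    have "((\<lambda>s. exp (of_real s * (- l))) has_vector_derivative ((- l) * exp (of_real s * (- l)))) (at s)"
      using exp_scaleR_has_vector_derivative_left[of "- l" s] by (simp add: scaleR_conv_of_real)
    from has_vector_derivative_mult[OF this y[of s]]
    show ?thesis unfolding z_def by (simp add: algebra_simps)
  qed
  have ne: "norm (exp (of_real s * (- l))) = exp (\<mu> * s)" for s
    by (simp add: \<mu>_def mult.commute)
  define \<phi> where "\<phi> s = C / (\<mu> - d) * exp ((\<mu> - d) * s)" for s
  have phi': "(\<phi> has_vector_derivative (C * exp ((\<mu> - d) * s))) (at s)" for s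
    unfolding \<phi>_def has_real_derivative_iff_has_vector_derivative[symmetric]
    using d by (auto intro!: derivative_eq_intros)
  have zb: "norm (z s - z 0) \<le> \<phi> s - \<phi> 0" if "0 < s" for s
  proof (rule differentiable_bound_general[OF that])
    show "continuous_on {0..s} z"
      by (meson z' continuous_at_imp_continuous_on has_vector_derivative_continuous)
    show "continuous_on {0..s} \<phi>"
      by (meson phi' continuous_at_imp_continuous_on has_vector_derivative_continuous)
    fix x assume x: "0 < x" "x < s"
    show "(z has_vector_derivative exp (of_real x * (- l)) * w x) (at x)" by (rule z')
    show "(\<phi> has_vector_derivative C * exp ((\<mu> - d) * x)) (at x)" by (rule phi')
    have "norm (w x) \<le> C * exp (- c * x)" using x by (intro w) auto
    also have "\<dots> \<le> C * exp (- d * x)" using C0 d x by (intro mult_left_mono) auto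
    finally have "exp (\<mu> * x) * norm (w x) \<le> exp (\<mu> * x) * (C * exp (- d * x))"
      by (rule mult_left_mono) simp
    also have "\<dots> = C * exp ((\<mu> - d) * x)" by (simp add: algebra_simps flip: exp_add)
    finally show "norm (exp (of_real x * (- l)) * w x) \<le> C * exp ((\<mu> - d) * x)"
      by (simp only: norm_mult ne)
  qed
  have "norm (y s) \<le> (norm (y 0) + C / (\<mu> - d)) * exp (- d * s)" if s: "0 \<le> s" for s
  proof (cases "s = 0")
    case True
    then show ?thesis using C0 d by simp
  next
    case False
    have "norm (z s) \<le> norm (z 0) + norm (z s - z 0)" by (metis norm_triangle_sub)
    also have "\<dots> \<le> norm (z 0) + (\<phi> s - \<phi> 0)" using zb[of s] False s by simp
    also have "\<dots> \<le> norm (y 0) + \<phi> s" using C0 d by (simp add: z_def \<phi>_def)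
    finally have "exp (\<mu> * s) * norm (y s) \<le> norm (y 0) + \<phi> s"
      by (simp only: z_def norm_mult ne)
    then have "exp (- \<mu> * s) * (exp (\<mu> * s) * norm (y s)) \<le> exp (- \<mu> * s) * (norm (y 0) + \<phi> s)"
      by (rule mult_left_mono) simp
    then have "norm (y s) \<le> exp (- \<mu> * s) * (norm (y 0) + \<phi> s)"
      by (simp add: mult.assoc[symmetric] flip: exp_add)
    also have "\<dots> = exp (- \<mu> * s) * norm (y 0) + C / (\<mu> - d) * exp (- d * s)"
      unfolding \<phi>_def by (simp add: algebra_simps mult_exp_exp)
    also have "\<dots> \<le> exp (- d * s) * norm (y 0) + C / (\<mu> - d) * exp (- d * s)"
      using d s by (intro add_right_mono mult_right_mono) (auto simp: mult_right_mono)
    finally show ?thesis by (simp add: algebra_simps)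
  qed
  then show ?thesis using d by blast
qed

definition cvec :: "real^'n^'n \<Rightarrow> complex^'n \<Rightarrow> complex^'n" where
  "cvec M v = map_matrix complex_of_real M *v v"

lemma cvec_component: "cvec M v $ i = (\<Sum>j\<in>UNIV. of_real (M $ i $ j) * v $ j)"
  by (simp add: cvec_def matrix_vector_mult_def map_matrix_def)

lemma cvec_mult: "cvec (M ** N) v = cvec M (cvec N v)"
proof -
  have "map_matrix complex_of_real (M ** N) = map_matrix complex_of_real M ** map_matrix complex_of_real N"
    by (simp add: map_matrix_def matrix_matrix_mult_def vec_eq_iff)
  then show ?thesis by (simp add: cvec_def matrix_vector_mul_assoc)
qed

lemma cvec_linear: "cvec M (v + w) = cvec M v + cvec M w" "cvec M (v - w) = cvec M v - cvec M w"
  "cvec M (a *s v) = a *s cvec M v" "cvec M 0 = 0"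
  by (simp_all add: cvec_def matrix_vector_right_distrib matrix_vector_mult_diff_distrib vec_eq_iff
      matrix_vector_mult_def sum_distrib_left mult_ac distrib_left right_diff_distrib sum.distrib sum_subtractf)

text \<open>This is \<open>p(A) v\<close>.\<close>
definition poly_apply :: "real^'n^'n \<Rightarrow> complex poly \<Rightarrow> complex^'n \<Rightarrow> complex^'n" where
  "poly_apply A p v = (\<Sum>k\<le>degree p. coeff p k *s (cvec A ^^ k) v)"

lemma poly_apply_altdef:
  assumes "degree p \<le> N"
  shows "poly_apply A p v = (\<Sum>k\<le>N. coeff p k *s (cvec A ^^ k) v)"
  unfolding poly_apply_def
  by (rule sum.mono_neutral_left) (use assms in \<open>auto simp: coeff_eq_0 not_le\<close>)

lemma poly_apply_add: "poly_apply A (p + q) v = poly_apply A p v + poly_apply A q v"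
proof -
  define N where "N = max (degree p) (degree q)"
  have "degree (p + q) \<le> N" "degree p \<le> N" "degree q \<le> N"
    by (auto simp: N_def degree_add_le_max)
  then show ?thesis
    by (simp add: poly_apply_altdef[of _ N] vector_sadd_rdistrib sum.distrib)
qed

lemma poly_apply_smult: "poly_apply A (smult c p) v = c *s poly_apply A p v"
  by (simp add: poly_apply_altdef[of "smult c p" "degree p"] poly_apply_def vec.scale_sum_right degree_smult_le)

lemma cvec_funpow_linear: "(cvec M ^^ k) (v + w) = (cvec M ^^ k) v + (cvec M ^^ k) w" "(cvec M ^^ k) (a *s v) = a *s (cvec M ^^ k) v"
  by (induction k) (simp_all add: cvec_linear)

lemma poly_apply_linear: "poly_apply A p (v + w) = poly_apply A p v + poly_apply A p w"
   "poly_apply A p (a *s v) = a *s poly_apply A p v"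
  by (simp_all add: poly_apply_def cvec_funpow_linear vector_add_ldistrib sum.distrib vec.scale_sum_right
     vector_smult_assoc mult.commute)

lemma poly_apply_pCons_0: "poly_apply A (pCons 0 p) v = poly_apply A p (cvec A v)"
proof -
  have "poly_apply A (pCons 0 p) v = (\<Sum>k\<le>Suc (degree p). coeff (pCons 0 p) k *s (cvec A ^^ k) v)"
    by (rule poly_apply_altdef) (simp add: degree_pCons_le)
  also have "\<dots> = (\<Sum>k\<le>degree p. coeff p k *s (cvec A ^^ Suc k) v)"
    by (subst sum.atMost_Suc_shift) simp
  also have "\<dots> = poly_apply A p (cvec A v)"
    by (simp add: poly_apply_def funpow_swap1)
  finally show ?thesis .
qed

lemma poly_apply_cvec: "poly_apply A p (cvec A v) = cvec A (poly_apply A p v)"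
proof -
  have "cvec A (sum f S) = (\<Sum>x\<in>S. cvec A (f x))" if "finite S" for S :: "nat set" and f
    using that by (induction S rule: finite_induct) (simp_all add: cvec_linear)
  then show ?thesis by (simp add: poly_apply_def cvec_linear funpow_swap1)
qed

lemma poly_apply_linear_factor:
  "poly_apply A ([:- z, 1:] * q) v = poly_apply A q (cvec A v - z *s v)"
proof -
  have "[:- z, 1:] * q = smult (- z) q + pCons 0 q" by simp
  then have "poly_apply A ([:- z, 1:] * q) v = (- z) *s poly_apply A q v + poly_apply A q (cvec A v)"
    by (simp only: poly_apply_add poly_apply_smult poly_apply_pCons_0)
  also have "\<dots> = poly_apply A q (cvec A v + (- z) *s v)"
    by (simp only: poly_apply_linear add.commute)
  also have "cvec A v + (- z) *s v = cvec A v - z *s v" by (simp add: vec_eq_iff)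
  finally show ?thesis .
qed

text \<open>The vectors \<open>v, Av, A\<^sup>2v, \<dots>\<close> live in a space of finite real dimension, so the first few are linearly dependent or repeat.\<close>
lemma exists_annihilating_poly:
  fixes A :: "real^'n^'n"
  shows "\<exists>p. p \<noteq> 0 \<and> poly_apply A p v = 0"
proof -
  define x where "x k = (cvec A ^^ k) v" for k
  define N where "N = DIM(complex^'n)"
  have "\<exists>a::nat \<Rightarrow> complex. (\<exists>k\<le>N. a k \<noteq> 0) \<and> (\<Sum>k\<le>N. a k *s x k) = 0"
  proof (cases "inj_on x {..N}")
    case True
    have card: "card (x ` {..N}) = Suc N" using card_image[OF True] by simp
    have "DIM(complex^'n) < card (x ` {..N})" unfolding card unfolding N_def by (rule lessI)
    then have "dependent (x ` {..N})"
      by (intro dependent_biggerset)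
    then obtain u where u: "\<exists>w\<in>x ` {..N}. u w \<noteq> 0" "(\<Sum>w\<in>x ` {..N}. u w *\<^sub>R w) = 0"
      unfolding dependent_finite[OF finite_imageI[OF finite_atMost]] by blast
    have "(\<Sum>k\<le>N. u (x k) *\<^sub>R x k) = 0" using u(2) by (simp add: sum.reindex[OF True])
    moreover have "u (x k) *\<^sub>R x k = of_real (u (x k)) *s x k" for k
      by (simp add: vec_eq_iff scaleR_conv_of_real[where 'a=complex])
    ultimately have "(\<Sum>k\<le>N. (of_real (u (x k)) :: complex) *s x k) = 0" by simp
    then show ?thesis using u(1) by (intro exI[of _ "\<lambda>k. of_real (u (x k))"]) auto
  next
    case False
    then obtain i j where ij: "i \<le> N" "j \<le> N" "i \<noteq> j" "x i = x j" by (auto simp: inj_on_def)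
    define a :: "nat \<Rightarrow> complex" where "a k = (if k = i then 1 else 0) - (if k = j then 1 else 0)" for k
    have "a k *s x k = (if k = i then x i else 0) - (if k = j then x j else 0)" for k
      by (auto simp: a_def vec_eq_iff)
    then have "(\<Sum>k\<le>N. a k *s x k) = 0" using ij by (simp add: sum_subtractf)
    moreover have "a i \<noteq> 0" using ij by (simp add: a_def)
    ultimately show ?thesis using ij by blast
  qed
  then obtain a k where a: "k \<le> N" "a k \<noteq> (0::complex)" "(\<Sum>k\<le>N. a k *s x k) = 0" by blast
  define p where "p = (\<Sum>k\<le>N. monom (a k) k)"
  have cf: "coeff p k = (if k \<le> N then a k else 0)" for k
    by (simp add: p_def coeff_sum coeff_monom)
  have "degree p \<le> N" by (rule degree_le) (simp add: cf)
  then have "poly_apply A p v = (\<Sum>k\<le>N. a k *s x k)"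
    by (simp add: poly_apply_altdef cf x_def)
  moreover have "p \<noteq> 0" using cf[of k] a by auto
  ultimately show ?thesis using a by auto
qed

definition exp_decays :: "real^'n^'n \<Rightarrow> complex^'n \<Rightarrow> bool" where
  "exp_decays A v \<longleftrightarrow> (\<exists>C c. 0 < c \<and> (\<forall>s\<ge>0. \<forall>i. norm (cvec (mat_exp (s *\<^sub>R A)) v $ i) \<le> C * exp (- c * s)))"

text \<open>Each component of \<open>e\<^bsup>sA\<^esup>v\<close> solves a scalar equation with rate \<open>z\<close> and the corresponding component of \<open>e\<^bsup>sA\<^esup>(A - z)v\<close> as right-hand side.\<close>
lemma exp_decays_eigen_step:
  assumes w: "exp_decays A (cvec A v - z *s v)" and z: "Re z < 0"
  shows "exp_decays A v"
proof -
  obtain C c where c: "0 < c" and Cc: "\<And>s i. 0 \<le> s \<Longrightarrow>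
      norm (cvec (mat_exp (s *\<^sub>R A)) (cvec A v - z *s v) $ i) \<le> C * exp (- c * s)"
    using w unfolding exp_decays_def by blast
  have "\<exists>C' c'. 0 < c' \<and> (\<forall>s\<ge>0. norm (cvec (mat_exp (s *\<^sub>R A)) v $ i) \<le> C' * exp (- c' * s))" for i
  proof (rule decay_of_scalar_ode[OF _ Cc c z])
    fix s
    have d: "((\<lambda>s. mat_exp (s *\<^sub>R A) $ i $ j) has_real_derivative (mat_exp (s *\<^sub>R A) ** A) $ i $ j) (at s)" for j
      using has_real_derivative_entry[OF mat_exp_scaleR_derivative[of A s], of i j]
      by (simp add: mat_exp_scaleR_commute)
    have "((\<lambda>s. \<Sum>j\<in>UNIV. of_real (mat_exp (s *\<^sub>R A) $ i $ j) * v $ j) has_vector_derivative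
       (\<Sum>j\<in>UNIV. of_real ((mat_exp (s *\<^sub>R A) ** A) $ i $ j) * v $ j)) (at s)"
      by (intro has_vector_derivative_sum has_vector_derivative_mult_left has_vector_derivative_of_real d)
    then have "((\<lambda>s. cvec (mat_exp (s *\<^sub>R A)) v $ i) has_vector_derivative cvec (mat_exp (s *\<^sub>R A) ** A) v $ i) (at s)"
      by (simp add: cvec_component)
    moreover have "cvec (mat_exp (s *\<^sub>R A) ** A) v $ i = z * cvec (mat_exp (s *\<^sub>R A)) v $ i +
        cvec (mat_exp (s *\<^sub>R A)) (cvec A v - z *s v) $ i"
      by (simp add: cvec_mult cvec_linear)
    ultimately show "((\<lambda>s. cvec (mat_exp (s *\<^sub>R A)) v $ i) has_vector_derivative
       z * cvec (mat_exp (s *\<^sub>R A)) v $ i + cvec (mat_exp (s *\<^sub>R A)) (cvec A v - z *s v) $ i) (at s)"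
      by simp
  qed
  then obtain C' c' where c': "\<And>i. 0 < c' i" and
    C': "\<And>i s. 0 \<le> s \<Longrightarrow> norm (cvec (mat_exp (s *\<^sub>R A)) v $ i) \<le> C' i * exp (- c' i * s)"
    by metis
  have C'0: "0 \<le> C' i" for i
  proof -
    have "0 \<le> norm (cvec (mat_exp (0 *\<^sub>R A)) v $ i)" by simp
    also have "\<dots> \<le> C' i" using C'[of 0 i] by simp
    finally show ?thesis .
  qed
  define d where "d = Min (range c')"
  have d: "0 < d" "\<And>i. d \<le> c' i" using c' by (auto simp: d_def)
  have "norm (cvec (mat_exp (s *\<^sub>R A)) v $ i) \<le> (\<Sum>i\<in>UNIV. C' i) * exp (- d * s)" if s: "0 \<le> s" for s i
  proof -
    have "norm (cvec (mat_exp (s *\<^sub>R A)) v $ i) \<le> C' i * exp (- c' i * s)" by (rule C'[OF s])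
    also have "\<dots> \<le> (\<Sum>i\<in>UNIV. C' i) * exp (- d * s)"
      using d s C'0 by (intro mult_mono member_le_sum sum_nonneg) (auto simp: mult_right_mono)
    finally show ?thesis .
  qed
  then show ?thesis unfolding exp_decays_def using d by blast
qed

text \<open>Induction on the degree of a polynomial annihilating \<open>v\<close>. Split off a root \<open>z\<close>. If \<open>z\<close> is an eigenvalue, then
  \<open>(A - z)v\<close> decays by induction and the scalar equation transfers this to \<open>v\<close>. Otherwise \<open>A - z\<close> is injective and
  the factor can be cancelled.\<close>
lemma exp_decays_all:
  assumes B: "\<And>z. complex_eigenvalue B z \<Longrightarrow> Re z < 0"
  shows "exp_decays B v"
proof -
  have "\<forall>v. poly_apply B p v = 0 \<longrightarrow> exp_decays B v" if "degree p = n" "p \<noteq> 0" for p n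
    using that
  proof (induction n arbitrary: p)
    case 0
    show ?case
    proof (intro allI impI)
      fix v assume "poly_apply B p v = 0"
      then have "coeff p 0 *s v = 0" using 0 by (simp add: poly_apply_def)
      moreover have "coeff p 0 \<noteq> 0" using 0 by (metis leading_coeff_0_iff)
      ultimately have "v = 0" by (simp add: vec.scale_eq_0_iff)
      then show "exp_decays B v"
        unfolding exp_decays_def by (intro exI[of _ 0] exI[of _ 1]) (simp add: cvec_linear)
    qed
  next
    case (Suc n)
    have "\<not> constant (poly p)" using Suc.prems by (simp add: constant_degree)
    then obtain z where "poly p z = 0" using fundamental_theorem_of_algebra by blast
    then obtain q where q: "p = [:- z, 1:] * q" by (metis poly_eq_0_iff_dvd dvdE)
    have q0: "q \<noteq> 0" using Suc.prems q by auto
    have "degree p = Suc (degree q)" unfolding q using q0 by (subst degree_mult_eq) auto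
    then have dq: "degree q = n" using Suc.prems by simp
    note IH = Suc.IH[OF dq q0]
    show ?case
    proof (intro allI impI)
      fix v assume v: "poly_apply B p v = 0"
      then have w: "poly_apply B q (cvec B v - z *s v) = 0" by (simp only: q poly_apply_linear_factor)
      show "exp_decays B v"
      proof (cases "complex_eigenvalue B z")
        case True
        then show ?thesis using exp_decays_eigen_step[of B v z] IH w B by blast
      next
        case False
        have "cvec B v - z *s v = cvec B v + (- z) *s v" by (simp add: vec_eq_iff)
        then have "cvec B (poly_apply B q v) + (- z) *s poly_apply B q v = 0"
          using w by (simp only: poly_apply_linear poly_apply_cvec)
        then have "cvec B (poly_apply B q v) = z *s poly_apply B q v"
          by (simp add: vec_eq_iff)
        then have "poly_apply B q v = 0"
          using False unfolding complex_eigenvalue_def cvec_def by blast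
        then show ?thesis using IH by blast
      qed
    qed
  qed
  then show ?thesis using exists_annihilating_poly[of B v] by blast
qed

lemma norm_matrix_le_sum: "norm (M :: real^'n^'m) \<le> (\<Sum>i\<in>UNIV. \<Sum>j\<in>UNIV. \<bar>M $ i $ j\<bar>)"
proof -
  have "norm M \<le> (\<Sum>i\<in>UNIV. norm (M $ i))"
    by (metis norm_vec_def L2_set_le_sum norm_ge_zero)
  also have "\<dots> \<le> (\<Sum>i\<in>UNIV. \<Sum>j\<in>UNIV. \<bar>M $ i $ j\<bar>)"
    by (intro sum_mono norm_le_l1_cart)
  finally show ?thesis .
qed

lemma mat_exp_decay:
  fixes B :: "real^'n^'n"
  assumes B: "\<And>z. complex_eigenvalue B z \<Longrightarrow> Re z < 0"
  obtains C c where "0 < c" "0 < C" "\<And>s. 0 \<le> s \<Longrightarrow> norm (mat_exp (s *\<^sub>R B)) \<le> C * exp (- c * s)"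
proof -
  have "exp_decays B (axis j 1)" for j by (rule exp_decays_all[OF B])
  then have "\<forall>j. \<exists>C c. 0 < c \<and> (\<forall>s\<ge>0. \<forall>i. norm (cvec (mat_exp (s *\<^sub>R B)) (axis j 1) $ i) \<le> C * exp (- c * s))"
    unfolding exp_decays_def by blast
  then obtain C c where c: "\<And>j. 0 < c j" and
    C: "\<And>s i j. 0 \<le> s \<Longrightarrow> norm (cvec (mat_exp (s *\<^sub>R B)) (axis j 1) $ i) \<le> C j * exp (- c j * s)"
    by metis
  have cv: "cvec M (axis j 1) $ i = of_real (M $ i $ j)" for M :: "real^'n^'n" and i j
  proof -
    have "of_real (M $ i $ k) * axis j 1 $ k = (if k = j then complex_of_real (M $ i $ j) else 0)" for k
      by (simp add: axis_def)
    then show ?thesis by (simp add: cvec_component)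
  qed
  have e: "\<bar>mat_exp (s *\<^sub>R B) $ i $ j\<bar> \<le> C j * exp (- c j * s)" if "0 \<le> s" for s i j
    using C[OF that, where i=i and j=j] by (simp only: cv norm_of_real)
  have C0: "0 \<le> C j" for j
    using order_trans[OF abs_ge_zero e[of 0 _ j]] by simp
  define d where "d = Min (range c)"
  have d: "0 < d" "\<And>i. d \<le> c i" using c by (auto simp: d_def)
  define K where "K = (\<Sum>i\<in>(UNIV::'n set). \<Sum>j\<in>UNIV. C j)"
  have K0: "0 \<le> K" using C0 unfolding K_def by (intro sum_nonneg)
  have "norm (mat_exp (s *\<^sub>R B)) \<le> (K + 1) * exp (- d * s)" if s: "0 \<le> s" for s
  proof -
    have "norm (mat_exp (s *\<^sub>R B)) \<le> (\<Sum>i\<in>UNIV. \<Sum>j\<in>UNIV. \<bar>mat_exp (s *\<^sub>R B) $ i $ j\<bar>)"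
      by (rule norm_matrix_le_sum)
    also have "\<dots> \<le> (\<Sum>i\<in>(UNIV::'n set). \<Sum>j\<in>UNIV. C j * exp (- d * s))"
    proof (intro sum_mono)
      fix i j
      have "\<bar>mat_exp (s *\<^sub>R B) $ i $ j\<bar> \<le> C j * exp (- c j * s)" by (rule e[OF s])
      also have "\<dots> \<le> C j * exp (- d * s)"
        using d s C0 by (intro mult_left_mono) (auto simp: mult_right_mono)
      finally show "\<bar>mat_exp (s *\<^sub>R B) $ i $ j\<bar> \<le> C j * exp (- d * s)" .
    qed
    also have "\<dots> = K * exp (- d * s)" by (simp add: K_def sum_distrib_right)
    also have "\<dots> \<le> (K + 1) * exp (- d * s)" by simp
    finally show ?thesis .
  qed
  then show thesis using d K0 by (intro that[of d "K + 1"]) auto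
qed

section \<open>Quadratic forms, determinants and inverses\<close>

lemma inner_transpose: "(A *v x) \<bullet> y = x \<bullet> (transpose A *v y)" for A :: "real^'n^'m"
  by (metis dot_lmul_matrix inner_commute transpose_matrix_vector transpose_transpose)

lemma norm_matrix_vector_le: "norm (M *v x) \<le> norm M * norm x" for M :: "real^'n^'m"
proof -
  have "norm (M *v x) = L2_set (\<lambda>i. norm (M $ i \<bullet> x)) UNIV"
    by (simp add: norm_vec_def matrix_vector_mul_component)
  also have "\<dots> \<le> L2_set (\<lambda>i. norm (M $ i) * norm x) UNIV"
    by (intro L2_set_mono) (auto simp: Cauchy_Schwarz_ineq2)
  also have "\<dots> = norm M * norm x"
    by (simp add: norm_vec_def[of M] L2_set_left_distrib)
  finally show ?thesis .
qed

lemma abs_matrix_form_le: "\<bar>(M *v x) \<bullet> y\<bar> \<le> norm M * norm x * norm y" for M :: "real^'n^'m"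
  using Cauchy_Schwarz_ineq2[of "M *v x" y] norm_matrix_vector_le[of M x]
  by (meson mult_right_mono norm_ge_zero order_trans)

lemma positive_form_bounded_below:
  fixes A :: "real^'n^'n"
  assumes "\<And>x. x \<noteq> 0 \<Longrightarrow> 0 < (A *v x) \<bullet> x"
  obtains c where "0 < c" "\<And>x. c * (norm x)\<^sup>2 \<le> (A *v x) \<bullet> x"
proof -
  have "continuous_on (sphere 0 1) (\<lambda>x. (A *v x) \<bullet> x)"
    by (intro continuous_intros mv.continuous_on)
  moreover have "sphere (0::real^'n) 1 \<noteq> {}" using norm_axis_1 by (metis dist_0_norm mem_sphere empty_iff)
  ultimately obtain y where y: "y \<in> sphere 0 1" "\<And>x. x \<in> sphere 0 1 \<Longrightarrow> (A *v y) \<bullet> y \<le> (A *v x) \<bullet> x"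
    using continuous_attains_inf[of "sphere 0 1" "\<lambda>x. (A *v x) \<bullet> x"] by auto
  show thesis
  proof (rule that[of "(A *v y) \<bullet> y"])
    have "norm y = 1" using y(1) by simp
    then have "y \<noteq> 0" by auto
    then show "0 < (A *v y) \<bullet> y" by (rule assms)
    fix x :: "real^'n"
    show "(A *v y) \<bullet> y * (norm x)\<^sup>2 \<le> (A *v x) \<bullet> x"
    proof (cases "x = 0")
      case False
      define z where "z = (1 / norm x) *\<^sub>R x"
      have "z \<in> sphere 0 1" using False by (simp add: z_def)
      then have "(A *v y) \<bullet> y * (norm x)\<^sup>2 \<le> (A *v z) \<bullet> z * (norm x)\<^sup>2"
        by (intro mult_right_mono y) auto
      also have "(A *v z) \<bullet> z * (norm x)\<^sup>2 = (A *v x) \<bullet> x"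
        using False by (simp add: z_def mv.scaleR_right power2_eq_square)
      finally show ?thesis .
    qed simp
  qed
qed

lemma invertible_of_positive_form:
  fixes A :: "real^'n^'n"
  assumes "\<And>x. x \<noteq> 0 \<Longrightarrow> 0 < (A *v x) \<bullet> x"
  shows "invertible A"
  unfolding invertible_left_inverse matrix_left_invertible_ker
  by (metis assms inner_zero_left less_irrefl)

lemma matrix_inv_cancel:
  fixes A :: "real^'n^'n"
  assumes "invertible A"
  shows "A ** matrix_inv A = mat 1" "matrix_inv A ** A = mat 1"
    "A *v (matrix_inv A *v x) = x" "matrix_inv A *v (A *v x) = x"
proof -
  have "A ** matrix_inv A = mat 1 \<and> matrix_inv A ** A = mat 1"
    using assms unfolding invertible_def matrix_inv_def by (rule someI_ex)
  then show 1: "A ** matrix_inv A = mat 1" "matrix_inv A ** A = mat 1" by auto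
  show "A *v (matrix_inv A *v x) = x" "matrix_inv A *v (A *v x) = x"
    by (simp_all add: matrix_vector_mul_assoc 1)
qed

text \<open>The segment from the identity to \<open>A\<close> consists of invertible matrices, so the determinant cannot change sign along it.\<close>
lemma det_pos_of_positive_form:
  fixes A :: "real^'n^'n"
  assumes A: "\<And>x. x \<noteq> 0 \<Longrightarrow> 0 < (A *v x) \<bullet> x"
  shows "0 < det A"
proof (rule ccontr)
  define M where "M s = (1 - s) *\<^sub>R mat 1 + s *\<^sub>R A" for s :: real
  assume "\<not> 0 < det A"
  then have "det (M 1) \<le> 0" "0 \<le> det (M 0)" by (auto simp: M_def)
  moreover have "continuous_on {0..1} (\<lambda>s. det (M s))"
    unfolding det_def M_def by (intro continuous_intros) 
  ultimately obtain s where s: "0 \<le> s" "s \<le> 1" "det (M s) = 0"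
    using IVT2'[of "\<lambda>s. det (M s)" 1 0 0] by auto
  have "0 < (M s *v x) \<bullet> x" if "x \<noteq> 0" for x
  proof -
    have e: "(M s *v x) \<bullet> x = (1 - s) * (x \<bullet> x) + s * ((A *v x) \<bullet> x)"
      by (simp add: M_def mv.add_left mv.scaleR_left inner_add_left)
    have "0 < x \<bullet> x" "0 < (A *v x) \<bullet> x" using that A by auto
    then show ?thesis unfolding e using s
      by (cases "s = 0") (auto intro!: add_nonneg_pos mult_nonneg_nonneg)
  qed
  then have "invertible (M s)" by (rule invertible_of_positive_form)
  then show False using s by (simp add: invertible_det_nz)
qed

text \<open>The number of summands in the Leibniz formula, used as a crude constant.\<close>
definition det_terms :: "'n::finite itself \<Rightarrow> real" where
  "det_terms _ = real (card {p. p permutes (UNIV::'n set)})"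

lemma det_terms_pos: "0 < det_terms TYPE('n::finite)"
proof -
  have "id \<in> {p. p permutes (UNIV::'n set)}" by (simp add: permutes_id)
  then have "{p. p permutes (UNIV::'n set)} \<noteq> {}" by blast
  then show ?thesis unfolding det_terms_def by (simp add: card_gt_0_iff finite_permutations del: Collect_empty_eq)
qed

lemma abs_sign: "\<bar>of_int (sign p) :: real\<bar> = 1"
  by (simp add: sign_def)

lemma abs_det_le:
  fixes M :: "real^'n^'n"
  assumes "\<And>i j. \<bar>M $ i $ j\<bar> \<le> m"
  shows "\<bar>det M\<bar> \<le> det_terms TYPE('n) * m ^ CARD('n)"
proof -
  have "\<bar>det M\<bar> \<le> (\<Sum>p\<in>{p. p permutes (UNIV::'n set)}. \<bar>of_int (sign p) * (\<Prod>i\<in>UNIV. M $ i $ p i)\<bar>)"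
    unfolding det_def by (rule sum_abs)
  also have "\<dots> \<le> (\<Sum>p\<in>{p. p permutes (UNIV::'n set)}. m ^ CARD('n))"
  proof (rule sum_mono)
    fix p
    have "\<bar>\<Prod>i\<in>UNIV. M $ i $ p i\<bar> \<le> (\<Prod>i\<in>(UNIV::'n set). m)"
      unfolding abs_prod by (rule prod_mono) (simp add: assms)
    then show "\<bar>of_int (sign p) * (\<Prod>i\<in>UNIV. M $ i $ p i)\<bar> \<le> m ^ CARD('n)"
      by (simp add: abs_mult abs_sign)
  qed
  finally show ?thesis by (simp add: det_terms_def)
qed

text \<open>Differentiating the Leibniz formula leaves one factor of the size of the derivative and all others of the size of the matrix; this gains a power over the bound for the determinant itself.\<close>
lemma det_derivative_bound:
  fixes M :: "real \<Rightarrow> real^'n^'n"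
  assumes M': "(M has_vector_derivative M') (at t)"
    and m: "\<And>i j. \<bar>M t $ i $ j\<bar> \<le> m" and m': "\<And>i j. \<bar>M' $ i $ j\<bar> \<le> m'"
  obtains d where "((\<lambda>t. det (M t)) has_real_derivative d) (at t)"
    "\<bar>d\<bar> \<le> det_terms TYPE('n) * (real CARD('n) * m' * m ^ (CARD('n) - 1))"
proof
  define d where "d = (\<Sum>p\<in>{p. p permutes (UNIV::'n set)}. of_int (sign p) *
     (\<Sum>i\<in>UNIV. M' $ i $ p i * (\<Prod>j\<in>UNIV - {i}. M t $ j $ p j)))"
  show "((\<lambda>t. det (M t)) has_real_derivative d) (at t)"
    unfolding det_def d_def
    by (intro DERIV_sum DERIV_cmult has_field_derivative_prod has_real_derivative_entry M')
  have m0: "0 \<le> m" "0 \<le> m'" using order_trans[OF abs_ge_zero m] order_trans[OF abs_ge_zero m'] by auto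
  have "\<bar>d\<bar> \<le> (\<Sum>p\<in>{p. p permutes (UNIV::'n set)}. \<bar>of_int (sign p) *
     (\<Sum>i\<in>UNIV. M' $ i $ p i * (\<Prod>j\<in>UNIV - {i}. M t $ j $ p j))\<bar>)"
    unfolding d_def by (rule sum_abs)
  also have "\<dots> \<le> (\<Sum>p\<in>{p. p permutes (UNIV::'n set)}. real (CARD('n)) * m' * m ^ (CARD('n) - 1))"
  proof (rule sum_mono)
    fix p
    have "\<bar>\<Sum>i\<in>UNIV. M' $ i $ p i * (\<Prod>j\<in>UNIV - {i}. M t $ j $ p j)\<bar> \<le> (\<Sum>i\<in>(UNIV::'n set). m' * m ^ (CARD('n) - 1))"
    proof (rule order_trans[OF sum_abs sum_mono])
      fix i :: 'n
      have "\<bar>\<Prod>j\<in>UNIV - {i}. M t $ j $ p j\<bar> \<le> (\<Prod>j\<in>UNIV - {i}. m)"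
        unfolding abs_prod by (rule prod_mono) (simp add: m)
      also have "\<dots> = m ^ (CARD('n) - 1)" by (simp add: card_Diff_singleton)
      finally show "\<bar>M' $ i $ p i * (\<Prod>j\<in>UNIV - {i}. M t $ j $ p j)\<bar> \<le> m' * m ^ (CARD('n) - 1)"
        unfolding abs_mult using m0 m' by (intro mult_mono) auto
    qed
    then show "\<bar>of_int (sign p) * (\<Sum>i\<in>UNIV. M' $ i $ p i * (\<Prod>j\<in>UNIV - {i}. M t $ j $ p j))\<bar>
       \<le> real (CARD('n)) * m' * m ^ (CARD('n) - 1)"
      by (simp add: abs_mult abs_sign)
  qed
  finally show "\<bar>d\<bar> \<le> det_terms TYPE('n) * (real CARD('n) * m' * m ^ (CARD('n) - 1))"
    by (simp add: det_terms_def)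
qed

text \<open>Pass to the limit in \<open>X\<^sub>s - X\<^sub>t = - X\<^sub>s (M\<^sub>s - M\<^sub>t) X\<^sub>t\<close>. The local bound on the inverses makes them continuous.\<close>
lemma matrix_inv_derivative:
  fixes M :: "real \<Rightarrow> real^'n^'n"
  assumes M': "(M has_vector_derivative M') (at t)"
    and inv: "\<forall>\<^sub>F s in at t. invertible (M s)" "invertible (M t)"
    and bdd: "\<forall>\<^sub>F s in at t. norm (matrix_inv (M s)) \<le> C"
  shows "((\<lambda>s. matrix_inv (M s)) has_vector_derivative
    - (matrix_inv (M t) ** M' ** matrix_inv (M t))) (at t)"
proof -
  define X where "X s = matrix_inv (M s)" for s
  have diff: "X s - X t = - (X s ** (M s - M t) ** X t)" if "invertible (M s)" for s
  proof -
    have "X s ** (M s - M t) ** X t = (X s ** M s) ** X t - X s ** (M t ** X t)"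
      by (simp add: mm.diff_left mm.diff_right matrix_mul_assoc)
    then show ?thesis using that inv by (simp add: X_def matrix_inv_cancel)
  qed
  have quot: "((\<lambda>s. (1 / (s - t)) *\<^sub>R (M s - M t)) \<longlongrightarrow> M') (at t)"
  proof (intro vec_tendstoI)
    fix i j
    have "((\<lambda>s. (M s $ i $ j - M t $ i $ j) / (s - t)) \<longlongrightarrow> M' $ i $ j) (at t)"
      using has_real_derivative_entry[OF M', of i j] by (simp add: has_field_derivative_iff)
    then show "((\<lambda>s. ((1 / (s - t)) *\<^sub>R (M s - M t)) $ i $ j) \<longlongrightarrow> M' $ i $ j) (at t)"
      by (simp add: divide_inverse mult.commute)
  qed
  have Mcont: "((\<lambda>s. M s - M t) \<longlongrightarrow> 0) (at t)"
    using has_vector_derivative_continuous[OF M'] by (simp add: continuous_at LIM_zero_iff isCont_def)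
  have Xcont: "(X \<longlongrightarrow> X t) (at t)"
  proof -
    obtain K where K: "0 < K" "\<And>a b. norm (a ** b :: real^'n^'n) \<le> norm a * norm (b :: real^'n^'n) * K"
      using mm.pos_bounded by blast
    have "((\<lambda>s. X s - X t) \<longlongrightarrow> 0) (at t)"
    proof (rule Lim_null_comparison)
      show "\<forall>\<^sub>F s in at t. norm (X s - X t) \<le> ((C * norm (M s - M t) * K) * norm (X t)) * K"
        using inv(1) bdd
      proof eventually_elim
        case (elim s)
        have "norm (X s - X t) = norm ((X s ** (M s - M t)) ** X t)" using diff[OF elim(1)] by simp
        also have "\<dots> \<le> norm (X s ** (M s - M t)) * norm (X t) * K" by (rule K)
        also have "\<dots> \<le> (norm (X s) * norm (M s - M t) * K) * norm (X t) * K"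
          using K by (intro mult_right_mono) auto
        also have "\<dots> \<le> (C * norm (M s - M t) * K) * norm (X t) * K"
          using K elim(2) by (intro mult_right_mono) (auto simp: X_def)
        finally show ?case by (simp add: mult_ac)
      qed
      have "((\<lambda>s. norm (M s - M t)) \<longlongrightarrow> 0) (at t)" by (rule tendsto_norm_zero[OF Mcont])
      then have "((\<lambda>s. ((C * norm (M s - M t) * K) * norm (X t)) * K) \<longlongrightarrow> ((C * 0 * K) * norm (X t)) * K) (at t)"
        by (intro tendsto_mult tendsto_const)
      then show "((\<lambda>s. ((C * norm (M s - M t) * K) * norm (X t)) * K) \<longlongrightarrow> 0) (at t)" by simp
    qed
    then show ?thesis by (simp add: LIM_zero_iff)
  qed
  have lim: "((\<lambda>s. - (X s ** ((1 / (s - t)) *\<^sub>R (M s - M t)) ** X t)) \<longlongrightarrow> - (X t ** M' ** X t)) (at t)"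
    by (intro tendsto_minus mm.tendsto Xcont quot tendsto_const)
  have "(X has_vector_derivative - (X t ** M' ** X t)) (at t)"
  proof (rule has_vector_derivative_entrywise)
    fix i j
    have "((\<lambda>s. (- (X s ** ((1 / (s - t)) *\<^sub>R (M s - M t)) ** X t)) $ i $ j) \<longlongrightarrow> (- (X t ** M' ** X t)) $ i $ j) (at t)"
      using lim by (intro tendsto_vec_nth)
    moreover have "\<forall>\<^sub>F s in at t. (- (X s ** ((1 / (s - t)) *\<^sub>R (M s - M t)) ** X t)) $ i $ j
        = (X s $ i $ j - X t $ i $ j) / (s - t)"
      using inv(1)
    proof eventually_elim
      case (elim s)
      have "- (X s ** ((1 / (s - t)) *\<^sub>R (M s - M t)) ** X t) = (1 / (s - t)) *\<^sub>R (X s - X t)"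
        unfolding diff[OF elim] by (simp add: mm.scaleR_left mm.scaleR_right)
      then have "(- (X s ** ((1 / (s - t)) *\<^sub>R (M s - M t)) ** X t)) $ i $ j = ((1 / (s - t)) *\<^sub>R (X s - X t)) $ i $ j"
        by (simp only:)
      then show ?case by simp
    qed
    ultimately show "((\<lambda>s. X s $ i $ j) has_real_derivative (- (X t ** M' ** X t)) $ i $ j) (at t)"
      unfolding has_field_derivative_iff by (rule Lim_transform_eventually)
  qed
  then show ?thesis by (simp add: X_def[abs_def])
qed

text \<open>Inversion reverses the order of positive forms. Expanding \<open>0 \<le> \<langle>M(a - b), a - b\<rangle>\<close> with \<open>a = M\<^sup>-\<^sup>1w\<close> and
  \<open>b = N\<^sup>-\<^sup>1w/k\<close> gives the inequality directly, without square roots of matrices.\<close>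
lemma matrix_inv_form_compare:
  fixes M N :: "real^'n^'n"
  assumes M: "transpose M = M" "\<And>x. 0 \<le> (M *v x) \<bullet> x" "invertible M"
    and N: "invertible N" and k: "0 < k" and le: "\<And>x. (M *v x) \<bullet> x \<le> k * ((N *v x) \<bullet> x)"
  shows "(1 / k) * ((matrix_inv N *v w) \<bullet> w) \<le> (matrix_inv M *v w) \<bullet> w"
proof -
  define a where "a = matrix_inv M *v w"
  define y where "y = matrix_inv N *v w"
  define b where "b = (1 / k) *\<^sub>R y"
  have Ma: "M *v a = w" and Ny: "N *v y = w" using M N by (simp_all add: a_def y_def matrix_inv_cancel)
  have sym: "(M *v b) \<bullet> a = (M *v a) \<bullet> b" using inner_transpose[of M b a] M by (simp add: inner_commute)
  have "0 \<le> (M *v (a - b)) \<bullet> (a - b)" by (rule M)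
  also have "\<dots> = w \<bullet> a - 2 * (w \<bullet> b) + (M *v b) \<bullet> b"
    using sym by (simp add: mv.diff_right inner_diff_left inner_diff_right Ma)
  also have "\<dots> \<le> w \<bullet> a - 2 * (w \<bullet> b) + k * ((N *v b) \<bullet> b)" using le[of b] by simp
  also have "(N *v b) \<bullet> b = (1 / k)\<^sup>2 * (w \<bullet> y)" by (simp add: b_def mv.scaleR_right Ny power2_eq_square)
  also have "w \<bullet> b = (1 / k) * (w \<bullet> y)" by (simp add: b_def)
  also have "w \<bullet> a - 2 * ((1 / k) * (w \<bullet> y)) + k * ((1 / k)\<^sup>2 * (w \<bullet> y)) = w \<bullet> a - (1 / k) * (w \<bullet> y)"
    using k by (simp add: power2_eq_square field_simps)
  finally show ?thesis by (simp add: a_def y_def inner_commute)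
qed

section \<open>The covariance matrices\<close>

locale stable_drift =
  fixes Q B :: "real^'n^'n"
  assumes Q: "symmetric_pos_def Q"
    and B: "\<And>z. complex_eigenvalue B z \<Longrightarrow> Re z < 0"
begin

definition expB :: "real \<Rightarrow> real^'n^'n" where "expB t = mat_exp (t *\<^sub>R B)"

definition cov_rate :: "real \<Rightarrow> real^'n^'n" where "cov_rate s = expB s ** Q ** transpose (expB s)"

definition Qt :: "real \<Rightarrow> real^'n^'n" where "Qt t = Qcov Q B (ereal t)"

definition Qi :: "real^'n^'n" where "Qi = Qcov Q B \<infinity>"

lemma expB_0: "expB 0 = mat 1" by (simp add: expB_def)

lemma expB_add: "expB (s + t) = expB s ** expB t" by (simp add: expB_def mat_exp_scaleR_add)

lemma expB_transpose_add: "transpose (expB s) *v (transpose (expB t) *v x) = transpose (expB (s + t)) *v x"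
  by (simp add: matrix_vector_mul_assoc add.commute[of s t] expB_add matrix_transpose_mul del: transpose_matrix_vector)

lemma expB_transpose_0: "transpose (expB 0) *v x = x"
  by (simp add: expB_0 transpose_mat del: transpose_matrix_vector)

lemma continuous_on_expB: "continuous_on S expB"
  unfolding expB_def[abs_def] by (rule continuous_on_mat_exp)

lemma continuous_on_transpose_expB: "continuous_on S (\<lambda>s. transpose (expB s))"
  by (rule bounded_linear.continuous_on[OF bounded_linear_transpose continuous_on_expB])

lemma continuous_on_cov_rate: "continuous_on S cov_rate"
  unfolding cov_rate_def[abs_def]
  by (intro mm.continuous_on continuous_on_expB continuous_on_transpose_expB continuous_on_const)

lemma cov_rate_shift: "cov_rate (t + s) = expB t ** cov_rate s ** transpose (expB t)"
  by (simp add: cov_rate_def expB_add matrix_transpose_mul matrix_mul_assoc)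

lemma cov_rate_form: "(cov_rate s *v v) \<bullet> v = (Q *v (transpose (expB s) *v v)) \<bullet> (transpose (expB s) *v v)"
  unfolding cov_rate_def matrix_vector_mul_assoc[symmetric] by (rule inner_transpose)

lemma cov_rate_symmetric: "transpose (cov_rate s) = cov_rate s"
  using Q by (simp add: cov_rate_def matrix_transpose_mul matrix_mul_assoc symmetric_pos_def_def)

lemma norm_transpose: "norm (transpose M) = norm M" for M :: "real^'p^'m"
proof -
  have "(norm (transpose M))\<^sup>2 = (norm M)\<^sup>2"
    unfolding power2_norm_eq_inner inner_vec_def transpose_def by (simp, rule sum.swap)
  then show ?thesis by simp
qed

lemma cov_rate_decay: obtains C c where "0 < c" "0 < C" "\<And>s. 0 \<le> s \<Longrightarrow> norm (cov_rate s) \<le> C * exp (- c * s)"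
proof -
  obtain C c where c: "0 < c" "0 < C" "\<And>s. 0 \<le> s \<Longrightarrow> norm (expB s) \<le> C * exp (- c * s)"
    using mat_exp_decay[OF B] unfolding expB_def by metis
  obtain K where K: "0 < K" "\<And>a b. norm (a ** b :: real^'n^'n) \<le> norm a * norm (b :: real^'n^'n) * K"
    using mm.pos_bounded by blast
  show thesis
  proof (rule that[of "2 * c" "C * C * (norm Q + 1) * K * K"])
    show "0 < 2 * c" using c by simp
    show "0 < C * C * (norm Q + 1) * K * K" using c K by (auto intro!: mult_pos_pos add_nonneg_pos)
    fix s :: real assume s: "0 \<le> s"
    have "norm (cov_rate s) \<le> norm (expB s ** Q) * norm (expB s) * K"
      unfolding cov_rate_def using K(2)[of "expB s ** Q" "transpose (expB s)"] by (simp add: norm_transpose)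
    also have "\<dots> \<le> (norm (expB s) * (norm Q + 1) * K) * norm (expB s) * K"
    proof -
      have "norm (expB s ** Q) \<le> norm (expB s) * norm Q * K" by (rule K(2))
      also have "\<dots> \<le> norm (expB s) * (norm Q + 1) * K" using K by (intro mult_right_mono mult_left_mono) auto
      finally show ?thesis using K by (intro mult_right_mono) auto
    qed
    also have "\<dots> = (norm (expB s) * norm (expB s)) * ((norm Q + 1) * K * K)" by (simp add: mult_ac)
    also have "\<dots> \<le> ((C * exp (- c * s)) * (C * exp (- c * s))) * ((norm Q + 1) * K * K)"
      using c s K by (intro mult_right_mono mult_mono) auto
    also have "\<dots> = C * C * (norm Q + 1) * K * K * (exp (- c * s) * exp (- c * s))"
      by (simp add: mult_ac)
    also have "exp (- c * s) * exp (- c * s) = exp (- (2 * c) * s)"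
      by (simp flip: exp_add)
    finally show "norm (cov_rate s) \<le> C * C * (norm Q + 1) * K * K * exp (- (2 * c) * s)" .
  qed
qed

lemma cov_rate_integrable: "0 \<le> a \<Longrightarrow> cov_rate integrable_on {a..}"
proof -
  assume a: "0 \<le> a"
  obtain C c where c: "0 < c" "0 < C" "\<And>s. 0 \<le> s \<Longrightarrow> norm (cov_rate s) \<le> C * exp (- c * s)"
    by (rule cov_rate_decay) blast
  have "(\<lambda>s. C * exp (- c * s)) integrable_on {a..}"
    using has_integral_mult_right[OF has_integral_exp_minus_to_infinity[OF c(1), of a], of C]
    by (auto simp: integrable_on_def)
  then show ?thesis
    by (rule measurable_bounded_by_integrable_imp_integrable[rotated])
      (use c a in \<open>auto intro!: continuous_imp_measurable_on_sets_lebesgue continuous_on_cov_rate\<close>)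
qed

lemma cov_rate_integrable_interval: "cov_rate integrable_on {a..b}"
  by (intro integrable_continuous_real continuous_on_cov_rate)

lemma Qt_eq: "Qt t = integral {0..t} cov_rate"
proof -
  have "{s::real. 0 \<le> s \<and> ereal s \<le> ereal t} = {0..t}" by auto
  then show ?thesis by (simp add: Qt_def Qcov_def cov_rate_def[abs_def] expB_def mat_exp_transpose flip: transpose_scalar)
qed

lemma Qi_eq: "Qi = integral {0..} cov_rate"
proof -
  have "{s::real. 0 \<le> s \<and> ereal s \<le> \<infinity>} = {0..}" by auto
  then show ?thesis by (simp add: Qi_def Qcov_def cov_rate_def[abs_def] expB_def mat_exp_transpose flip: transpose_scalar)
qed

text \<open>The tail of the defining integral is dominated by the tail of an exponential.\<close>
lemma Qt_tendsto: "(Qt \<longlongrightarrow> Qi) at_top"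
proof -
  obtain C c where c: "0 < c" "0 < C" "\<And>s. 0 \<le> s \<Longrightarrow> norm (cov_rate s) \<le> C * exp (- c * s)"
    by (rule cov_rate_decay) blast
  have "((\<lambda>t. Qt t - Qi) \<longlongrightarrow> 0) at_top"
  proof (rule Lim_null_comparison)
    show "\<forall>\<^sub>F t in at_top. norm (Qt t - Qi) \<le> C * (exp (- c * t) / c)"
      using eventually_ge_at_top[of 0]
    proof eventually_elim
      case (elim t)
      have u: "{0..} = {0..t} \<union> {t..}" using elim by auto
      have "{0..t} \<inter> {t..} = {t}" using elim by auto
      then have "integral ({0..t} \<union> {t..}) cov_rate = integral {0..t} cov_rate + integral {t..} cov_rate"
        using elim by (intro integral_Un cov_rate_integrable cov_rate_integrable_interval) auto
      then have "Qi - Qt t = integral {t..} cov_rate"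
        unfolding Qi_eq Qt_eq u[symmetric] by simp
      moreover have "norm (integral {t..} cov_rate) \<le> C * (exp (- c * t) / c)"
      proof -
        have h: "((\<lambda>s. C * exp (- c * s)) has_integral C * (exp (- c * t) / c)) {t..}"
          by (rule has_integral_mult_right[OF has_integral_exp_minus_to_infinity[OF c(1)]])
        have "norm (integral {t..} cov_rate) \<le> integral {t..} (\<lambda>s. C * exp (- c * s))"
          using h c elim by (intro integral_norm_bound_integral cov_rate_integrable) (auto simp: integrable_on_def)
        then show ?thesis using integral_unique[OF h] by simp
      qed
      ultimately show ?case by (simp add: norm_minus_commute)
    qed
    have "((\<lambda>t. exp (- c * t)) \<longlongrightarrow> 0) at_top"
    proof -
      have "filterlim (\<lambda>t. - c * t) at_bot at_top"
        using c by (simp add: filterlim_uminus_at_bot filterlim_tendsto_pos_mult_at_top[OF tendsto_const] filterlim_ident)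
      then show ?thesis by (rule filterlim_compose[OF exp_at_bot])
    qed
    then have "((\<lambda>t. C * (exp (- c * t) / c)) \<longlongrightarrow> C * (0 / c)) at_top"
      using c by (intro tendsto_intros) auto
    then show "((\<lambda>t. C * (exp (- c * t) / c)) \<longlongrightarrow> 0) at_top" by simp
  qed
  then show ?thesis by (simp add: LIM_zero_iff)
qed

lemma Qt_shift:
  assumes "0 \<le> t" "0 \<le> s"
  shows "Qt (t + s) - Qt t = expB t ** Qt s ** transpose (expB t)"
proof -
  have "Qt t + integral {t..t + s} cov_rate = Qt (t + s)"
    unfolding Qt_eq using assms by (intro Henstock_Kurzweil_Integration.integral_combine cov_rate_integrable_interval) auto
  moreover have "integral {t..t + s} cov_rate = integral {0..s} (cov_rate \<circ> (\<lambda>x. x + t))"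
    using integral_shift[of 0 t s cov_rate] continuous_on_cov_rate by (simp add: add.commute)
  moreover have "integral {0..s} (cov_rate \<circ> (\<lambda>x. x + t)) = expB t ** Qt s ** transpose (expB t)"
  proof -
    have bl: "bounded_linear (\<lambda>M. expB t ** M ** transpose (expB t))"
      using bounded_linear_compose[OF mm.bounded_linear_left mm.bounded_linear_right] .
    have "cov_rate \<circ> (\<lambda>x. x + t) = (\<lambda>M. expB t ** M ** transpose (expB t)) \<circ> cov_rate"
      by (simp add: o_def fun_eq_iff cov_rate_shift add.commute[of _ t])
    then show ?thesis
      using integral_linear[OF cov_rate_integrable_interval bl, of 0 s] by (simp add: Qt_eq)
  qed
  ultimately show ?thesis by (simp add: algebra_simps)
qed

text \<open>The substitution \<open>s \<mapsto> t + s\<close> in the covariance integral, carried out on bounded intervals and then passed to the limit.\<close>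
lemma Qi_minus_Qt:
  assumes "0 \<le> t"
  shows "Qi - Qt t = expB t ** Qi ** transpose (expB t)"
proof -
  have "((\<lambda>s. Qt (t + s) - Qt t) \<longlongrightarrow> Qi - Qt t) at_top"
    by (intro tendsto_diff tendsto_const filterlim_compose[OF Qt_tendsto]
        filterlim_tendsto_add_at_top[OF tendsto_const] filterlim_ident)
  moreover have "\<forall>\<^sub>F s in at_top. Qt (t + s) - Qt t = expB t ** Qt s ** transpose (expB t)"
    using eventually_ge_at_top[of 0] by eventually_elim (rule Qt_shift[OF assms])
  ultimately have 1: "((\<lambda>s. expB t ** Qt s ** transpose (expB t)) \<longlongrightarrow> Qi - Qt t) at_top"
    by (rule Lim_transform_eventually)
  have 2: "((\<lambda>s. expB t ** Qt s ** transpose (expB t)) \<longlongrightarrow> expB t ** Qi ** transpose (expB t)) at_top"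
    by (intro mm.tendsto tendsto_const Qt_tendsto)
  show ?thesis by (rule tendsto_unique[OF _ 1 2]) simp
qed

lemma Qt_symmetric: "transpose (Qt t) = Qt t"
proof -
  have "transpose \<circ> cov_rate = cov_rate" by (simp add: o_def fun_eq_iff cov_rate_symmetric)
  then show ?thesis
    using integral_linear[OF cov_rate_integrable_interval bounded_linear_transpose, of 0 t] by (simp add: Qt_eq)
qed

lemma expB_bounded: obtains K where "1 \<le> K" "\<And>s. \<bar>s\<bar> \<le> 2 \<Longrightarrow> norm (expB s) \<le> K"
proof -
  have "compact (expB ` {-2..2})" by (intro compact_continuous_image continuous_on_expB) auto
  then have "bounded (expB ` {-2..2})" by (rule compact_imp_bounded)
  then obtain K where "\<And>s. s \<in> {-2..2} \<Longrightarrow> norm (expB s) \<le> K" unfolding bounded_iff by blast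
  then show thesis by (intro that[of "max 1 K"]) (auto simp: abs_le_iff le_max_iff_disj)
qed

lemma expB_transpose_bounds: obtains K where "1 \<le> K" "\<And>s v. \<bar>s\<bar> \<le> 2 \<Longrightarrow> norm (transpose (expB s) *v v) \<le> K * norm v"
  "\<And>s v. \<bar>s\<bar> \<le> 2 \<Longrightarrow> norm v \<le> K * norm (transpose (expB s) *v v)"
proof -
  obtain K where K: "1 \<le> K" "\<And>s. \<bar>s\<bar> \<le> 2 \<Longrightarrow> norm (expB s) \<le> K" by (rule expB_bounded) blast
  have u: "norm (transpose (expB s) *v v) \<le> K * norm v" if "\<bar>s\<bar> \<le> 2" for s v
    using norm_matrix_vector_le[of "transpose (expB s)" v] K(2)[OF that]
    by (smt (verit) mult_right_mono norm_ge_zero norm_transpose)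
  have "norm v \<le> K * norm (transpose (expB s) *v v)" if "\<bar>s\<bar> \<le> 2" for s v
    using u[of "- s" "transpose (expB s) *v v"] that unfolding expB_transpose_add by (simp add: expB_transpose_0 del: transpose_matrix_vector)
  then show thesis using that u K by blast
qed

lemma form_integral: "(Qt t *v v) \<bullet> v = integral {0..t} (\<lambda>s. (cov_rate s *v v) \<bullet> v)"
  "(\<lambda>s. (cov_rate s *v v) \<bullet> v) integrable_on {0..t}"
proof -
  have "bounded_linear (\<lambda>M :: real^'n^'n. (M *v v) \<bullet> v)"
    using bounded_linear_compose[OF bounded_linear_inner_left mv.bounded_linear_left] .
  from integral_linear[OF cov_rate_integrable_interval this, of 0 t] integrable_linear[OF cov_rate_integrable_interval this, of 0 t]
  show "(Qt t *v v) \<bullet> v = integral {0..t} (\<lambda>s. (cov_rate s *v v) \<bullet> v)" "(\<lambda>s. (cov_rate s *v v) \<bullet> v) integrable_on {0..t}"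
    by (simp_all add: o_def Qt_eq)
qed

lemma Q_lower: obtains c where "0 < c" "\<And>x. c * (norm x)\<^sup>2 \<le> (Q *v x) \<bullet> x"
  using positive_form_bounded_below[of Q] Q unfolding symmetric_pos_def_def by metis

lemma Qt_lower: obtains c where "0 < c" "\<And>t v. 0 \<le> t \<Longrightarrow> t \<le> 2 \<Longrightarrow> c * t * (norm v)\<^sup>2 \<le> (Qt t *v v) \<bullet> v"
proof -
  obtain c where c: "0 < c" "\<And>x. c * (norm x)\<^sup>2 \<le> (Q *v x) \<bullet> x" by (rule Q_lower) blast
  obtain K where K: "1 \<le> K" "\<And>s v. \<bar>s\<bar> \<le> 2 \<Longrightarrow> norm v \<le> K * norm (transpose (expB s) *v v)"
    by (rule expB_transpose_bounds) blast
  have Fl: "c / K\<^sup>2 * (norm v)\<^sup>2 \<le> (cov_rate s *v v) \<bullet> v" if "\<bar>s\<bar> \<le> 2" for s v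
  proof -
    have "(norm v)\<^sup>2 \<le> (K * norm (transpose (expB s) *v v))\<^sup>2" by (intro power_mono K that) auto
    then have "c / K\<^sup>2 * (norm v)\<^sup>2 \<le> c / K\<^sup>2 * (K * norm (transpose (expB s) *v v))\<^sup>2"
      using c by (intro mult_left_mono) auto
    also have "\<dots> = c * (norm (transpose (expB s) *v v))\<^sup>2" using K by (simp add: power_mult_distrib)
    also have "\<dots> \<le> (cov_rate s *v v) \<bullet> v" unfolding cov_rate_form by (rule c)
    finally show ?thesis .
  qed
  show thesis
  proof (rule that[of "c / K\<^sup>2"])
    show "0 < c / K\<^sup>2" using c K by simp
    fix t v assume t: "0 \<le> t" "t \<le> (2::real)"
    have "integral {0..t} (\<lambda>s. c / K\<^sup>2 * (norm v)\<^sup>2) \<le> integral {0..t} (\<lambda>s. (cov_rate s *v v) \<bullet> v)"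
      using t by (intro integral_le form_integral Fl) auto
    then show "c / K\<^sup>2 * t * (norm v)\<^sup>2 \<le> (Qt t *v v) \<bullet> v" using t by (simp add: form_integral mult_ac)
  qed
qed

lemma cov_rate_bounded: obtains C where "0 < C" "\<And>s. 0 \<le> s \<Longrightarrow> norm (cov_rate s) \<le> C"
proof -
  obtain C c where c: "0 < c" "0 < C" "\<And>s. 0 \<le> s \<Longrightarrow> norm (cov_rate s) \<le> C * exp (- c * s)"
    by (rule cov_rate_decay) blast
  have "norm (cov_rate s) \<le> C" if "0 \<le> s" for s
  proof -
    have "C * exp (- c * s) \<le> C * 1" using c that by (intro mult_left_mono) auto
    then show ?thesis using c(3)[OF that] by simp
  qed
  then show thesis using that c by blast
qed

lemma Qt_upper: obtains C where "0 < C" "\<And>t. 0 \<le> t \<Longrightarrow> norm (Qt t) \<le> C * t"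
proof -
  obtain C where C: "0 < C" "\<And>s. 0 \<le> s \<Longrightarrow> norm (cov_rate s) \<le> C" by (rule cov_rate_bounded) blast
  have "norm (Qt t) \<le> C * (t - 0)" if "0 \<le> t" for t
    unfolding Qt_eq using that by (intro integral_bound continuous_on_cov_rate C) auto
  then show thesis using that C by simp
qed

lemma Qt_nonneg: "0 \<le> t \<Longrightarrow> 0 \<le> (Qt t *v v) \<bullet> v"
proof -
  assume "0 \<le> t"
  have "0 \<le> (cov_rate s *v v) \<bullet> v" for s
    unfolding cov_rate_form using Q_lower by (metis mult_nonneg_nonneg zero_le_power2 less_imp_le order_trans)
  then show ?thesis unfolding form_integral by (intro integral_nonneg form_integral) auto
qed

text \<open>The form version of \<open>Q\<^sub>\<infinity> = Q\<^sub>t + e\<^bsup>tB\<^esup> Q\<^sub>\<infinity> e\<^bsup>tB*\<^esup>\<close>. It yields the lower bound for \<open>Q\<^sub>\<infinity>\<close>, the gap between the inverse covariances and the growth of \<open>R\<close> along trajectories.\<close>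
lemma Qi_form: "0 \<le> t \<Longrightarrow> (Qi *v v) \<bullet> v = (Qt t *v v) \<bullet> v + (Qi *v (transpose (expB t) *v v)) \<bullet> (transpose (expB t) *v v)"
proof -
  assume "0 \<le> t"
  then have "Qi = Qt t + expB t ** Qi ** transpose (expB t)" using Qi_minus_Qt[of t] by (simp add: algebra_simps)
  then have "(Qi *v v) \<bullet> v = ((Qt t + expB t ** Qi ** transpose (expB t)) *v v) \<bullet> v" by simp
  also have "\<dots> = (Qt t *v v) \<bullet> v + (expB t *v (Qi *v (transpose (expB t) *v v))) \<bullet> v"
    by (simp only: mv.add_left inner_add_left matrix_vector_mul_assoc[symmetric])
  also have "(expB t *v (Qi *v (transpose (expB t) *v v))) \<bullet> v = (Qi *v (transpose (expB t) *v v)) \<bullet> (transpose (expB t) *v v)"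
    by (rule inner_transpose)
  finally show ?thesis .
qed

lemma Qi_lower: obtains c where "0 < c" "\<And>v. c * (norm v)\<^sup>2 \<le> (Qi *v v) \<bullet> v"
proof -
  obtain c where c: "0 < c" "\<And>t v. 0 \<le> t \<Longrightarrow> t \<le> 2 \<Longrightarrow> c * t * (norm v)\<^sup>2 \<le> (Qt t *v v) \<bullet> v" by (rule Qt_lower) blast
  have "0 \<le> (Qi *v v) \<bullet> v" for v
  proof (rule tendsto_lowerbound)
    show "((\<lambda>t. (Qt t *v v) \<bullet> v) \<longlongrightarrow> (Qi *v v) \<bullet> v) at_top"
      by (intro tendsto_inner mv.tendsto Qt_tendsto tendsto_const)
    show "\<forall>\<^sub>F t in at_top. 0 \<le> (Qt t *v v) \<bullet> v"
      using eventually_ge_at_top[of 0] by eventually_elim (rule Qt_nonneg)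
  qed simp
  then have "c * 1 * (norm v)\<^sup>2 \<le> (Qi *v v) \<bullet> v" for v
    using c(2)[of 1 v] Qi_form[of 1 v] by (smt (verit))
  then show thesis using that c by simp
qed

lemma Qi_pos: "v \<noteq> 0 \<Longrightarrow> 0 < (Qi *v v) \<bullet> v"
proof -
  assume "v \<noteq> 0"
  obtain c where c: "0 < c" "\<And>v. c * (norm v)\<^sup>2 \<le> (Qi *v v) \<bullet> v" by (rule Qi_lower) blast
  have "0 < c * (norm v)\<^sup>2" using c \<open>v \<noteq> 0\<close> by simp
  then show ?thesis using c(2)[of v] by simp
qed

lemma Qt_pos: "0 < t \<Longrightarrow> t \<le> 2 \<Longrightarrow> v \<noteq> 0 \<Longrightarrow> 0 < (Qt t *v v) \<bullet> v"
proof -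
  assume t: "0 < t" "t \<le> 2" and v: "v \<noteq> 0"
  obtain c where c: "0 < c" "\<And>t v. 0 \<le> t \<Longrightarrow> t \<le> 2 \<Longrightarrow> c * t * (norm v)\<^sup>2 \<le> (Qt t *v v) \<bullet> v" by (rule Qt_lower) blast
  have "0 < c * t * (norm v)\<^sup>2" using c v t by simp
  then show ?thesis using c(2)[of t v] t by simp
qed

definition Qt_inv :: "real \<Rightarrow> real^'n^'n" where "Qt_inv t = matrix_inv (Qt t)"
definition Qi_inv :: "real^'n^'n" where "Qi_inv = matrix_inv Qi"

lemma Qi_invertible: "invertible Qi" by (rule invertible_of_positive_form[OF Qi_pos])
lemma Qt_invertible: "0 < t \<Longrightarrow> t \<le> 2 \<Longrightarrow> invertible (Qt t)"
  by (rule invertible_of_positive_form[OF Qt_pos])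

lemmas Qi_cancel = matrix_inv_cancel[OF Qi_invertible, folded Qi_inv_def]
lemmas Qt_cancel = matrix_inv_cancel[OF Qt_invertible, folded Qt_inv_def]

lemma Qi_inv_form: "(Qi_inv *v w) \<bullet> w = (Qi *v (Qi_inv *v w)) \<bullet> (Qi_inv *v w)"
  by (simp add: Qi_cancel inner_commute)

lemma Qi_inv_lower: obtains c where "0 < c" "\<And>w. c * (norm w)\<^sup>2 \<le> (Qi_inv *v w) \<bullet> w"
proof (rule positive_form_bounded_below)
  fix w :: "real^'n" assume "w \<noteq> 0"
  then have "Qi_inv *v w \<noteq> 0" by (metis Qi_cancel(3) matrix_vector_mult_0_right)
  then show "0 < (Qi_inv *v w) \<bullet> w" unfolding Qi_inv_form by (rule Qi_pos)
qed blast

lemma Qt_inv_upper: obtains C where "0 < C" "\<And>t w. 0 < t \<Longrightarrow> t \<le> 2 \<Longrightarrow> norm (Qt_inv t *v w) \<le> C / t * norm w"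
proof -
  obtain c where c: "0 < c" "\<And>t v. 0 \<le> t \<Longrightarrow> t \<le> 2 \<Longrightarrow> c * t * (norm v)\<^sup>2 \<le> (Qt t *v v) \<bullet> v" by (rule Qt_lower) blast
  have "norm (Qt_inv t *v w) \<le> (1 / c) / t * norm w" if t: "0 < t" "t \<le> 2" for t w
  proof (cases "Qt_inv t *v w = 0")
    case False
    have "c * t * (norm (Qt_inv t *v w))\<^sup>2 \<le> (Qt t *v (Qt_inv t *v w)) \<bullet> (Qt_inv t *v w)" using c t by simp
    also have "\<dots> = w \<bullet> (Qt_inv t *v w)" using t by (simp add: Qt_cancel)
    also have "\<dots> \<le> norm w * norm (Qt_inv t *v w)" by (rule norm_cauchy_schwarz)
    finally have "(c * t * norm (Qt_inv t *v w)) * norm (Qt_inv t *v w) \<le> norm w * norm (Qt_inv t *v w)"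
      by (simp add: power2_eq_square mult_ac)
    then have "c * t * norm (Qt_inv t *v w) \<le> norm w" using False by simp
    then show ?thesis using c t by (simp add: field_simps)
  qed (use c t in auto)
  then show thesis using that[of "1 / c"] c by simp
qed

text \<open>The gap \<open>Q\<^sub>\<infinity> - Q\<^sub>t = e\<^bsup>tB\<^esup> Q\<^sub>\<infinity> e\<^bsup>tB*\<^esup>\<close> is bounded below while \<open>Q\<^sub>t\<close> is at most a multiple of \<open>t\<close>. So
  \<open>(1 + d/t) Q\<^sub>t \<le> Q\<^sub>\<infinity>\<close>, and inverting gives \<open>Q\<^sub>t\<^sup>-\<^sup>1 - Q\<^sub>\<infinity>\<^sup>-\<^sup>1 \<ge> (d/t) Q\<^sub>\<infinity>\<^sup>-\<^sup>1\<close>.\<close>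
lemma form_difference_lower: obtains c where "0 < c"
  "\<And>t w. 0 < t \<Longrightarrow> t \<le> 1 \<Longrightarrow> c / t * (norm w)\<^sup>2 \<le> ((Qt_inv t - Qi_inv) *v w) \<bullet> w"
proof -
  obtain ci where ci: "0 < ci" "\<And>v. ci * (norm v)\<^sup>2 \<le> (Qi *v v) \<bullet> v" by (rule Qi_lower) blast
  obtain cy where cy: "0 < cy" "\<And>v. cy * (norm v)\<^sup>2 \<le> (Qi_inv *v v) \<bullet> v" by (rule Qi_inv_lower) blast
  obtain C where C: "0 < C" "\<And>t. 0 \<le> t \<Longrightarrow> norm (Qt t) \<le> C * t" by (rule Qt_upper) blast
  obtain K where K: "1 \<le> K" "\<And>s v. \<bar>s\<bar> \<le> 2 \<Longrightarrow> norm v \<le> K * norm (transpose (expB s) *v v)"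
    by (rule expB_transpose_bounds) blast
  define d where "d = ci / K\<^sup>2 / C"
  have d: "0 < d" using ci K C by (simp add: d_def)
  have le: "(Qt t *v v) \<bullet> v \<le> 1 / (1 + d / t) * ((Qi *v v) \<bullet> v)" if t: "0 < t" "t \<le> 1" for t v
  proof -
    let ?w = "transpose (expB t) *v v"
    have "(Qt t *v v) \<bullet> v \<le> norm (Qt t) * norm v * norm v"
      using abs_matrix_form_le[of "Qt t" v v] by simp
    also have "\<dots> \<le> C * t * norm v * norm v" using C(2)[of t] t by (intro mult_right_mono) auto
    finally have "d / t * ((Qt t *v v) \<bullet> v) \<le> d / t * (C * t * norm v * norm v)"
      using d t by (intro mult_left_mono) auto
    also have "\<dots> = ci / K\<^sup>2 * (norm v)\<^sup>2" using t C by (simp add: d_def power2_eq_square)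
    also have "\<dots> \<le> ci / K\<^sup>2 * (K * norm ?w)\<^sup>2"
      using K(2)[of t v] t ci by (intro mult_left_mono power_mono) auto
    also have "\<dots> = ci * (norm ?w)\<^sup>2" using K by (simp add: power_mult_distrib)
    also have "\<dots> \<le> (Qi *v ?w) \<bullet> ?w" by (rule ci)
    finally have "(1 + d / t) * ((Qt t *v v) \<bullet> v) \<le> (Qi *v v) \<bullet> v"
      using Qi_form[of t v] t by (simp add: algebra_simps)
    moreover have "0 < 1 + d / t" using d t by (simp add: add_pos_pos)
    ultimately show ?thesis by (simp add: pos_le_divide_eq mult.commute)
  qed
  have main: "d / t * ((Qi_inv *v w) \<bullet> w) \<le> ((Qt_inv t - Qi_inv) *v w) \<bullet> w" if t: "0 < t" "t \<le> 1" for t w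
  proof -
    have "0 < 1 / (1 + d / t)" using d t by (simp add: add_pos_pos)
    from matrix_inv_form_compare[OF Qt_symmetric[of t] Qt_nonneg Qt_invertible Qi_invertible this le, of w] t
    show ?thesis by (simp add: Qt_inv_def Qi_inv_def mv.diff_left inner_diff_left algebra_simps)
  qed
  show thesis
  proof (rule that[of "d * cy"])
    show "0 < d * cy" using d cy by simp
    fix t :: real and w :: "real^'n" assume t: "0 < t" "t \<le> 1"
    have "d * cy / t * (norm w)\<^sup>2 = d / t * (cy * (norm w)\<^sup>2)" by simp
    also have "\<dots> \<le> d / t * ((Qi_inv *v w) \<bullet> w)" using d t cy by (intro mult_left_mono) auto
    also have "\<dots> \<le> ((Qt_inv t - Qi_inv) *v w) \<bullet> w" by (rule main[OF t])
    finally show "d * cy / t * (norm w)\<^sup>2 \<le> ((Qt_inv t - Qi_inv) *v w) \<bullet> w" .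
  qed
qed

end

section \<open>Integral estimates\<close>

lemma nn_integral_lborel_translate:
  fixes g :: "'a::euclidean_space \<Rightarrow> ennreal"
  assumes [measurable]: "g \<in> borel_measurable borel"
  shows "(\<integral>\<^sup>+x. g (x + c) \<partial>lborel) = (\<integral>\<^sup>+x. g x \<partial>lborel)"
proof -
  have "(\<integral>\<^sup>+x. g x \<partial>lborel) = (\<integral>\<^sup>+x. g x \<partial>(distr lborel borel ((+) c)))"
    by (simp add: lborel_distr_plus)
  also have "\<dots> = (\<integral>\<^sup>+x. g (c + x) \<partial>lborel)"
    by (subst nn_integral_distr) auto
  finally show ?thesis by (simp add: add.commute)
qed

text \<open>The uniqueness argument for Haar measure, with an inequality at the end. By translation invariance and Fubini, the
  product of \<open>\<integral>g(Tx)dx\<close> and \<open>\<integral>h\<close> equals that of \<open>\<integral>g\<close> and \<open>\<integral>h(-Tx)dx\<close>; with \<open>h\<close> the indicator of the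
  unit ball, the last integrand lives on the ball of radius \<open>L\<close>.\<close>
lemma nn_integral_linear_substitution_le:
  fixes T :: "'a::euclidean_space \<Rightarrow> 'a" and g :: "'a \<Rightarrow> ennreal"
  assumes T: "linear T" and L: "\<And>x. norm x \<le> L * norm (T x)" and L0: "0 \<le> L"
    and [measurable]: "g \<in> borel_measurable borel"
  shows "(\<integral>\<^sup>+x. g (T x) \<partial>lborel) \<le> ennreal (L ^ DIM('a)) * (\<integral>\<^sup>+x. g x \<partial>lborel)"
proof -
  define h :: "'a \<Rightarrow> ennreal" where "h = indicator (cball 0 1)"
  have hm[measurable]: "h \<in> borel_measurable borel"
    unfolding h_def by (intro borel_measurable_indicator) simp
  have Tc: "continuous_on UNIV T" by (rule linear_continuous_on) (rule linear_conv_bounded_linear[THEN iffD1, OF T])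
  have Tm[measurable]: "T \<in> borel_measurable borel" by (rule borel_measurable_continuous_onI[OF Tc])
  have inj: "inj T"
    unfolding linear_injective_0[OF T] using L by (metis mult_zero_right norm_le_zero_iff norm_zero)
  then have surj: "surj T" by (rule linear_inj_imp_surj[OF T])
  define V where "V = unit_ball_vol (real DIM('a))"
  have Vpos: "V > 0" by (simp add: V_def)
  have int_h: "(\<integral>\<^sup>+y. h y \<partial>lborel) = ennreal V"
    by (simp add: h_def emeasure_cball V_def)
  have trT: "(\<integral>\<^sup>+x. f (T x + y) \<partial>lborel) = (\<integral>\<^sup>+x. f (T x) \<partial>lborel)"
    if [measurable]: "f \<in> borel_measurable borel" for f :: "'a \<Rightarrow> ennreal" and y
  proof -
    obtain z where z: "y = T z" using surj by blast
    have "(\<integral>\<^sup>+x. f (T x + y) \<partial>lborel) = (\<integral>\<^sup>+x. f (T (x + z)) \<partial>lborel)"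
      by (simp add: z linear_add[OF T])
    also have "\<dots> = (\<integral>\<^sup>+x. f (T x) \<partial>lborel)"
      by (rule nn_integral_lborel_translate[where g="\<lambda>x. f (T x)"]) measurable
    finally show ?thesis .
  qed
  have hT: "(\<integral>\<^sup>+x. h (y - T x) \<partial>lborel) \<le> ennreal (L ^ DIM('a) * V)" for y
  proof -
    have "(\<integral>\<^sup>+x. h (y - T x) \<partial>lborel) = (\<integral>\<^sup>+x. h (- T x) \<partial>lborel)"
    proof -
      have "(\<lambda>w. h (- (w + - y))) = (\<lambda>w. h (y - w))" by simp
      then show ?thesis using trT[of "\<lambda>w. h (- w)" "- y"] by simp
    qed
    also have "\<dots> \<le> (\<integral>\<^sup>+x. indicator (cball 0 L) (x :: 'a) \<partial>lborel)"
    proof -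
      have "h (- T x) \<le> indicator (cball 0 L) x" for x
      proof (cases "norm (T x) \<le> 1")
        case True
        have "norm x \<le> L * norm (T x)" by (rule L)
        also have "\<dots> \<le> L * 1" using True L0 by (rule mult_left_mono)
        finally show ?thesis by (simp add: h_def indicator_def)
      next
        case False
        then show ?thesis by (simp add: h_def)
      qed
      then show ?thesis by (intro nn_integral_mono) simp
    qed
    also have "\<dots> = ennreal (V * L ^ DIM('a))"
      using L0 by (simp add: emeasure_cball V_def)
    finally show ?thesis by (simp add: mult.commute)
  qed
  have "ennreal V * (\<integral>\<^sup>+x. g (T x) \<partial>lborel) = (\<integral>\<^sup>+y. h y * (\<integral>\<^sup>+x. g (T x) \<partial>lborel) \<partial>lborel)"
    by (simp add: nn_integral_multc int_h)
  also have "\<dots> = (\<integral>\<^sup>+y. (\<integral>\<^sup>+x. h y * g (T x + y) \<partial>lborel) \<partial>lborel)"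
    by (simp add: nn_integral_cmult trT)
  also have "\<dots> = (\<integral>\<^sup>+x. (\<integral>\<^sup>+y. h y * g (T x + y) \<partial>lborel) \<partial>lborel)"
    by (rule lborel_pair.Fubini') measurable
  also have "\<dots> = (\<integral>\<^sup>+x. (\<integral>\<^sup>+y. h (y - T x) * g y \<partial>lborel) \<partial>lborel)"
  proof (rule nn_integral_cong)
    fix x :: 'a
    have "(\<integral>\<^sup>+y. h (y + T x - T x) * g (y + T x) \<partial>lborel) = (\<integral>\<^sup>+y. h (y - T x) * g y \<partial>lborel)"
      by (rule nn_integral_lborel_translate[where g="\<lambda>y. h (y - T x) * g y"]) measurable
    then show "(\<integral>\<^sup>+y. h y * g (T x + y) \<partial>lborel) = (\<integral>\<^sup>+y. h (y - T x) * g y \<partial>lborel)"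
      by (simp add: add.commute)
  qed
  also have "\<dots> = (\<integral>\<^sup>+y. (\<integral>\<^sup>+x. h (y - T x) * g y \<partial>lborel) \<partial>lborel)"
    by (rule lborel_pair.Fubini') measurable
  also have "\<dots> = (\<integral>\<^sup>+y. (\<integral>\<^sup>+x. h (y - T x) \<partial>lborel) * g y \<partial>lborel)"
    by (simp add: nn_integral_multc)
  also have "\<dots> \<le> (\<integral>\<^sup>+y. ennreal (L ^ DIM('a) * V) * g y \<partial>lborel)"
    by (intro nn_integral_mono mult_right_mono hT) auto
  also have "\<dots> = ennreal (L ^ DIM('a) * V) * (\<integral>\<^sup>+y. g y \<partial>lborel)"
    by (simp add: nn_integral_cmult)
  also have "\<dots> = ennreal V * (ennreal (L ^ DIM('a)) * (\<integral>\<^sup>+y. g y \<partial>lborel))"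
    using L0 Vpos by (simp add: ennreal_mult mult_ac)
  finally have "ennreal V * (\<integral>\<^sup>+x. g (T x) \<partial>lborel)
      \<le> ennreal V * (ennreal (L ^ DIM('a)) * (\<integral>\<^sup>+y. g y \<partial>lborel))" .
  then show ?thesis
    using Vpos by (subst (asm) ennreal_mult_le_mult_iff) auto
qed

text \<open>Dyadic shells of radius \<open>b 2\<^sup>k\<close> around \<open>u\<close> contribute a geometric series in which \<open>b\<close> cancels.\<close>
lemma nn_integral_inverse_power_le:
  fixes u :: "'a::euclidean_space"
  assumes b: "0 < b"
  shows "(\<integral>\<^sup>+z. ennreal (b / (b + norm (u - z)) ^ Suc (DIM('a))) \<partial>lborel)
     \<le> ennreal (2 ^ Suc (DIM('a)) * unit_ball_vol (real DIM('a)))"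
proof -
  define n where "n = DIM('a)"
  define V where "V = unit_ball_vol (real DIM('a))"
  have V0: "V \<ge> 0" by (simp add: V_def)
  define c where "c k = b / (b * 2 ^ k) ^ Suc n" for k :: nat
  define S where "S k = cball u (b * 2 ^ Suc k)" for k :: nat
  have [measurable]: "S k \<in> sets borel" for k by (simp add: S_def)
  have c0: "c k \<ge> 0" for k using b by (simp add: c_def)
  have pt: "ennreal (b / (b + norm (u - z)) ^ Suc n) \<le> (\<Sum>k. ennreal (c k) * indicator (S k) z)" for z
  proof -
    define r where "r = 1 + norm (u - z) / b"
    have r1: "r \<ge> 1" using b by (simp add: r_def)
    define k where "k = nat \<lfloor>log 2 r\<rfloor>"
    have l0: "log 2 r \<ge> 0" using r1 by simp
    have k1: "real k \<le> log 2 r" using l0 by (simp add: k_def)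
    have k2: "log 2 r < real k + 1" using l0 unfolding k_def by linarith
    have "2 powr (real k) \<le> r" using k1 r1 by (simp add: le_log_iff)
    then have lo: "2 ^ k \<le> r" by (simp add: powr_realpow)
    have "r < 2 powr (real (Suc k))" using k2 r1 by (simp add: log_less_iff add.commute)
    then have hi: "r \<le> 2 ^ Suc k" by (metis less_imp_le powr_realpow zero_less_numeral)
    have br: "b * r = b + norm (u - z)" using b by (simp add: r_def field_simps)
    have "norm (u - z) \<le> b * 2 ^ Suc k"
    proof -
      have "norm (u - z) \<le> b * r" using br b by linarith
      also have "\<dots> \<le> b * 2 ^ Suc k" using hi b by (intro mult_left_mono) auto
      finally show ?thesis .
    qed
    then have inS: "z \<in> S k" by (simp add: S_def dist_norm)
    have "b / (b + norm (u - z)) ^ Suc n \<le> c k"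
      unfolding c_def br[symmetric]
      using lo b r1 by (intro divide_left_mono power_mono mult_left_mono mult_pos_pos zero_less_power) auto
    then have "ennreal (b / (b + norm (u - z)) ^ Suc n) \<le> ennreal (c k) * indicator (S k) z"
      using inS by (simp add: ennreal_leI)
    also have "\<dots> \<le> (\<Sum>k. ennreal (c k) * indicator (S k) z)"
    proof -
      have sgl: "(\<Sum>j\<in>{k}. F j) = F k" for F :: "nat \<Rightarrow> ennreal" by simp
      show ?thesis
        using sum_le_suminf[of "\<lambda>k. ennreal (c k) * indicator (S k) z" "{k}"] unfolding sgl by simp
    qed
    finally show ?thesis .
  qed
  have "(\<integral>\<^sup>+z. ennreal (b / (b + norm (u - z)) ^ Suc n) \<partial>lborel)
      \<le> (\<integral>\<^sup>+z. (\<Sum>k. ennreal (c k) * indicator (S k) z) \<partial>lborel)"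
    by (intro nn_integral_mono pt)
  also have "\<dots> = (\<Sum>k. \<integral>\<^sup>+z. ennreal (c k) * indicator (S k) z \<partial>lborel)"
    by (rule nn_integral_suminf) measurable
  also have "\<dots> = (\<Sum>k. ennreal (2 ^ n * V * (1/2) ^ k))"
  proof (rule suminf_cong)
    fix k
    have "(\<integral>\<^sup>+z. ennreal (c k) * indicator (S k) z \<partial>lborel) = ennreal (c k) * emeasure lborel (S k)"
      by (subst nn_integral_cmult_indicator) (simp_all add: S_def)
    also have "emeasure lborel (S k) = ennreal (V * (b * 2 ^ Suc k) ^ n)"
      using b by (simp add: S_def emeasure_cball V_def n_def)
    also have "ennreal (c k) * \<dots> = ennreal (c k * (V * (b * 2 ^ Suc k) ^ n))"
      using c0 V0 b by (simp add: ennreal_mult)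
    also have "c k * (V * (b * 2 ^ Suc k) ^ n) = 2 ^ n * V * (1/2) ^ k"
    proof -
      have "b * (b * 2 ^ Suc k) ^ n = 2 ^ n * (b * (b * 2 ^ k) ^ n)"
        by (simp add: power_mult_distrib)
      moreover have "(b * 2 ^ k) ^ Suc n = 2 ^ k * (b * (b * 2 ^ k) ^ n)" by simp
      moreover have "b * (b * 2 ^ k) ^ n > 0" using b by simp
      ultimately show ?thesis
        using b unfolding c_def by (simp add: power_divide field_simps)
    qed
    finally show "(\<integral>\<^sup>+z. ennreal (c k) * indicator (S k) z \<partial>lborel) = ennreal (2 ^ n * V * (1/2) ^ k)" .
  qed
  also have "\<dots> = ennreal (2 ^ n * V * 2)"
  proof (rule suminf_ennreal_eq)
    show "0 \<le> 2 ^ n * V * (1/2) ^ k" for k using V0 by simp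
    show "(\<lambda>k. 2 ^ n * V * (1/2) ^ k) sums (2 ^ n * V * 2)"
      using geometric_sums[of "1/2::real"] by (intro sums_mult) simp
  qed
  finally show ?thesis by (simp add: n_def V_def mult_ac)
qed

text \<open>At the infimum \<open>s0\<close> of \<open>S\<close> the value of \<open>e\<^bsup>-h\<^esup>\<close> is essentially at most \<open>A\<close>, and from there on it decays at rate
  \<open>k\<close>. Since \<open>S\<close> lies in the unit interval, one may also use the rate \<open>1 + k\<close>, which keeps the bound finite for \<open>k = 0\<close>.\<close>
lemma nn_integral_exp_minus_growth_le:
  fixes h :: "real \<Rightarrow> real"
  assumes S: "S \<subseteq> {0..1}" "S \<in> sets borel" and k: "0 \<le> k" and A0: "0 \<le> A"
    and A: "\<And>s. s \<in> S \<Longrightarrow> exp (- h s) \<le> A"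
    and h: "\<And>s s'. 0 \<le> s \<Longrightarrow> s \<le> s' \<Longrightarrow> s' \<le> 1 \<Longrightarrow> h s + k * (s' - s) \<le> h s'"
  shows "(\<integral>\<^sup>+s. ennreal (exp (- h s)) * indicator S s \<partial>lborel) \<le> ennreal (exp 2 * A / (1 + k))"
proof (cases "S = {}")
  case True
  then show ?thesis by simp
next
  case False
  define s0 where "s0 = Inf S"
  have bdd: "bdd_below S" using S by (meson atLeastAtMost_iff bdd_below.I subset_iff)
  have s0: "s0 \<le> s" if "s \<in> S" for s unfolding s0_def by (rule cInf_lower[OF that bdd])
  have s0ge: "0 \<le> s0" unfolding s0_def using False S by (intro cInf_greatest) auto
  \<comment> \<open>The infimum need not be attained. A point of \<open>S\<close> within \<open>1/k\<close> of it costs one factor \<open>e\<close>; passing to the rate \<open>1 + k\<close> costs another.\<close>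
  obtain s1 where s1: "s1 \<in> S" "k * (s1 - s0) \<le> 1"
  proof (cases "k = 0")
    case True
    then show ?thesis using that False by auto
  next
    case kn: False
    have "Inf S < s0 + 1 / k" using k kn by (simp add: s0_def)
    then obtain s1 where "s1 \<in> S" "s1 < s0 + 1 / k"
      using cInf_lessD[OF False] by blast
    then show ?thesis using that[of s1] k kn by (auto simp: field_simps)
  qed
  have key: "exp (- h s) \<le> exp 2 * A * exp (- (1 + k) * (s - s0))" if sS: "s \<in> S" for s
  proof -
    have ss: "s - s0 \<le> 1" "0 \<le> s - s0" using s0ge s0[OF sS] S sS by auto
    have 1: "exp (- h s) \<le> A * exp (1 - k * (s - s0))"
    proof (cases "s1 \<le> s")
      case True
      have "h s1 + k * (s - s1) \<le> h s" using S s1 sS True by (intro h) auto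
      then have "exp (- h s) \<le> exp (- h s1) * exp (- (k * (s - s1)))"
        by (simp flip: exp_add)
      also have "\<dots> \<le> A * exp (- (k * (s - s1)))"
        by (intro mult_right_mono A s1) auto
      also have "\<dots> \<le> A * exp (1 - k * (s - s0))"
        using s1(2) A0 by (intro mult_left_mono) (auto simp: algebra_simps)
      finally show ?thesis .
    next
      case False
      have "k * (s - s0) \<le> k * (s1 - s0)" using False k by (intro mult_left_mono) auto
      then have "1 \<le> exp (1 - k * (s - s0))" using s1(2) by simp
      then have "A * 1 \<le> A * exp (1 - k * (s - s0))" using A0 by (rule mult_left_mono)
      then show ?thesis using A[OF sS] by simp
    qed
    also have "A * exp (1 - k * (s - s0)) \<le> A * exp (2 - (1 + k) * (s - s0))"
      using ss A0 by (intro mult_left_mono) (auto simp: algebra_simps)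
    also have "\<dots> = exp 2 * A * exp (- (1 + k) * (s - s0))"
    proof -
      have "exp (2 - x) = exp 2 * exp (- x)" for x :: real by (simp flip: exp_add)
      moreover have e: "- (1 + k) * (s - s0) = - ((1 + k) * (s - s0))" by (simp add: algebra_simps)
      ultimately show ?thesis unfolding e by (simp only: ac_simps)
    qed
    finally show ?thesis .
  qed
  have "((\<lambda>x. exp (-(1+k)*x)) has_integral exp (-(1+k) * s0)/(1+k)) {s0..}"
    using k by (intro has_integral_exp_minus_to_infinity) auto
  then have "((\<lambda>x. (exp 2 * A * exp ((1+k) * s0)) * exp (-(1+k)*x)) has_integral
      (exp 2 * A * exp ((1+k) * s0)) * (exp (-(1+k) * s0)/(1+k))) {s0..}"
    by (rule has_integral_mult_right)
  moreover have "(exp 2 * A * exp ((1+k) * s0)) * (exp (-(1+k) * s0)/(1+k)) = exp 2 * A / (1 + k)"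
  proof -
    have "exp ((1+k) * s0) * exp (-(1+k) * s0) = 1" by (simp flip: exp_add add: algebra_simps)
    then show ?thesis by (simp add: mult.assoc)
  qed
  moreover have "(exp 2 * A * exp ((1+k) * s0)) * exp (-(1+k)*x) = exp 2 * A * exp (-(1+k)*(x - s0))" for x
    by (simp add: algebra_simps flip: exp_add)
  ultimately have I: "((\<lambda>x. exp 2 * A * exp (-(1+k)*(x - s0))) has_integral exp 2 * A / (1 + k)) {s0..}"
    by (simp only:)
  have "(\<integral>\<^sup>+s. ennreal (exp (- h s)) * indicator S s \<partial>lborel)
      \<le> (\<integral>\<^sup>+x\<in>{s0..}. ennreal (exp 2 * A * exp (-(1+k)*(x - s0))) \<partial>lborel)"
  proof (rule nn_integral_mono)
    fix s
    show "ennreal (exp (- h s)) * indicator S s \<le> ennreal (exp 2 * A * exp (-(1+k)*(s - s0))) * indicator {s0..} s"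
    proof (cases "s \<in> S")
      case True
      then show ?thesis using key[OF True] s0[OF True] by (simp only: indicator_simps atLeast_iff mult_1_right ennreal_leI)
    qed simp
  qed
  also have "\<dots> = ennreal (exp 2 * A / (1 + k))"
  proof -
    have "(\<integral>\<^sup>+x\<in>{s0..}. ennreal (exp 2 * A * exp (-(1+k)*(x - s0))) \<partial>lborel)
       = (\<integral>\<^sup>+x. ennreal (indicator {s0..} x * (exp 2 * A * exp (-(1+k)*(x - s0)))) \<partial>lborel)"
      by (rule nn_integral_cong) (simp add: indicator_def)
    also have "\<dots> = ennreal (exp 2 * A / (1 + k))"
      using A0 by (intro nn_integral_has_integral_lebesgue[OF _ I]) auto
    finally show ?thesis .
  qed
  finally show ?thesis .
qed

section \<open>Tubes along an expanding flow\<close>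

text \<open>The power \<open>n + 1\<close> makes the weight integrable in \<open>z\<close> with integral comparable to \<open>1 + \<bar>x\<bar>\<close>; the core radius \<open>1/(1 + \<bar>x\<bar>)\<close> is the distance over which \<open>R\<close> changes by a constant near \<open>x\<close>.\<close>
definition tube_weight :: "'a::euclidean_space \<Rightarrow> 'a \<Rightarrow> real" where
  "tube_weight x z = 1 / (1 / (1 + norm x) + norm z) ^ Suc (DIM('a))"

lemma tube_weight_nonneg: "0 \<le> tube_weight x z"
  by (simp add: tube_weight_def)

lemma continuous_on_tube_weight: "continuous_on UNIV (\<lambda>p::'a::euclidean_space \<times> 'a. tube_weight (fst p) (snd p))"
proof -
  have "1 + norm x \<noteq> 0" "1 / (1 + norm x) + norm z \<noteq> 0" for x z :: 'a
    by (smt (verit) norm_ge_zero divide_pos_pos zero_less_one)+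
  then show ?thesis
    unfolding tube_weight_def by (intro continuous_intros) auto
qed

lemma tube_weight_measurable[measurable]:
  assumes [measurable]: "f \<in> borel_measurable M" "g \<in> borel_measurable M"
  shows "(\<lambda>x. tube_weight (f x) (g x :: 'a::euclidean_space)) \<in> borel_measurable M"
  by (rule borel_measurable_continuous_Pair[OF assms continuous_on_tube_weight])

lemma tube_weight_compare:
  fixes x y :: "'a::euclidean_space"
  assumes "norm x \<le> L * norm y" "1 \<le> L"
  shows "tube_weight x z \<le> L ^ Suc (DIM('a)) * tube_weight y z"
proof -
  have L: "1 + norm x \<le> L * (1 + norm y)" using assms by (simp add: algebra_simps)
  have p: "0 < 1 + norm x" "0 < 1 + norm y" "0 < 1 / (1 + norm x)" "0 < 1 / (1 + norm y)"
    by (auto intro: add_pos_nonneg)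
  have "1 / (1 + norm y) \<le> L * (1 / (1 + norm x))"
    using L p by (simp add: field_simps)
  moreover have "norm z \<le> L * norm z" using assms(2) by (simp add: mult_le_cancel_right1)
  ultimately have "1 / (1 + norm y) + norm z \<le> L * (1 / (1 + norm x) + norm z)"
    by (simp add: algebra_simps)
  then have "(1 / (1 + norm y) + norm z) ^ Suc DIM('a) \<le> L ^ Suc DIM('a) * (1 / (1 + norm x) + norm z) ^ Suc DIM('a)"
    unfolding power_mult_distrib[symmetric] using p by (intro power_mono) auto
  moreover have "0 < (1 / (1 + norm y) + norm z) ^ Suc DIM('a)" "0 < (1 / (1 + norm x) + norm z) ^ Suc DIM('a)"
    using p by (intro zero_less_power add_pos_nonneg norm_ge_zero; simp)+
  ultimately show ?thesis
    unfolding tube_weight_def by (simp add: divide_simps mult.commute del: power_Suc)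
qed

text \<open>Removes the dependence of the core radius on \<open>y\<close>, so that \<open>z\<close> can become the variable of integration. If \<open>\<bar>z\<bar>\<close> is
  small compared with \<open>1 + \<bar>u\<bar>\<close>, then \<open>\<bar>y\<bar>\<close> and \<open>\<bar>u\<bar>\<close> are comparable and so are the two radii; otherwise
  \<open>\<bar>z\<bar>\<close> is bounded away from zero and the weight is comparable to \<open>\<bar>z\<bar>\<^bsup>-n-1\<^esup>\<close>.\<close>
lemma tube_weight_dominated:
  fixes y u z :: "'a::euclidean_space"
  assumes L: "1 \<le> L" and z: "norm (u - z) \<le> L * norm y" "norm y \<le> L * norm (u - z)"
  shows "1 / (1 + norm y) * tube_weight y z \<le> (4 * L) ^ Suc (Suc (DIM('a))) *
    ((1 / (1 + norm u)) / ((1 / (1 + norm u)) + norm z) ^ Suc (DIM('a)) + 1 / (1 + norm z) ^ Suc (DIM('a)))"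
proof -
  define N where "N = Suc (DIM('a))"
  define a where "a = 1 / (1 + norm y)"
  define b where "b = 1 / (1 + norm u)"
  have y0: "0 < 1 + norm y" and u0: "0 < 1 + norm u" by (auto intro: add_pos_nonneg)
  have a: "0 < a" "a \<le> 1" using y0 by (auto simp: a_def)
  have b: "0 < b" using u0 by (auto simp: b_def)
  have uz: "norm u \<le> norm (u - z) + norm z" by (metis norm_triangle_sub add.commute)
  have uz2: "norm (u - z) \<le> norm u + norm z" by (rule norm_triangle_ineq4)
  show ?thesis
  proof (cases "norm z \<le> (1 + norm u) / 2")
    case True
    have "norm z \<le> 1/2 + norm u / 2" using True by (simp add: field_simps)
    then have "1 + norm u \<le> 2 * (1 + L * norm y)" using uz z(1) by (smt (verit) field_sum_of_halves)
    also have "\<dots> \<le> 2 * (L * (1 + norm y))" using L by (simp add: algebra_simps)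
    finally have 1: "a \<le> 2 * L * b" using y0 u0 unfolding a_def b_def by (simp add: field_simps)
    have "norm y \<le> L * (norm u + norm z)" using z(2) uz2 L by (smt (verit) mult_left_mono)
    also have "\<dots> \<le> L * (norm u + (1 + norm u) / 2)" using True L by (intro mult_left_mono) auto
    finally have "1 + norm y \<le> 1 + L * (norm u + (1 + norm u) / 2)" by simp
    also have "\<dots> \<le> L + L * (norm u + (1 + norm u) / 2)" using L by simp
    also have "\<dots> \<le> L * (2 * (1 + norm u))" using L by (simp add: algebra_simps)
    finally have 2: "b \<le> 2 * L * a" using y0 u0 unfolding a_def b_def by (simp add: field_simps)
    have "b + norm z \<le> 2 * L * (a + norm z)"
    proof -
      have "norm z \<le> 2 * L * norm z" using L by (simp add: mult_le_cancel_right1)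
      then show ?thesis using 2 by (simp add: algebra_simps)
    qed
    then have 3: "(b + norm z) ^ N \<le> (2 * L) ^ N * (a + norm z) ^ N"
      unfolding power_mult_distrib[symmetric] using b by (intro power_mono) auto
    have pos: "0 < (a + norm z) ^ N" "0 < (b + norm z) ^ N"
      using a b by (auto intro!: zero_less_power add_pos_nonneg)
    have "1 / (a + norm z) ^ N \<le> (2 * L) ^ N / (b + norm z) ^ N"
      using 3 pos by (simp add: divide_simps mult.commute)
    then have "a * (1 / (a + norm z) ^ N) \<le> (2 * L * b) * ((2 * L) ^ N / (b + norm z) ^ N)"
      using 1 a b L pos by (intro mult_mono) auto
    also have "\<dots> = (2 * L) ^ Suc N * (b / (b + norm z) ^ N)" by simp
    also have "\<dots> \<le> (4 * L) ^ Suc N * (b / (b + norm z) ^ N)"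
      using L b pos by (intro mult_right_mono power_mono) auto
    also have "\<dots> \<le> (4 * L) ^ Suc N * (b / (b + norm z) ^ N + 1 / (1 + norm z) ^ N)"
      using L by (intro mult_left_mono) auto
    finally show ?thesis by (simp add: tube_weight_def a_def b_def N_def)
  next
    case False
    then have "1 + norm u < 2 * norm z" by (simp add: field_simps)
    then have zh: "norm z \<ge> 1/2" by (smt (verit) norm_ge_zero field_sum_of_halves)
    have "1 + norm z \<le> 4 * (a + norm z)" using zh a by simp
    then have 3: "(1 + norm z) ^ N \<le> 4 ^ N * (a + norm z) ^ N"
      unfolding power_mult_distrib[symmetric] by (intro power_mono) auto
    have pos: "0 < (a + norm z) ^ N" "0 < (1 + norm z) ^ N"
      using a by (auto intro!: zero_less_power add_pos_nonneg)
    have "1 / (a + norm z) ^ N \<le> 4 ^ N / (1 + norm z) ^ N"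
      using 3 pos by (simp add: divide_simps mult.commute)
    then have "a * (1 / (a + norm z) ^ N) \<le> 1 * (4 ^ N / (1 + norm z) ^ N)"
      using a pos by (intro mult_mono) auto
    also have "\<dots> \<le> (4 * L) ^ Suc N * (1 / (1 + norm z) ^ N)"
    proof -
      have "(4::real) ^ N \<le> (4 * L) ^ N" using L by (intro power_mono) auto
      also have "\<dots> \<le> (4 * L) ^ Suc N" using L by (intro power_increasing) auto
      finally show ?thesis using pos by (simp add: divide_right_mono)
    qed
    also have "\<dots> \<le> (4 * L) ^ Suc N * (b / (b + norm z) ^ N + 1 / (1 + norm z) ^ N)"
      using L b by (intro mult_left_mono) auto
    finally show ?thesis by (simp add: tube_weight_def a_def b_def N_def)
  qed
qed

text \<open>The value of the constant is immaterial; what matters is that it depends only on the dimension and on \<open>L\<close>.\<close>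
definition tube_const :: "'a::euclidean_space itself \<Rightarrow> real \<Rightarrow> real" where
  "tube_const _ L = L ^ DIM('a) * ((4 * L) ^ Suc (Suc (DIM('a))) * (2 * (2 ^ Suc (DIM('a)) * unit_ball_vol (real DIM('a)))))"

lemma nn_integral_tube_weight_le:
  fixes D :: "'a::euclidean_space \<Rightarrow> 'a"
  assumes D: "linear D" and L: "1 \<le> L" "\<And>x. norm (D x) \<le> L * norm x" "\<And>x. norm x \<le> L * norm (D x)"
  shows "(\<integral>\<^sup>+y. ennreal (1 / (1 + norm y) * tube_weight y (u - D y)) \<partial>lborel)
    \<le> ennreal (tube_const TYPE('a) L)"
proof -
  define N where "N = Suc (DIM('a))"
  define C where "C = (4 * L) ^ Suc N"
  define K where "K = 2 ^ N * unit_ball_vol (real DIM('a))"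
  define b where "b = 1 / (1 + norm u)"
  define g where "g v = ennreal C * (ennreal (b / (b + norm (u - v)) ^ N) + ennreal (1 / (1 + norm (u - v)) ^ N))" for v
  have C0: "0 \<le> C" using L by (simp add: C_def)
  have K0: "0 \<le> K" by (simp add: K_def)
  have b0: "0 < b" by (simp add: b_def add_pos_nonneg)
  have gm[measurable]: "g \<in> borel_measurable borel" unfolding g_def by measurable
  have "(\<integral>\<^sup>+y. ennreal (1 / (1 + norm y) * tube_weight y (u - D y)) \<partial>lborel)
      \<le> (\<integral>\<^sup>+y. g (D y) \<partial>lborel)"
  proof (rule nn_integral_mono)
    fix y :: 'a
    have "1 / (1 + norm y) * tube_weight y (u - D y) \<le> C *
      (b / (b + norm (u - D y)) ^ N + 1 / (1 + norm (u - D y)) ^ N)"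
      unfolding C_def N_def b_def using L by (intro tube_weight_dominated) auto
    then have "ennreal (1 / (1 + norm y) * tube_weight y (u - D y)) \<le> ennreal (C *
      (b / (b + norm (u - D y)) ^ N + 1 / (1 + norm (u - D y)) ^ N))"
      by (rule ennreal_leI)
    also have "\<dots> = g (D y)"
      unfolding g_def using C0 b0 by (subst ennreal_mult) (auto intro!: ennreal_plus)
    finally show "ennreal (1 / (1 + norm y) * tube_weight y (u - D y)) \<le> g (D y)" .
  qed
  also have "\<dots> \<le> ennreal (L ^ DIM('a)) * (\<integral>\<^sup>+v. g v \<partial>lborel)"
    using L by (intro nn_integral_linear_substitution_le D gm) auto
  also have "(\<integral>\<^sup>+v. g v \<partial>lborel) = ennreal C * ((\<integral>\<^sup>+v. ennreal (b / (b + norm (u - v)) ^ N) \<partial>lborel)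
      + (\<integral>\<^sup>+v. ennreal (1 / (1 + norm (u - v)) ^ N) \<partial>lborel))"
    unfolding g_def by (simp add: nn_integral_cmult nn_integral_add)
  also have "\<dots> \<le> ennreal C * (ennreal K + ennreal K)"
    unfolding K_def N_def
    by (intro mult_left_mono add_mono nn_integral_inverse_power_le b0 zero_less_one) auto
  also have "\<dots> = ennreal (C * (2 * K))"
    using C0 K0 by (simp add: ennreal_mult flip: ennreal_plus)
  finally have "(\<integral>\<^sup>+y. ennreal (1 / (1 + norm y) * tube_weight y (u - D y)) \<partial>lborel)
    \<le> ennreal (L ^ DIM('a)) * ennreal (C * (2 * K))"
    by (simp add: mult_left_mono)
  also have "\<dots> = ennreal (L ^ DIM('a) * (C * (2 * K)))"
    using L C0 K0 by (subst ennreal_mult) auto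
  finally show ?thesis by (simp only: C_def K_def N_def tube_const_def)
qed

locale expanding_flow =
  fixes D :: "real \<Rightarrow> 'a::euclidean_space \<Rightarrow> 'a" and R :: "'a \<Rightarrow> real" and L \<kappa> :: real
  assumes lin: "linear (D s)"
    and D0: "D 0 x = x"
    and Dadd: "D (s + t) x = D s (D t x)"
    and contD: "continuous_on UNIV (\<lambda>p. D (fst p) (snd p))"
    and L1: "1 \<le> L"
    and bound: "\<bar>s\<bar> \<le> 2 \<Longrightarrow> norm (D s x) \<le> L * norm x"
    and kappa: "0 < \<kappa>"
    and contR: "continuous_on UNIV R"
    and growth: "0 \<le> s \<Longrightarrow> s \<le> s' \<Longrightarrow> s' \<le> 1 \<Longrightarrow> R (D s x) + \<kappa> * (norm x)\<^sup>2 * (s' - s) \<le> R (D s' x)"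
begin

lemma bound': "\<bar>s\<bar> \<le> 2 \<Longrightarrow> norm x \<le> L * norm (D s x)"
  using bound[of "-s" "D s x"] Dadd[of "-s" s x] D0 by simp

lemma D_measurable[measurable]:
  assumes [measurable]: "f \<in> borel_measurable M" "g \<in> borel_measurable M"
  shows "(\<lambda>x. D (f x) (g x)) \<in> borel_measurable M"
  by (rule borel_measurable_continuous_Pair[OF assms contD])

lemma R_measurable[measurable]: "R \<in> borel_measurable borel"
  by (rule borel_measurable_continuous_onI[OF contR])

definition tube :: "real \<Rightarrow> 'a \<Rightarrow> 'a \<Rightarrow> ennreal" where
  "tube b x u = (\<integral>\<^sup>+t\<in>{0..b}. ennreal (tube_weight x (u - D t x)) \<partial>lborel)"

lemma tube_measurable[measurable]:
  assumes [measurable]: "f \<in> borel_measurable M" "g \<in> borel_measurable M"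
  shows "(\<lambda>x. tube b (f x) (g x)) \<in> borel_measurable M"
  unfolding tube_def by measurable

definition tube_op :: "'a measure \<Rightarrow> ('a \<Rightarrow> ennreal) \<Rightarrow> 'a \<Rightarrow> ennreal" where
  "tube_op M f x = ennreal (exp (R x) * (1 + norm x)) * (\<integral>\<^sup>+u. tube 1 x u * f u \<partial>M)"

lemma tube_op_level_set_measurable:
  assumes [measurable]: "f \<in> borel_measurable borel"
  shows "{x. \<alpha> < tube_op lborel f x} \<in> sets borel"
proof -
  have "{x \<in> space borel. \<alpha> < tube_op lborel f x} \<in> sets borel" unfolding tube_op_def by measurable
  then show ?thesis by simp
qed

text \<open>The tube of any point on the trajectory of \<open>y\<close>, up to time 1, is part of the tube of \<open>y\<close> of twice the duration.\<close>
lemma tube_shift_le: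
  assumes s: "s \<in> {0..1}"
  shows "tube 1 (D s y) u \<le> ennreal (L ^ Suc (DIM('a))) * tube 2 y u"
proof -
  define g where "g t = ennreal (tube_weight y (u - D t y)) * indicator {0..2} t" for t
  have [measurable]: "g \<in> borel_measurable borel" unfolding g_def by measurable
  have "tube 1 (D s y) u \<le> (\<integral>\<^sup>+t. ennreal (L ^ Suc (DIM('a))) * g (t + s) \<partial>lborel)"
    unfolding tube_def
  proof (rule nn_integral_mono)
    fix t :: real
    have "tube_weight (D s y) (u - D t (D s y)) \<le> L ^ Suc (DIM('a)) * tube_weight y (u - D (t + s) y)"
      unfolding Dadd using s by (intro tube_weight_compare L1 bound) auto
    then have "ennreal (tube_weight (D s y) (u - D t (D s y))) \<le>
       ennreal (L ^ Suc (DIM('a))) * ennreal (tube_weight y (u - D (t + s) y))"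
      using L1 by (subst ennreal_mult[symmetric]) (auto intro!: ennreal_leI tube_weight_nonneg)
    then show "ennreal (tube_weight (D s y) (u - D t (D s y))) * indicator {0..1} t
      \<le> ennreal (L ^ Suc (DIM('a))) * g (t + s)"
      unfolding g_def using s by (auto simp: indicator_def)
  qed
  also have "\<dots> = ennreal (L ^ Suc (DIM('a))) * (\<integral>\<^sup>+t. g (t + s) \<partial>lborel)"
    by (rule nn_integral_cmult) measurable
  also have "(\<integral>\<^sup>+t. g (t + s) \<partial>lborel) = (\<integral>\<^sup>+t. g t \<partial>lborel)"
    by (rule nn_integral_lborel_translate) measurable
  finally show ?thesis by (simp add: tube_def g_def)
qed

lemma nn_integral_trajectory_le:
  assumes E: "E \<in> sets borel" and W: "0 \<le> A"
    and A: "\<And>s. s \<in> {0..1} \<Longrightarrow> D s y \<in> E \<Longrightarrow> exp (- R (D s y)) \<le> A"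
  shows "(\<integral>\<^sup>+s\<in>{0..1}. ennreal (exp (- R (D s y))) * indicator E (D s y) \<partial>lborel)
    \<le> ennreal (exp 2 * A / (1 + \<kappa> * (norm y)\<^sup>2))"
proof -
  define S where "S = {s. s \<in> {0..1} \<and> D s y \<in> E}"
  note [measurable] = E
  have "S = {s \<in> space borel. s \<in> {0..1} \<and> D s y \<in> E}" by (simp add: S_def)
  also have "\<dots> \<in> sets borel" by measurable
  finally have Sm: "S \<in> sets borel" .
  have "(\<integral>\<^sup>+s\<in>{0..1}. ennreal (exp (- R (D s y))) * indicator E (D s y) \<partial>lborel)
     = (\<integral>\<^sup>+s. ennreal (exp (- R (D s y))) * indicator S s \<partial>lborel)"
    by (rule nn_integral_cong) (auto simp: S_def indicator_def)
  also have "\<dots> \<le> ennreal (exp 2 * A / (1 + \<kappa> * (norm y)\<^sup>2))"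
    using kappa growth A
    by (intro nn_integral_exp_minus_growth_le Sm W) (auto simp: S_def)
  finally show ?thesis .
qed

text \<open>Fubini, followed for each time by the uniform bound on the integral of the weight over the base points.\<close>
lemma weighted_tube_integral_le:
  assumes [measurable]: "F \<in> borel_measurable borel"
  shows "(\<integral>\<^sup>+y. ennreal (1 / (1 + norm y)) * (\<integral>\<^sup>+u. tube 2 y u * F u \<partial>lborel) \<partial>lborel)
    \<le> ennreal (2 * tube_const TYPE('a) L)
       * (\<integral>\<^sup>+u. F u \<partial>lborel)"
proof -
  define K where "K = tube_const TYPE('a) L"
  have K0: "0 \<le> K" using L1 by (simp add: K_def tube_const_def)
  define a where "a y = ennreal (1 / (1 + norm y))" for y :: 'a
  have [measurable]: "a \<in> borel_measurable borel" unfolding a_def by measurable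
  have "(\<integral>\<^sup>+y. a y * (\<integral>\<^sup>+u. tube 2 y u * F u \<partial>lborel) \<partial>lborel)
     = (\<integral>\<^sup>+y. (\<integral>\<^sup>+u. a y * (tube 2 y u * F u) \<partial>lborel) \<partial>lborel)"
    by (simp add: nn_integral_cmult)
  also have "\<dots> = (\<integral>\<^sup>+u. (\<integral>\<^sup>+y. a y * (tube 2 y u * F u) \<partial>lborel) \<partial>lborel)"
    by (rule lborel_pair.Fubini') measurable
  also have "\<dots> = (\<integral>\<^sup>+u. (\<integral>\<^sup>+y. a y * tube 2 y u \<partial>lborel) * F u \<partial>lborel)"
    by (simp add: nn_integral_multc flip: mult.assoc)
  also have "\<dots> \<le> (\<integral>\<^sup>+u. ennreal (2 * K) * F u \<partial>lborel)"
  proof (intro nn_integral_mono mult_right_mono)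
    fix u :: 'a
    have "(\<integral>\<^sup>+y. a y * tube 2 y u \<partial>lborel)
       = (\<integral>\<^sup>+y. (\<integral>\<^sup>+t. a y * (ennreal (tube_weight y (u - D t y)) * indicator {0..2} t) \<partial>lborel) \<partial>lborel)"
      unfolding tube_def by (simp add: nn_integral_cmult)
    also have "\<dots> = (\<integral>\<^sup>+t. (\<integral>\<^sup>+y. a y * (ennreal (tube_weight y (u - D t y)) * indicator {0..2} t) \<partial>lborel) \<partial>lborel)"
      by (rule lborel_pair.Fubini') measurable
    also have "\<dots> = (\<integral>\<^sup>+t\<in>{0..2}. (\<integral>\<^sup>+y. ennreal (1 / (1 + norm y) * tube_weight y (u - D t y)) \<partial>lborel) \<partial>lborel)"
    proof (rule nn_integral_cong)
      fix t :: real
      have "a y * ennreal (tube_weight y (u - D t y)) = ennreal (1 / (1 + norm y) * tube_weight y (u - D t y))" for y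
        unfolding a_def by (subst ennreal_mult) (auto simp: tube_weight_nonneg)
      then show "(\<integral>\<^sup>+y. a y * (ennreal (tube_weight y (u - D t y)) * indicator {0..2} t) \<partial>lborel) =
         (\<integral>\<^sup>+y. ennreal (1 / (1 + norm y) * tube_weight y (u - D t y)) \<partial>lborel) * indicator {0..2} t"
        by (simp add: nn_integral_multc flip: mult.assoc)
    qed
    also have "\<dots> \<le> (\<integral>\<^sup>+t. ennreal K * indicator {0..2::real} t \<partial>lborel)"
    proof (rule nn_integral_mono)
      fix t :: real
      show "(\<integral>\<^sup>+y. ennreal (1 / (1 + norm y) * tube_weight y (u - D t y)) \<partial>lborel) * indicator {0..2} t
         \<le> ennreal K * indicator {0..2} t"
      proof (cases "t \<in> {0..2}")
        case True
        then have "(\<integral>\<^sup>+y. ennreal (1 / (1 + norm y) * tube_weight y (u - D t y)) \<partial>lborel) \<le> ennreal K"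
          unfolding K_def by (intro nn_integral_tube_weight_le lin L1 bound bound') auto
        then show ?thesis by (rule mult_right_mono) simp
      qed simp
    qed
    also have "\<dots> = ennreal (2 * K)"
      using K0 by (subst nn_integral_cmult_indicator) (auto simp: ennreal_mult mult.commute)
    finally show "(\<integral>\<^sup>+y. a y * tube 2 y u \<partial>lborel) \<le> ennreal (2 * K)" .
  qed auto
  also have "\<dots> = ennreal (2 * K) * (\<integral>\<^sup>+u. F u \<partial>lborel)"
    by (rule nn_integral_cmult) measurable
  finally show ?thesis by (simp only: a_def K_def)
qed

text \<open>All points of the level set on the unit piece of trajectory starting at \<open>y\<close> satisfy the same bound \<open>e\<^bsup>-R\<^esup> \<le> A\<close>, with
  \<open>A\<close> expressed through the longer tube of \<open>y\<close>. The growth of \<open>R\<close> then gains the factor \<open>1/(1 + \<kappa>\<bar>y\<bar>\<^sup>2)\<close>, of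
  which \<open>A\<close> consumes \<open>1 + \<bar>y\<bar>\<close>.\<close>
lemma level_set_trajectory_le:
  fixes F :: "'a \<Rightarrow> ennreal" and \<alpha> :: real
  assumes [measurable]: "F \<in> borel_measurable borel" and \<alpha>: "0 < \<alpha>"
  defines "W \<equiv> \<lambda>b x. \<integral>\<^sup>+u. tube b x u * F u \<partial>lborel"
  defines "E \<equiv> {x. ennreal \<alpha> < tube_op lborel F x}"
  shows "(\<integral>\<^sup>+s\<in>{0..1}. ennreal (exp (- R (D s y))) * indicator E (D s y) \<partial>lborel)
    \<le> ennreal (exp 2 * L * L ^ Suc (DIM('a)) * (2 / min 1 \<kappa>) / \<alpha>) * (ennreal (1 / (1 + norm y)) * W 2 y)"
proof (cases "W 2 y = top")
  case True
  have "0 < 1 / (1 + norm y)" by (simp add: add_pos_nonneg)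
  moreover have "0 < exp 2 * L * L ^ Suc (DIM('a)) * (2 / min 1 \<kappa>) / \<alpha>"
    using L1 kappa \<alpha> by (intro divide_pos_pos mult_pos_pos zero_less_power) auto
  moreover have "ennreal x * top = top" if "0 < x" for x
    using that by (simp add: ennreal_mult_eq_top_iff)
  ultimately show ?thesis using True by (simp only: top_greatest)
next
  case False
  define w where "w = enn2real (W 2 y)"
  have w: "W 2 y = ennreal w" "0 \<le> w" using False by (auto simp: w_def less_top)
  define c where "c = L * L ^ Suc (DIM('a))"
  have c0: "0 \<le> c" using L1 by (simp add: c_def)
  define A where "A = c * (1 + norm y) * w / \<alpha>"
  have A0: "0 \<le> A" using w c0 \<alpha> by (auto simp: A_def intro!: divide_nonneg_pos mult_nonneg_nonneg)
  have Em: "E \<in> sets borel" unfolding E_def by (rule tube_op_level_set_measurable) fact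
  have small: "exp (- R (D s y)) \<le> A" if s: "s \<in> {0..1}" and E: "D s y \<in> E" for s
  proof -
    let ?x = "D s y"
    have x: "1 + norm ?x \<le> L * (1 + norm y)"
      using bound[of s y] s L1 by (simp add: algebra_simps)
    have "W 1 ?x \<le> (\<integral>\<^sup>+u. ennreal (L ^ Suc (DIM('a))) * tube 2 y u * F u \<partial>lborel)"
      unfolding W_def by (intro nn_integral_mono mult_right_mono tube_shift_le s) auto
    also have "\<dots> = ennreal (L ^ Suc (DIM('a))) * W 2 y"
      unfolding W_def by (simp add: nn_integral_cmult mult.assoc del: power_Suc)
    finally have W1: "W 1 ?x \<le> ennreal (L ^ Suc (DIM('a)) * w)"
      using w L1 by (simp add: ennreal_mult del: power_Suc)
    have "ennreal \<alpha> < ennreal (exp (R ?x) * (1 + norm ?x)) * W 1 ?x"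
      using E by (simp add: E_def tube_op_def W_def)
    also have "\<dots> \<le> ennreal (exp (R ?x) * (L * (1 + norm y))) * ennreal (L ^ Suc (DIM('a)) * w)"
      using x by (intro mult_mono W1 ennreal_leI mult_left_mono) auto
    also have "\<dots> = ennreal (exp (R ?x) * (c * (1 + norm y) * w))"
      using L1 w by (subst ennreal_mult[symmetric]) (auto simp: c_def mult_ac)
    finally have "\<alpha> < exp (R ?x) * (c * (1 + norm y) * w)"
      using \<alpha> by (simp add: ennreal_less_iff)
    then show ?thesis unfolding A_def using \<alpha> by (simp add: exp_minus field_simps)
  qed
  \<comment> \<open>This amounts to \<open>(1 + \<bar>y\<bar>)\<^sup>2 \<le> 2 (1 + \<bar>y\<bar>\<^sup>2) \<le> (2 / min 1 \<kappa>) (1 + \<kappa>\<bar>y\<bar>\<^sup>2)\<close>.\<close>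
  have num: "exp 2 * A / (1 + \<kappa> * (norm y)\<^sup>2) \<le> exp 2 * c * (2 / min 1 \<kappa>) / \<alpha> * (1 / (1 + norm y) * w)"
  proof -
    define m where "m = min 1 \<kappa>"
    have m: "0 < m" "m \<le> 1" "m \<le> \<kappa>" using kappa by (auto simp: m_def)
    have p: "0 < 1 + norm y" "0 < 1 + \<kappa> * (norm y)\<^sup>2"
      using kappa by (auto intro!: add_pos_nonneg)
    have "m * (1 + norm y)\<^sup>2 \<le> m * (2 * (1 + (norm y)\<^sup>2))"
    proof (rule mult_left_mono)
      have "0 \<le> (1 - norm y)\<^sup>2" by simp
      then show "(1 + norm y)\<^sup>2 \<le> 2 * (1 + (norm y)\<^sup>2)"
        unfolding power2_sum power2_diff by simp
    qed (use m in auto)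
    also have "\<dots> = 2 * (m * 1 + m * (norm y)\<^sup>2)" by (simp add: algebra_simps)
    also have "\<dots> \<le> 2 * (1 * 1 + \<kappa> * (norm y)\<^sup>2)"
      using m by (intro mult_left_mono add_mono mult_right_mono) auto
    finally have "m * (1 + norm y)\<^sup>2 \<le> 2 * (1 + \<kappa> * (norm y)\<^sup>2)" by simp
    moreover have "q / r \<le> (2 / m) * (1 / q)" if "m * q\<^sup>2 \<le> 2 * r" "0 < q" "0 < r" for q r :: real
      using that m by (simp add: field_simps power2_eq_square)
    ultimately have "(1 + norm y) / (1 + \<kappa> * (norm y)\<^sup>2) \<le> (2 / m) * (1 / (1 + norm y))"
      using p by blast
    then have "exp 2 * c * w / \<alpha> * ((1 + norm y) / (1 + \<kappa> * (norm y)\<^sup>2)) \<le> exp 2 * c * w / \<alpha> * ((2 / m) * (1 / (1 + norm y)))"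
      using c0 w \<alpha> by (intro mult_left_mono) auto
    then show ?thesis by (simp add: A_def m_def mult_ac)
  qed
  have "(\<integral>\<^sup>+s\<in>{0..1}. ennreal (exp (- R (D s y))) * indicator E (D s y) \<partial>lborel)
     \<le> ennreal (exp 2 * A / (1 + \<kappa> * (norm y)\<^sup>2))"
    by (rule nn_integral_trajectory_le[OF Em A0 small])
  also have "\<dots> \<le> ennreal (exp 2 * c * (2 / min 1 \<kappa>) / \<alpha> * (1 / (1 + norm y) * w))"
    by (intro ennreal_leI num)
  also have "\<dots> = ennreal (exp 2 * c * (2 / min 1 \<kappa>) / \<alpha>) * (ennreal (1 / (1 + norm y)) * ennreal w)"
    using c0 kappa \<alpha> w by (simp add: ennreal_mult del: times_divide_eq_left times_divide_eq_right)
  finally show ?thesis by (simp only: w(1) c_def mult.assoc)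
qed

text \<open>Replacing \<open>x\<close> by \<open>D\<^sub>s y\<close> costs a constant factor for each \<open>s\<close> in the unit interval. Averaging over these \<open>s\<close> turns the
  measure of the level set into an integral over \<open>y\<close> of integrals along trajectories.\<close>
theorem tube_operator_weak_type:
  fixes k :: real
  assumes k: "0 < k"
  defines "M \<equiv> density lborel (\<lambda>x. ennreal (k * exp (- R x)))"
  shows "\<exists>C>0. \<forall>f \<alpha>. f \<in> borel_measurable borel \<longrightarrow> 0 < \<alpha> \<longrightarrow>
    {x. ennreal \<alpha> < tube_op M f x} \<in> sets borel \<and>
    emeasure M {x. ennreal \<alpha> < tube_op M f x}
      \<le> ennreal (C / \<alpha>) * (\<integral>\<^sup>+u. f u \<partial>M)"
proof -
  define K where "K = 2 * tube_const TYPE('a) L"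
  define c where "c = exp 2 * L * L ^ Suc (DIM('a)) * (2 / min 1 \<kappa>)"
  have K0: "0 < K" unfolding K_def tube_const_def using L1
    by (intro mult_pos_pos zero_less_power unit_ball_vol_pos) auto
  have c0: "0 < c" unfolding c_def using L1 kappa by (intro mult_pos_pos zero_less_power divide_pos_pos) auto
  have main: "{x. ennreal \<alpha> < tube_op M f x} \<in> sets borel \<and>
    emeasure M {x. ennreal \<alpha> < tube_op M f x}
      \<le> ennreal (k * L ^ DIM('a) * c * K / \<alpha>) * (\<integral>\<^sup>+u. f u \<partial>M)"
    if fm[measurable]: "f \<in> borel_measurable borel" and \<alpha>: "0 < \<alpha>" for f and \<alpha> :: real
  proof -
    define F where "F u = ennreal (k * exp (- R u)) * f u" for u
    have Fm[measurable]: "F \<in> borel_measurable borel" unfolding F_def by measurable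
    have MF: "(\<integral>\<^sup>+u. g u * f u \<partial>M) = (\<integral>\<^sup>+u. g u * F u \<partial>lborel)"
      if [measurable]: "g \<in> borel_measurable borel" for g
      unfolding M_def F_def by (subst nn_integral_density) (auto simp: mult_ac)
    define W where "W b x = (\<integral>\<^sup>+u. tube b x u * F u \<partial>lborel)" for b x
    define E where "E = {x. ennreal \<alpha> < tube_op lborel F x}"
    have op: "tube_op M f x = tube_op lborel F x" for x
      unfolding tube_op_def by (subst MF) auto
    have Em[measurable]: "E \<in> sets borel" unfolding E_def by (rule tube_op_level_set_measurable) fact
    define g where "g x = ennreal (exp (- R x)) * indicator E x" for x
    have gm[measurable]: "g \<in> borel_measurable borel" unfolding g_def by measurable
    have "emeasure M E = (\<integral>\<^sup>+x. ennreal (k * exp (- R x)) * indicator E x \<partial>lborel)"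
      unfolding M_def by (subst emeasure_density) auto
    also have "\<dots> = (\<integral>\<^sup>+x. ennreal k * g x \<partial>lborel)"
      unfolding g_def using k by (simp add: ennreal_mult mult.assoc)
    also have "\<dots> = ennreal k * (\<integral>\<^sup>+x. g x \<partial>lborel)"
      by (rule nn_integral_cmult) measurable
    finally have 1: "emeasure M E = ennreal k * (\<integral>\<^sup>+x. g x \<partial>lborel)" .
    have shift: "(\<integral>\<^sup>+x. g x \<partial>lborel) \<le> ennreal (L ^ DIM('a)) * (\<integral>\<^sup>+y. g (D s y) \<partial>lborel)"
      if s: "s \<in> {0..1}" for s
    proof -
      have "D s (D (- s) x) = x" for x using Dadd[of s "- s" x] D0 by simp
      then have "(\<integral>\<^sup>+x. g x \<partial>lborel) = (\<integral>\<^sup>+x. g (D s (D (- s) x)) \<partial>lborel)" by simp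
      also have "\<dots> \<le> ennreal (L ^ DIM('a)) * (\<integral>\<^sup>+y. g (D s y) \<partial>lborel)"
        using s L1 by (intro nn_integral_linear_substitution_le[where T="D (- s)"] lin bound') auto
      finally show ?thesis .
    qed
    have "(\<integral>\<^sup>+x. g x \<partial>lborel) = (\<integral>\<^sup>+s\<in>{0..1::real}. (\<integral>\<^sup>+x. g x \<partial>lborel) \<partial>lborel)"
      by (subst nn_integral_cmult_indicator) auto
    also have "\<dots> \<le> (\<integral>\<^sup>+s\<in>{0..1}. ennreal (L ^ DIM('a)) * (\<integral>\<^sup>+y. g (D s y) \<partial>lborel) \<partial>lborel)"
      by (intro nn_integral_mono) (auto simp: indicator_def intro: shift)
    also have "\<dots> = (\<integral>\<^sup>+s. ennreal (L ^ DIM('a)) * (\<integral>\<^sup>+y. g (D s y) * indicator {0..1} s \<partial>lborel) \<partial>lborel)"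
      by (simp add: nn_integral_multc mult.assoc)
    also have "\<dots> = ennreal (L ^ DIM('a)) * (\<integral>\<^sup>+s. (\<integral>\<^sup>+y. g (D s y) * indicator {0..1} s \<partial>lborel) \<partial>lborel)"
      by (rule nn_integral_cmult) measurable
    also have "(\<integral>\<^sup>+s. (\<integral>\<^sup>+y. g (D s y) * indicator {0..1} s \<partial>lborel) \<partial>lborel)
       = (\<integral>\<^sup>+y. (\<integral>\<^sup>+s. g (D s y) * indicator {0..1} s \<partial>lborel) \<partial>lborel)"
      by (rule lborel_pair.Fubini') measurable
    also have "\<dots> \<le> (\<integral>\<^sup>+y. ennreal (c / \<alpha>) * (ennreal (1 / (1 + norm y)) * W 2 y) \<partial>lborel)"
    proof (rule nn_integral_mono)
      fix y :: 'a
      show "(\<integral>\<^sup>+s. g (D s y) * indicator {0..1} s \<partial>lborel) \<le> ennreal (c / \<alpha>) * (ennreal (1 / (1 + norm y)) * W 2 y)"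
        unfolding g_def E_def W_def c_def by (rule level_set_trajectory_le[OF Fm \<alpha>])
    qed
    also have "\<dots> = ennreal (c / \<alpha>) * (\<integral>\<^sup>+y. ennreal (1 / (1 + norm y)) * W 2 y \<partial>lborel)"
      unfolding W_def by (rule nn_integral_cmult) measurable
    also have "\<dots> \<le> ennreal (c / \<alpha>) * (ennreal K * (\<integral>\<^sup>+u. F u \<partial>lborel))"
      unfolding W_def K_def by (intro mult_left_mono weighted_tube_integral_le) auto
    finally have "(\<integral>\<^sup>+x. g x \<partial>lborel) \<le> ennreal (L ^ DIM('a)) * (ennreal (c / \<alpha>) * (ennreal K * (\<integral>\<^sup>+u. F u \<partial>lborel)))"
      by (simp add: mult_left_mono)
    then have "emeasure M E \<le> ennreal k * (ennreal (L ^ DIM('a)) * (ennreal (c / \<alpha>) * (ennreal K * (\<integral>\<^sup>+u. F u \<partial>lborel))))"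
      unfolding 1 by (rule mult_left_mono) simp
    also have "\<dots> = ennreal (k * L ^ DIM('a) * c * K / \<alpha>) * (\<integral>\<^sup>+u. F u \<partial>lborel)"
    proof -
      have "k * L ^ DIM('a) * c * K / \<alpha> = k * (L ^ DIM('a) * (c / \<alpha> * K))" by simp
      then show ?thesis
        using k c0 K0 \<alpha> L1 by (simp only: ennreal_mult mult_nonneg_nonneg zero_le_power divide_nonneg_pos less_imp_le
             order_trans[OF zero_le_one] mult.assoc)
    qed
    also have "(\<integral>\<^sup>+u. F u \<partial>lborel) = (\<integral>\<^sup>+u. f u \<partial>M)"
      using MF[of "\<lambda>_. 1"] by simp
    finally show ?thesis using Em by (simp add: E_def op)
  qed
  have "0 < k * L ^ DIM('a) * c * K"
    using k c0 K0 L1 by (intro mult_pos_pos zero_less_power) auto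
  with main show ?thesis by blast
qed

end

section \<open>The time derivative of the Mehler kernel\<close>

lemma abs_entry_le: "\<bar>M $ i $ j\<bar> \<le> norm (M *v axis j 1)" for M :: "real^'n^'m"
proof -
  have "(M *v axis j 1) $ i = M $ i $ j" by (simp add: matrix_vector_mult_basis column_def)
  then show ?thesis by (metis component_le_norm_cart)
qed

lemma abs_entry_le_norm: "\<bar>M $ i $ j\<bar> \<le> norm M" for M :: "real^'n^'m"
  using abs_entry_le[of M i j] norm_matrix_vector_le[of M "axis j 1"] by simp

lemma power_times_gaussian_bounded:
  fixes c :: real
  assumes c: "0 < c"
  obtains M where "0 < M" "\<And>r. 0 \<le> r \<Longrightarrow> (1 + r) ^ m * exp (- c * r\<^sup>2) \<le> M"
proof (rule that)
  show "0 < 2 ^ m * (1 + fact m / c ^ m)" using c by (intro mult_pos_pos add_pos_pos) auto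
  fix r :: real assume r: "0 \<le> r"
  have "(1 + r) ^ m \<le> 2 ^ m * (1 + (r\<^sup>2) ^ m)"
  proof (cases "r \<le> 1")
    case True
    then have "(1 + r) ^ m \<le> 2 ^ m" using r by (intro power_mono) auto
    also have "\<dots> \<le> 2 ^ m * (1 + (r\<^sup>2) ^ m)" by simp
    finally show ?thesis .
  next
    case False
    then have "1 + r \<le> 2 * r\<^sup>2" by (smt (verit) mult_le_cancel_right1 power2_eq_square)
    then have "(1 + r) ^ m \<le> (2 * r\<^sup>2) ^ m" using r by (intro power_mono) auto
    also have "\<dots> \<le> 2 ^ m * (1 + (r\<^sup>2) ^ m)" by (simp add: power_mult_distrib)
    finally show ?thesis .
  qed
  then have "(1 + r) ^ m * exp (- c * r\<^sup>2) \<le> 2 ^ m * (1 + (r\<^sup>2) ^ m) * exp (- c * r\<^sup>2)"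
    by (rule mult_right_mono) simp
  also have "\<dots> = 2 ^ m * (exp (- c * r\<^sup>2) + (r\<^sup>2) ^ m * exp (- c * r\<^sup>2))" by (simp add: algebra_simps)
  also have "\<dots> \<le> 2 ^ m * (1 + fact m / c ^ m)"
  proof (intro mult_left_mono add_mono)
    show "exp (- c * r\<^sup>2) \<le> 1" using c by simp
    have "(c * r\<^sup>2) ^ m / fact m \<le> exp (c * r\<^sup>2)"
    proof -
      have "(\<Sum>k\<in>{m}. (c * r\<^sup>2) ^ k /\<^sub>R fact k) \<le> (\<Sum>k. (c * r\<^sup>2) ^ k /\<^sub>R fact k)"
        using c by (intro sum_le_suminf summable_exp_generic) auto
      then show ?thesis by (simp add: exp_def divide_inverse mult.commute)
    qed
    then have "c ^ m * ((r\<^sup>2) ^ m * exp (- (c * r\<^sup>2))) \<le> fact m"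
      by (simp add: power_mult_distrib exp_minus field_simps)
    then show "(r\<^sup>2) ^ m * exp (- c * r\<^sup>2) \<le> fact m / c ^ m"
      using c by (simp add: pos_le_divide_eq mult.commute)
  qed auto
  finally show "(1 + r) ^ m * exp (- c * r\<^sup>2) \<le> 2 ^ m * (1 + fact m / c ^ m)" .
qed

text \<open>With \<open>\<tau> = \<surd>t\<close>, \<open>\<omega> = \<bar>u - D\<^sub>t x\<bar>\<close> and \<open>b = \<bar>x\<bar>\<close> this is, up to constants, the bound for \<open>e\<^bsup>-R(x)\<^esup>\<bar>\<partial>K\<^sub>t/\<partial>t\<bar>\<close> obtained by differentiating the kernel factor by factor.\<close>
definition kernel_profile :: "nat \<Rightarrow> real \<Rightarrow> real \<Rightarrow> real \<Rightarrow> real \<Rightarrow> real" where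
  "kernel_profile n c \<tau> \<omega> b =
     (1 / \<tau>) ^ n * (1 / \<tau>\<^sup>2 + \<omega>\<^sup>2 / (\<tau>\<^sup>2)\<^sup>2 + \<omega> * b / \<tau>\<^sup>2) * exp (- c * (\<omega>\<^sup>2 / \<tau>\<^sup>2))"

text \<open>Write \<open>r = \<omega>/\<tau>\<close>. The assumption lets each factor \<open>1/\<tau>\<close> in excess of \<open>n + 1\<close> be traded for \<open>b\<close>, and turns
  \<open>\<tau>\<^bsup>-n-1\<^esup>\<close> into \<open>(1/b + \<omega>)\<^bsup>-n-1\<^esup>\<close>, each time at the price of powers of \<open>1 + r\<close>, which the Gaussian absorbs.\<close>
lemma kernel_profile_le:
  fixes c C :: real
  assumes c: "0 < c" and C: "0 \<le> C"
  obtains M where "0 < M"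
    "\<And>\<tau> \<omega> b. 0 < \<tau> \<Longrightarrow> 0 \<le> \<omega> \<Longrightarrow> 1 \<le> b \<Longrightarrow> 1 / b \<le> C * (\<omega> + \<tau>) \<Longrightarrow>
      kernel_profile n c \<tau> \<omega> b \<le> M * b * (1 / (1 / b + \<omega>) ^ Suc n)"
proof -
  obtain M where M: "0 < M" "\<And>r. 0 \<le> r \<Longrightarrow> (1 + r) ^ (Suc n + 3) * exp (- c * r\<^sup>2) \<le> M"
    using power_times_gaussian_bounded[OF c, of "Suc n + 3"] by blast
  show thesis
  proof (rule that[of "(C + 1) ^ Suc (Suc n) * M"])
    show "0 < (C + 1) ^ Suc (Suc n) * M" using C M by (intro mult_pos_pos zero_less_power) auto
    fix \<tau> \<omega> b :: real
    assume t: "0 < \<tau>" and w: "0 \<le> \<omega>" and b: "1 \<le> b" and ab: "1 / b \<le> C * (\<omega> + \<tau>)"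
    define r where "r = \<omega> / \<tau>"
    define a where "a = 1 / b"
    have r: "0 \<le> r" and wr: "\<omega> = r * \<tau>" using t w by (auto simp: r_def)
    have a: "0 < a" using b by (simp add: a_def)
    have a1: "a \<le> C * (1 + r) * \<tau>" using ab unfolding a_def[symmetric] wr by (simp add: algebra_simps)
    have aw: "a + \<omega> \<le> (C + 1) * (1 + r) * \<tau>"
    proof -
      have "r * \<tau> \<le> (1 + r) * \<tau>" using t by simp
      then show ?thesis using a1 by (simp add: wr algebra_simps)
    qed
    have it: "1 / \<tau> \<le> b * (C * (1 + r))"
    proof -
      have "1 = b * a" using b by (simp add: a_def)
      also have "\<dots> \<le> b * (C * (1 + r) * \<tau>)" using a1 b by (intro mult_left_mono) auto
      finally show ?thesis using t by (simp add: field_simps)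
    qed
    have "1 / \<tau>\<^sup>2 + \<omega>\<^sup>2 / (\<tau>\<^sup>2)\<^sup>2 + \<omega> * b / \<tau>\<^sup>2 = 1 / \<tau> * (1 / \<tau> * (1 + r\<^sup>2) + b * r)"
      using t by (simp add: wr power2_eq_square field_simps)
    also have "\<dots> \<le> 1 / \<tau> * (b * (C * (1 + r)) * (1 + r\<^sup>2) + b * r)"
      using t it b r by (intro mult_left_mono add_mono mult_right_mono) auto
    also have "\<dots> \<le> 1 / \<tau> * (b * ((C + 1) * (1 + r) ^ 3))"
    proof -
      have "(1 + r) * (1 + r\<^sup>2) \<le> (1 + r) * (1 + r)\<^sup>2"
        using r by (intro mult_left_mono) (auto simp: power2_sum)
      then have 1: "C * ((1 + r) * (1 + r\<^sup>2)) \<le> C * (1 + r) ^ 3"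
        using C by (intro mult_left_mono) (auto simp: power3_eq_cube power2_eq_square)
      have 2: "r \<le> (1 + r) ^ 3"
        using r self_le_power[of "1 + r" 3] by simp
      have "C * (1 + r) * (1 + r\<^sup>2) + r \<le> (C + 1) * (1 + r) ^ 3"
        using 1 2 by (simp only: distrib_right mult_1_left mult.assoc add_mono)
      then have "b * (C * (1 + r) * (1 + r\<^sup>2) + r) \<le> b * ((C + 1) * (1 + r) ^ 3)"
        using b by (intro mult_left_mono) auto
      moreover have "b * (C * (1 + r)) * (1 + r\<^sup>2) + b * r = b * (C * (1 + r) * (1 + r\<^sup>2) + r)"
        by (simp add: algebra_simps)
      ultimately have "b * (C * (1 + r)) * (1 + r\<^sup>2) + b * r \<le> b * ((C + 1) * (1 + r) ^ 3)" by simp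
      then show ?thesis using t by (intro mult_left_mono) auto
    qed
    finally have 1: "1 / \<tau>\<^sup>2 + \<omega>\<^sup>2 / (\<tau>\<^sup>2)\<^sup>2 + \<omega> * b / \<tau>\<^sup>2 \<le> 1 / \<tau> * (b * ((C + 1) * (1 + r) ^ 3))" .
    have 2: "(1 / \<tau>) ^ Suc n \<le> (C + 1) ^ Suc n * (1 + r) ^ Suc n * (1 / (a + \<omega>) ^ Suc n)"
    proof -
      have "(a + \<omega>) ^ Suc n \<le> ((C + 1) * (1 + r) * \<tau>) ^ Suc n" using aw a w by (intro power_mono) auto
      moreover have "0 < (a + \<omega>) ^ Suc n" "0 < \<tau> ^ Suc n" using a w t by (auto intro!: zero_less_power add_pos_nonneg)
      ultimately show ?thesis
        unfolding power_mult_distrib power_one_over by (simp add: field_simps del: power_Suc)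
    qed
    have e: "\<omega>\<^sup>2 / \<tau>\<^sup>2 = r\<^sup>2" by (simp add: r_def power_divide)
    have "(1 / \<tau>) ^ n * (1 / \<tau>\<^sup>2 + \<omega>\<^sup>2 / (\<tau>\<^sup>2)\<^sup>2 + \<omega> * b / \<tau>\<^sup>2) * exp (- c * (\<omega>\<^sup>2 / \<tau>\<^sup>2))
       \<le> (1 / \<tau>) ^ n * (1 / \<tau> * (b * ((C + 1) * (1 + r) ^ 3))) * exp (- c * r\<^sup>2)"
      unfolding e using t 1 by (intro mult_right_mono mult_left_mono) auto
    also have "\<dots> = (1 / \<tau>) ^ Suc n * (b * ((C + 1) * (1 + r) ^ 3) * exp (- c * r\<^sup>2))" by simp
    also have "\<dots> \<le> ((C + 1) ^ Suc n * (1 + r) ^ Suc n * (1 / (a + \<omega>) ^ Suc n)) * (b * ((C + 1) * (1 + r) ^ 3) * exp (- c * r\<^sup>2))"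
      using b C r by (intro mult_right_mono 2) auto
    also have "\<dots> = (C + 1) ^ Suc (Suc n) * ((1 + r) ^ (Suc n + 3) * exp (- c * r\<^sup>2)) * (b * (1 / (a + \<omega>) ^ Suc n))"
      unfolding power_add[of "1 + r"] power_Suc2[of "C + 1" "Suc n"] by (simp only: ac_simps)
    also have "\<dots> \<le> (C + 1) ^ Suc (Suc n) * M * (b * (1 / (a + \<omega>) ^ Suc n))"
      using a w b C by (intro mult_right_mono mult_left_mono M r) auto
    finally show "kernel_profile n c \<tau> \<omega> b \<le> (C + 1) ^ Suc (Suc n) * M * b * (1 / (1 / b + \<omega>) ^ Suc n)"
      by (simp only: kernel_profile_def a_def mult.assoc)
  qed
qed

context stable_drift
begin

definition D :: "real \<Rightarrow> real^'n^'n" where "D t = Dmat Q B t"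

lemma D_eq: "D t = Qi ** transpose (expB (- t)) ** Qi_inv"
  unfolding D_def Dmat_def Qi_def[symmetric] Qi_inv_def[symmetric] expB_def
  by (simp add: mat_exp_transpose flip: transpose_scalar)

lemma D_apply: "D t *v x = Qi *v (transpose (expB (- t)) *v (Qi_inv *v x))"
  by (simp add: D_eq matrix_vector_mul_assoc matrix_mul_assoc del: transpose_matrix_vector)

lemma Qi_inv_D: "Qi_inv *v (D t *v x) = transpose (expB (- t)) *v (Qi_inv *v x)"
  by (simp add: D_apply Qi_cancel del: transpose_matrix_vector)

lemma D_0: "D 0 *v x = x"
  by (simp add: D_apply expB_transpose_0 Qi_cancel del: transpose_matrix_vector)

lemma D_add: "D (s + t) *v x = D s *v (D t *v x)"
  unfolding D_apply[of s] Qi_inv_D expB_transpose_add by (simp add: D_apply del: transpose_matrix_vector)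

definition D_velocity :: "real \<Rightarrow> real^'n^'n" where
  "D_velocity t = Qi ** transpose ((- 1) *\<^sub>R (B ** expB (- t))) ** Qi_inv"

lemma D_deriv: "(D has_vector_derivative D_velocity t) (at t)"
proof -
  have 1: "((\<lambda>t. expB (- t)) has_vector_derivative ((- 1) *\<^sub>R (B ** expB (- t)))) (at t)"
    unfolding expB_def by (rule mat_exp_scaleR_chain) (auto intro!: derivative_eq_intros)
  have bl: "bounded_linear (\<lambda>M. Qi ** transpose M ** Qi_inv)"
    using bounded_linear_compose[OF mm.bounded_linear_left bounded_linear_compose[OF mm.bounded_linear_right bounded_linear_transpose]] .
  show ?thesis
    unfolding D_eq[abs_def] D_velocity_def by (rule bounded_linear.has_vector_derivative[OF bl 1])
qed

lemma continuous_on_D: "continuous_on S D"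
  by (intro continuous_at_imp_continuous_on ballI has_vector_derivative_continuous[OF D_deriv])

lemma D_bounds: obtains L where "1 \<le> L" "\<And>t x. \<bar>t\<bar> \<le> 2 \<Longrightarrow> norm (D t *v x) \<le> L * norm x"
  "\<And>t x. \<bar>t\<bar> \<le> 2 \<Longrightarrow> norm (D_velocity t *v x) \<le> L * norm x"
proof -
  have "continuous_on {-2..2} D_velocity"
    unfolding D_velocity_def[abs_def]
    by (intro mm.continuous_on continuous_on_const bounded_linear.continuous_on[OF bounded_linear_transpose]
       continuous_on_scaleR continuous_on_compose2[OF continuous_on_expB[of UNIV]] continuous_intros) auto
  then have "bounded (D ` {-2..2})" "bounded (D_velocity ` {-2..2})"
    by (auto intro!: compact_imp_bounded compact_continuous_image continuous_on_D)
  then obtain K1 K2 where K: "\<And>t. t \<in> {-2..2} \<Longrightarrow> norm (D t) \<le> K1"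
    "\<And>t. t \<in> {-2..2} \<Longrightarrow> norm (D_velocity t) \<le> K2"
    unfolding bounded_iff by (metis imageI)
  define L where "L = max 1 (max K1 K2)"
  have b: "norm (M *v x) \<le> L * norm x" if "norm M \<le> L" for M :: "real^'n^'n" and x
    using norm_matrix_vector_le[of M x] mult_right_mono[OF that, of "norm x"] by simp
  have "norm (D t) \<le> L" "norm (D_velocity t) \<le> L" if "\<bar>t\<bar> \<le> 2" for t
  proof -
    have t: "t \<in> {-2..2}" using that by auto
    show "norm (D t) \<le> L" "norm (D_velocity t) \<le> L"
      using K(1)[OF t] K(2)[OF t] by (auto simp only: L_def le_max_iff_disj)
  qed
  then show thesis using b by (intro that[of L]) (simp_all only: L_def max.cobounded1)
qed

lemma Rquad_eq: "Rquad Q B x = 1/2 * ((Qi_inv *v x) \<bullet> x)"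
  by (simp add: Rquad_def Qi_inv_def Qi_def)

lemma Rquad_D: "Rquad Q B (D s *v x) =
   1/2 * ((Qi *v (transpose (expB (- s)) *v (Qi_inv *v x))) \<bullet> (transpose (expB (- s)) *v (Qi_inv *v x)))"
  unfolding Rquad_eq Qi_inv_form[of "D s *v x"] unfolding Qi_inv_D ..

text \<open>With \<open>p = e\<^bsup>-s'B*\<^esup> Q\<^sub>\<infinity>\<^sup>-\<^sup>1 x\<close> the values of \<open>2R\<close> at times \<open>s'\<close> and \<open>s\<close> are the form of \<open>Q\<^sub>\<infinity>\<close> at \<open>p\<close> and at
  \<open>e\<^bsup>(s'-s)B*\<^esup> p\<close>. Their difference is the form of \<open>Q\<^bsub>s'-s\<^esub>\<close> at \<open>p\<close>.\<close>
lemma Rquad_growth: obtains \<kappa> where "0 < \<kappa>"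
  "\<And>s s' x. 0 \<le> s \<Longrightarrow> s \<le> s' \<Longrightarrow> s' \<le> 1 \<Longrightarrow> Rquad Q B (D s *v x) + \<kappa> * (norm x)\<^sup>2 * (s' - s) \<le> Rquad Q B (D s' *v x)"
proof -
  obtain c where c: "0 < c" "\<And>t v. 0 \<le> t \<Longrightarrow> t \<le> 2 \<Longrightarrow> c * t * (norm v)\<^sup>2 \<le> (Qt t *v v) \<bullet> v" by (rule Qt_lower) blast
  obtain K where K: "1 \<le> K" "\<And>s v. \<bar>s\<bar> \<le> 2 \<Longrightarrow> norm v \<le> K * norm (transpose (expB s) *v v)"
    by (rule expB_transpose_bounds) blast
  define G where "G = K * (norm Qi + 1)"
  have G: "0 < G" using K by (auto simp: G_def intro!: mult_pos_pos add_nonneg_pos)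
  show thesis
  proof (rule that[of "1/2 * (c / G\<^sup>2)"])
    show "0 < 1/2 * (c / G\<^sup>2)" using c G by simp
    fix s s' :: real and x :: "real^'n"
    assume s: "0 \<le> s" "s \<le> s'" "s' \<le> 1"
    define p where "p = transpose (expB (- s')) *v (Qi_inv *v x)"
    have ps: "transpose (expB (s' - s)) *v p = transpose (expB (- s)) *v (Qi_inv *v x)"
      unfolding p_def expB_transpose_add by simp
    have "norm x = norm (Qi *v (Qi_inv *v x))" by (simp add: Qi_cancel)
    also have "\<dots> \<le> norm Qi * norm (Qi_inv *v x)" by (rule norm_matrix_vector_le)
    also have "\<dots> \<le> (norm Qi + 1) * (K * norm p)"
      using K(2)[of "- s'" "Qi_inv *v x"] s unfolding p_def by (intro mult_mono) auto
    finally have "norm x \<le> G * norm p" by (simp add: G_def mult_ac)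
    then have "(norm x)\<^sup>2 \<le> (G * norm p)\<^sup>2" by (intro power_mono) auto
    then have 1: "c / G\<^sup>2 * (s' - s) * (norm x)\<^sup>2 \<le> c / G\<^sup>2 * (s' - s) * (G * norm p)\<^sup>2"
      using c s by (intro mult_left_mono) auto
    also have "\<dots> = c * (s' - s) * (norm p)\<^sup>2" using G by (simp add: power_mult_distrib)
    also have "\<dots> \<le> (Qt (s' - s) *v p) \<bullet> p" using s by (intro c) auto
    finally have 2: "c / G\<^sup>2 * (s' - s) * (norm x)\<^sup>2 \<le> (Qt (s' - s) *v p) \<bullet> p" .
    have "(Qi *v p) \<bullet> p = (Qt (s' - s) *v p) \<bullet> p + (Qi *v (transpose (expB (s' - s)) *v p)) \<bullet> (transpose (expB (s' - s)) *v p)"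
      using s by (intro Qi_form) auto
    then have "c / G\<^sup>2 * (s' - s) * (norm x)\<^sup>2 + (Qi *v (transpose (expB (- s)) *v (Qi_inv *v x))) \<bullet> (transpose (expB (- s)) *v (Qi_inv *v x))
       \<le> (Qi *v p) \<bullet> p" using 2 unfolding ps by linarith
    then show "Rquad Q B (D s *v x) + 1/2 * (c / G\<^sup>2) * (norm x)\<^sup>2 * (s' - s) \<le> Rquad Q B (D s' *v x)"
      unfolding Rquad_D p_def[symmetric] by (simp add: mult_ac)
  qed
qed

lemma continuous_on_Rquad: "continuous_on S (Rquad Q B)"
  unfolding Rquad_eq[abs_def] by (intro continuous_intros mv.continuous_on)

lemma exists_expanding_flow: obtains L \<kappa> where "expanding_flow (\<lambda>t x. D t *v x) (Rquad Q B) L \<kappa>"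
proof -
  obtain L where L: "1 \<le> L" "\<And>t x. \<bar>t\<bar> \<le> 2 \<Longrightarrow> norm (D t *v x) \<le> L * norm x" by (rule D_bounds) blast
  obtain \<kappa> where k: "0 < \<kappa>" "\<And>s s' x. 0 \<le> s \<Longrightarrow> s \<le> s' \<Longrightarrow> s' \<le> 1 \<Longrightarrow>
     Rquad Q B (D s *v x) + \<kappa> * (norm x)\<^sup>2 * (s' - s) \<le> Rquad Q B (D s' *v x)" by (rule Rquad_growth) blast
  have "expanding_flow (\<lambda>t x. D t *v x) (Rquad Q B) L \<kappa>"
  proof
    show "continuous_on UNIV (\<lambda>p. D (fst p) *v snd p)"
      by (intro mv.continuous_on continuous_on_compose2[OF continuous_on_D[of UNIV]] continuous_intros) auto
  qed (use L k D_0 D_add continuous_on_Rquad in \<open>auto simp: mv.add_right mv.scaleR_right\<close>)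
  then show thesis by (rule that)
qed

lemma det_Qt_pos: "0 < t \<Longrightarrow> t \<le> 2 \<Longrightarrow> 0 < det (Qt t)"
  by (rule det_pos_of_positive_form[OF Qt_pos])

lemma det_Qi_pos: "0 < det Qi"
  by (rule det_pos_of_positive_form[OF Qi_pos])

text \<open>The entries of the inverse are at most a multiple of \<open>1/t\<close>, so its determinant is at most a multiple of \<open>t\<^bsup>-n\<^esup>\<close>; the two determinants have product 1.\<close>
lemma det_Qt_lower: obtains c where "0 < c" "\<And>t. 0 < t \<Longrightarrow> t \<le> 2 \<Longrightarrow> c * t ^ CARD('n) \<le> det (Qt t)"
proof -
  obtain C where C: "0 < C" "\<And>t w. 0 < t \<Longrightarrow> t \<le> 2 \<Longrightarrow> norm (Qt_inv t *v w) \<le> C / t * norm w" by (rule Qt_inv_upper) blast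
  define P where "P = det_terms TYPE('n) * C ^ CARD('n)"
  have P: "0 < P" using C det_terms_pos[where 'n='n] by (simp add: P_def)
  have "1 / P * t ^ CARD('n) \<le> det (Qt t)" if t: "0 < t" "t \<le> 2" for t
  proof -
    have "\<bar>Qt_inv t $ i $ j\<bar> \<le> C / t" for i j
      using abs_entry_le[of "Qt_inv t" i j] C(2)[OF t, of "axis j 1"] by simp
    then have "\<bar>det (Qt_inv t)\<bar> \<le> det_terms TYPE('n) * (C / t) ^ CARD('n)" by (rule abs_det_le)
    also have "\<dots> = P / t ^ CARD('n)" by (simp add: P_def power_divide)
    finally have 1: "\<bar>det (Qt_inv t)\<bar> \<le> P / t ^ CARD('n)" .
    have "det (Qt t) * det (Qt_inv t) = 1" using t by (simp add: Qt_cancel flip: det_mul)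
    then have "1 = \<bar>det (Qt t) * det (Qt_inv t)\<bar>" by simp
    also have "\<dots> = det (Qt t) * \<bar>det (Qt_inv t)\<bar>" using det_Qt_pos[OF t] by (simp add: abs_mult)
    also have "\<dots> \<le> det (Qt t) * (P / t ^ CARD('n))" using det_Qt_pos[OF t] 1 by (intro mult_left_mono) auto
    finally show ?thesis using P t by (simp add: field_simps)
  qed
  then show thesis using that[of "1 / P"] P by simp
qed

text \<open>The range of times extends beyond 1, so that derivatives at time 1 are two-sided.\<close>
lemma Qt_deriv: "0 < t \<Longrightarrow> t < 2 \<Longrightarrow> (Qt has_vector_derivative cov_rate t) (at t)"
  using integral_has_vector_derivative[OF continuous_on_cov_rate[of "{0..2}"], of t]
  by (simp add: Qt_eq[abs_def] at_within_Icc_at)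

lemma Qt_inv_deriv:
  assumes t: "0 < t" "t < 2"
  shows "(Qt_inv has_vector_derivative - (Qt_inv t ** cov_rate t ** Qt_inv t)) (at t)"
proof -
  obtain C where C: "0 < C" "\<And>t w. 0 < t \<Longrightarrow> t \<le> 2 \<Longrightarrow> norm (Qt_inv t *v w) \<le> C / t * norm w" by (rule Qt_inv_upper) blast
  have near: "\<forall>\<^sub>F s in at t. t / 2 < s \<and> s < 2"
    using t by (intro eventually_conj order_tendstoD[OF tendsto_ident_at]) auto
  show ?thesis unfolding Qt_inv_def[abs_def]
  proof (rule matrix_inv_derivative[OF Qt_deriv[OF t]])
    show "\<forall>\<^sub>F s in at t. invertible (Qt s)"
      using near by eventually_elim (use t in \<open>auto intro!: Qt_invertible\<close>)
    show "invertible (Qt t)" using t by (intro Qt_invertible) auto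
    show "\<forall>\<^sub>F s in at t. norm (matrix_inv (Qt s)) \<le> (\<Sum>i\<in>(UNIV::'n set). \<Sum>j\<in>(UNIV::'n set). C / (t / 2))"
      using near
    proof eventually_elim
      case (elim s)
      have "\<bar>Qt_inv s $ i $ j\<bar> \<le> C / (t / 2)" for i j
      proof -
        have "\<bar>Qt_inv s $ i $ j\<bar> \<le> C / s"
          using abs_entry_le[of "Qt_inv s" i j] C(2)[of s "axis j 1"] elim t by simp
        also have "\<dots> \<le> C / (t / 2)" using C elim t by (intro divide_left_mono mult_pos_pos) auto
        finally show ?thesis .
      qed
      then show ?case unfolding Qt_inv_def[symmetric]
        by (intro order_trans[OF norm_matrix_le_sum sum_mono] sum_mono)
    qed
  qed
qed

definition form :: "real^'n \<Rightarrow> real^'n \<Rightarrow> real \<Rightarrow> real" where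
  "form x u t = ((Qt_inv t - Qi_inv) *v (u - D t *v x)) \<bullet> (u - D t *v x)"

text \<open>The product rule with \<open>\<partial>Q\<^sub>t\<^sup>-\<^sup>1/\<partial>t = - Q\<^sub>t\<^sup>-\<^sup>1 (\<partial>Q\<^sub>t/\<partial>t) Q\<^sub>t\<^sup>-\<^sup>1\<close>, each inverse costing \<open>1/t\<close>.\<close>
lemma form_deriv: obtains C where "0 < C"
  "\<And>x u t. 0 < t \<Longrightarrow> t \<le> 1 \<Longrightarrow> \<exists>q'. (form x u has_real_derivative q') (at t) \<and>
     \<bar>q'\<bar> \<le> C * ((norm (u - D t *v x))\<^sup>2 / t\<^sup>2 + norm (u - D t *v x) * norm x / t)"
proof -
  obtain C where C: "0 < C" "\<And>t w. 0 < t \<Longrightarrow> t \<le> 2 \<Longrightarrow> norm (Qt_inv t *v w) \<le> C / t * norm w" by (rule Qt_inv_upper) blast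
  obtain CF where CF: "0 < CF" "\<And>s. 0 \<le> s \<Longrightarrow> norm (cov_rate s) \<le> CF" by (rule cov_rate_bounded) blast
  obtain L where L: "1 \<le> L" "\<And>t x. \<bar>t\<bar> \<le> 2 \<Longrightarrow> norm (D t *v x) \<le> L * norm x"
    "\<And>t x. \<bar>t\<bar> \<le> 2 \<Longrightarrow> norm (D_velocity t *v x) \<le> L * norm x"
    by (rule D_bounds) blast
  define C1 where "C1 = C + norm Qi_inv"
  have C1: "0 < C1" using C by (simp add: C1_def add_pos_nonneg)
  define K where "K = 2 * C1 * L + C * CF * C"
  have K: "0 < K" using C C1 CF L by (auto simp: K_def intro!: add_pos_pos mult_pos_pos)
  have "\<exists>q'. (form x u has_real_derivative q') (at t) \<and>
     \<bar>q'\<bar> \<le> K * ((norm (u - D t *v x))\<^sup>2 / t\<^sup>2 + norm (u - D t *v x) * norm x / t)"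
    if t: "0 < t" "t \<le> 1" for x u t
  proof -
    define A where "A = Qt_inv t - Qi_inv"
    define A' where "A' = - (Qt_inv t ** cov_rate t ** Qt_inv t)"
    define w where "w = u - D t *v x"
    define w' where "w' = - (D_velocity t *v x)"
    have wd: "((\<lambda>t. u - D t *v x) has_vector_derivative w') (at t)"
      using has_vector_derivative_diff[OF has_vector_derivative_const[of u]
        bounded_linear.has_vector_derivative[OF mv.bounded_linear_left D_deriv[of t]], of x]
      by (simp add: w'_def)
    have Ad: "((\<lambda>t. Qt_inv t - Qi_inv) has_vector_derivative A') (at t)"
      using has_vector_derivative_diff[OF Qt_inv_deriv[of t] has_vector_derivative_const[of Qi_inv]] t by (simp add: A'_def)
    have "((\<lambda>t. (Qt_inv t - Qi_inv) *v (u - D t *v x)) has_vector_derivative (A *v w' + A' *v w)) (at t)"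
      unfolding A_def w_def by (rule mv.has_vector_derivative[OF Ad wd])
    then have "(form x u has_vector_derivative ((A *v w) \<bullet> w' + (A *v w' + A' *v w) \<bullet> w)) (at t)"
      unfolding form_def[abs_def] A_def w_def
      by (rule bounded_bilinear.has_vector_derivative[OF bounded_bilinear_inner _ wd])
    moreover have "\<bar>(A *v w) \<bullet> w' + (A *v w' + A' *v w) \<bullet> w\<bar> \<le> K * ((norm w)\<^sup>2 / t\<^sup>2 + norm w * norm x / t)"
    proof -
      have Ab: "norm (A *v v) \<le> C1 / t * norm v" for v
      proof -
        have "norm (A *v v) \<le> norm (Qt_inv t *v v) + norm (Qi_inv *v v)"
          by (simp add: A_def mv.diff_left norm_triangle_ineq4)
        also have "\<dots> \<le> C / t * norm v + norm Qi_inv / t * norm v"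
        proof (intro add_mono)
          show "norm (Qt_inv t *v v) \<le> C / t * norm v" using C t by simp
          have "norm Qi_inv \<le> norm Qi_inv / t" using t mult_left_mono[of t 1 "norm Qi_inv"] by (simp add: field_simps)
          then show "norm (Qi_inv *v v) \<le> norm Qi_inv / t * norm v"
            using norm_matrix_vector_le[of Qi_inv v] by (meson mult_right_mono norm_ge_zero order_trans)
        qed
        finally show ?thesis by (simp add: C1_def add_divide_distrib algebra_simps)
      qed
      have w'b: "norm w' \<le> L * norm x" using L(3)[of t x] t by (simp add: w'_def)
      have 1: "\<bar>(A *v w) \<bullet> w'\<bar> \<le> C1 / t * norm w * (L * norm x)"
        using C1 t w'b Ab[of w] by (intro order_trans[OF Cauchy_Schwarz_ineq2] mult_mono) auto
      have "norm (A *v w') \<le> C1 / t * (L * norm x)"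
        using C1 t w'b by (intro order_trans[OF Ab] mult_left_mono) auto
      then have 2: "\<bar>(A *v w') \<bullet> w\<bar> \<le> C1 / t * (L * norm x) * norm w"
        by (intro order_trans[OF Cauchy_Schwarz_ineq2] mult_right_mono) auto
      have "norm (A' *v w) = norm (Qt_inv t *v (cov_rate t *v (Qt_inv t *v w)))"
        by (simp add: A'_def mv.minus_left matrix_vector_mul_assoc matrix_mul_assoc)
      also have "\<dots> \<le> C / t * norm (cov_rate t *v (Qt_inv t *v w))" using C t by simp
      also have "\<dots> \<le> C / t * (CF * (C / t * norm w))"
      proof (intro mult_left_mono)
        have "norm (cov_rate t *v (Qt_inv t *v w)) \<le> norm (cov_rate t) * norm (Qt_inv t *v w)" by (rule norm_matrix_vector_le)
        also have "\<dots> \<le> CF * (C / t * norm w)" using CF C t by (intro mult_mono) auto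
        finally show "norm (cov_rate t *v (Qt_inv t *v w)) \<le> CF * (C / t * norm w)" .
      qed (use C t in auto)
      finally have 3: "\<bar>(A' *v w) \<bullet> w\<bar> \<le> C / t * (CF * (C / t * norm w)) * norm w"
        by (intro order_trans[OF Cauchy_Schwarz_ineq2] mult_right_mono) auto
      have "\<bar>(A *v w) \<bullet> w' + (A *v w' + A' *v w) \<bullet> w\<bar>
         \<le> \<bar>(A *v w) \<bullet> w'\<bar> + \<bar>(A *v w') \<bullet> w\<bar> + \<bar>(A' *v w) \<bullet> w\<bar>"
        unfolding inner_add_left by linarith
      also have "\<dots> \<le> C1 / t * norm w * (L * norm x) + C1 / t * (L * norm x) * norm w + C / t * (CF * (C / t * norm w)) * norm w"
        by (intro add_mono 1 2 3)
      also have "\<dots> = (2 * C1 * L) * (norm w * norm x / t) + (C * CF * C) * ((norm w)\<^sup>2 / t\<^sup>2)"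
        using t by (simp add: power2_eq_square field_simps)
      also have "\<dots> \<le> K * (norm w * norm x / t) + K * ((norm w)\<^sup>2 / t\<^sup>2)"
        unfolding K_def using C C1 CF L t by (intro add_mono mult_right_mono) auto
      finally show ?thesis by (simp add: algebra_simps)
    qed
    ultimately show ?thesis by (auto simp: w_def has_real_derivative_iff_has_vector_derivative)
  qed
  then show thesis using that K by blast
qed

text \<open>The factor of the Mehler kernel that depends on time only.\<close>
definition amp :: "real \<Rightarrow> real" where "amp t = (det Qi / det (Qt t)) powr (1/2)"

lemma amp_pos: "0 < t \<Longrightarrow> t \<le> 2 \<Longrightarrow> 0 < amp t"
  using det_Qi_pos det_Qt_pos[of t] by (simp add: amp_def)

text \<open>The logarithmic derivative is \<open>- d/(2 det Q\<^sub>t)\<close> with \<open>d\<close> of size \<open>t\<^bsup>n-1\<^esup>\<close> and the determinant of size \<open>t\<^sup>n\<close>.\<close>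
lemma amp_deriv: obtains C where "0 < C"
  "\<And>t. 0 < t \<Longrightarrow> t \<le> 1 \<Longrightarrow> amp t \<le> C * (1 / sqrt t) ^ CARD('n)"
  "\<And>t. 0 < t \<Longrightarrow> t \<le> 1 \<Longrightarrow> \<exists>a'. (amp has_real_derivative a') (at t) \<and> \<bar>a'\<bar> \<le> C * (1 / sqrt t) ^ CARD('n) / t"
proof -
  obtain c where c: "0 < c" "\<And>t. 0 < t \<Longrightarrow> t \<le> 2 \<Longrightarrow> c * t ^ CARD('n) \<le> det (Qt t)" by (rule det_Qt_lower) blast
  obtain CQ where CQ: "0 < CQ" "\<And>t. 0 \<le> t \<Longrightarrow> norm (Qt t) \<le> CQ * t" by (rule Qt_upper) blast
  obtain CF where CF: "0 < CF" "\<And>s. 0 \<le> s \<Longrightarrow> norm (cov_rate s) \<le> CF" by (rule cov_rate_bounded) blast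
  define N where "N = CARD('n)"
  have N: "0 < N" by (simp add: N_def)
  define C1 where "C1 = sqrt (det Qi / c)"
  have C1: "0 < C1" using c det_Qi_pos by (simp add: C1_def)
  define P where "P = det_terms TYPE('n) * (real N * CF * CQ ^ (N - 1)) / c"
  have P: "0 \<le> P" using c CQ CF det_terms_pos[where 'n='n] by (simp add: P_def)
  have up: "amp t \<le> C1 * (1 / sqrt t) ^ N" if t: "0 < t" "t \<le> 1" for t
  proof -
    have d: "0 < det (Qt t)" "c * t ^ N \<le> det (Qt t)" using t det_Qt_pos[of t] c(2)[of t] by (auto simp: N_def)
    have "amp t = sqrt (det Qi / det (Qt t))" using d det_Qi_pos by (simp add: amp_def powr_half_sqrt)
    also have "\<dots> \<le> sqrt (det Qi / (c * t ^ N))"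
      using d c t det_Qi_pos by (intro real_sqrt_le_mono divide_left_mono) auto
    also have "\<dots> = C1 * (1 / sqrt t) ^ N"
      by (simp add: C1_def real_sqrt_divide real_sqrt_mult real_sqrt_power power_one_over)
    finally show ?thesis .
  qed
  have der: "\<exists>a'. (amp has_real_derivative a') (at t) \<and> \<bar>a'\<bar> \<le> (C1 * P) * (1 / sqrt t) ^ N / t"
    if t: "0 < t" "t \<le> 1" for t
  proof -
    have e1: "\<bar>Qt t $ i $ j\<bar> \<le> CQ * t" for i j
      using abs_entry_le_norm[of "Qt t" i j] CQ(2)[of t] t by simp
    have e2: "\<bar>cov_rate t $ i $ j\<bar> \<le> CF" for i j
      using abs_entry_le_norm[of "cov_rate t" i j] CF(2)[of t] t by simp
    have "(Qt has_vector_derivative cov_rate t) (at t)" using t by (intro Qt_deriv) auto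
    from det_derivative_bound[OF this e1 e2] obtain d where d: "((\<lambda>t. det (Qt t)) has_real_derivative d) (at t)"
      "\<bar>d\<bar> \<le> det_terms TYPE('n) * (real N * CF * (CQ * t) ^ (N - 1))" unfolding N_def by blast
    have p: "0 < det (Qt t)" "c * t ^ N \<le> det (Qt t)" using t det_Qt_pos[of t] c(2)[of t] by (auto simp: N_def)
    have g: "((\<lambda>t. det Qi / det (Qt t)) has_real_derivative (- (det Qi * d) / (det (Qt t))\<^sup>2)) (at t)"
      using p by (auto intro!: derivative_eq_intros d simp: power2_eq_square)
    have "(amp has_real_derivative amp t * (0 * ln (det Qi / det (Qt t)) + (- (det Qi * d) / (det (Qt t))\<^sup>2) * (1/2) / (det Qi / det (Qt t)))) (at t)"
      unfolding amp_def[abs_def] using p det_Qi_pos by (intro DERIV_powr g DERIV_const) auto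
    moreover have "(0 * ln (det Qi / det (Qt t)) + (- (det Qi * d) / (det (Qt t))\<^sup>2) * (1/2) / (det Qi / det (Qt t)))
       = - d / (2 * det (Qt t))"
      using p det_Qi_pos by (simp add: power2_eq_square field_simps)
    ultimately have a': "(amp has_real_derivative amp t * (- d / (2 * det (Qt t)))) (at t)" by simp
    have "\<bar>d\<bar> / det (Qt t) \<le> (det_terms TYPE('n) * (real N * CF * (CQ * t) ^ (N - 1))) / (c * t ^ N)"
      using d p c t by (intro frac_le) auto
    also have "\<dots> = P / t"
    proof -
      have "t ^ N = t * t ^ (N - 1)" using N by (simp flip: power_Suc)
      then show ?thesis using t c by (simp add: P_def power_mult_distrib field_simps)
    qed
    finally have "\<bar>d\<bar> / det (Qt t) \<le> P / t" .
    moreover have "\<bar>- d / (2 * det (Qt t))\<bar> \<le> \<bar>d\<bar> / det (Qt t)" using p by (simp add: abs_mult field_simps)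
    ultimately have "\<bar>- d / (2 * det (Qt t))\<bar> \<le> P / t" by linarith
    then have "amp t * \<bar>- d / (2 * det (Qt t))\<bar> \<le> (C1 * (1 / sqrt t) ^ N) * (P / t)"
      using up[OF t] amp_pos[of t] t C1 by (intro mult_mono) auto
    then have "\<bar>amp t * (- d / (2 * det (Qt t)))\<bar> \<le> (C1 * P) * (1 / sqrt t) ^ N / t"
      using amp_pos[of t] t by (simp add: abs_mult mult_ac)
    then show ?thesis using a' by blast
  qed
  show thesis
  proof (rule that[of "C1 * (1 + P)"])
    show "0 < C1 * (1 + P)" using C1 P by (simp add: add_pos_nonneg)
    fix t :: real assume t: "0 < t" "t \<le> 1"
    have m: "C1 \<le> C1 * (1 + P)" "C1 * P \<le> C1 * (1 + P)" using C1 P by (simp_all add: algebra_simps)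
    have n: "0 \<le> (1 / sqrt t) ^ N" "0 \<le> (1 / sqrt t) ^ N / t" using t by auto
    show "amp t \<le> C1 * (1 + P) * (1 / sqrt t) ^ CARD('n)"
      using up[OF t] mult_right_mono[OF m(1) n(1)] by (simp add: N_def)
    show "\<exists>a'. (amp has_real_derivative a') (at t) \<and> \<bar>a'\<bar> \<le> C1 * (1 + P) * (1 / sqrt t) ^ CARD('n) / t"
      using der[OF t] mult_right_mono[OF m(2) n(2)] unfolding N_def times_divide_eq_right by (meson order_trans)
  qed
qed

lemma mehler_eq: "mehler Q B t x u = amp t * exp (Rquad Q B x) * exp (- (1/2) * form x u t)"
  by (simp add: mehler_def amp_def form_def Qi_def[symmetric] Qt_def[symmetric] Qt_inv_def[symmetric] Qi_inv_def[symmetric]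
      D_def[symmetric])

lemma mehler_deriv: obtains C c where "0 < C" "0 < c"
  "\<And>x u t. 0 < t \<Longrightarrow> t \<le> 1 \<Longrightarrow> \<exists>k'. ((\<lambda>t. mehler Q B t x u) has_real_derivative k') (at t) \<and>
     \<bar>k'\<bar> \<le> C * exp (Rquad Q B x) * kernel_profile CARD('n) c (sqrt t) (norm (u - D t *v x)) (norm x)"
proof -
  obtain Ca where Ca: "0 < Ca" "\<And>t. 0 < t \<Longrightarrow> t \<le> 1 \<Longrightarrow> amp t \<le> Ca * (1 / sqrt t) ^ CARD('n)"
  "\<And>t. 0 < t \<Longrightarrow> t \<le> 1 \<Longrightarrow> \<exists>a'. (amp has_real_derivative a') (at t) \<and> \<bar>a'\<bar> \<le> Ca * (1 / sqrt t) ^ CARD('n) / t"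
    by (rule amp_deriv) blast
  obtain Cq where Cq: "0 < Cq" "\<And>x u t. 0 < t \<Longrightarrow> t \<le> 1 \<Longrightarrow> \<exists>q'. (form x u has_real_derivative q') (at t) \<and>
     \<bar>q'\<bar> \<le> Cq * ((norm (u - D t *v x))\<^sup>2 / t\<^sup>2 + norm (u - D t *v x) * norm x / t)"
    by (rule form_deriv) blast
  obtain c where c: "0 < c" "\<And>t w. 0 < t \<Longrightarrow> t \<le> 1 \<Longrightarrow> c / t * (norm w)\<^sup>2 \<le> ((Qt_inv t - Qi_inv) *v w) \<bullet> w"
    by (rule form_difference_lower) blast
  show thesis
  proof (rule that[of "Ca * (1 + Cq)" "c / 2"])
    show "0 < Ca * (1 + Cq)" "0 < c / 2" using Ca Cq c by auto
    fix x u :: "real^'n" and t :: real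
    assume t: "0 < t" "t \<le> 1"
    define w where "w = u - D t *v x"
    define S where "S = (norm w)\<^sup>2 / t\<^sup>2 + norm w * norm x / t"
    define A where "A = (1 / sqrt t) ^ CARD('n)"
    define R where "R = exp (Rquad Q B x)"
    define e where "e = exp (- (1/2) * form x u t)"
    have S: "0 \<le> S" and A: "0 \<le> A" and R: "0 \<le> R" using t by (auto simp: S_def A_def R_def)
    obtain a' where a': "(amp has_real_derivative a') (at t)" "\<bar>a'\<bar> \<le> Ca * A / t"
      using Ca(3)[OF t] unfolding A_def by blast
    obtain q' where q': "(form x u has_real_derivative q') (at t)" "\<bar>q'\<bar> \<le> Cq * S"
      using Cq(2)[OF t] unfolding S_def w_def by blast
    have am: "0 < amp t" "amp t \<le> Ca * A" using amp_pos[of t] Ca(2)[of t] t by (auto simp: A_def)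
    define k' where "k' = (a' - amp t * q' / 2) * R * e"
    have "((\<lambda>t. mehler Q B t x u) has_real_derivative k') (at t)"
      unfolding mehler_eq R_def[symmetric] k'_def e_def
      by (rule derivative_eq_intros a'(1) q'(1) refl | (simp add: algebra_simps))+
    moreover have "\<bar>k'\<bar> \<le> Ca * (1 + Cq) * R * (A * (1 / t + S) * exp (- (c / 2) * ((norm w)\<^sup>2 / t)))"
    proof -
      have "\<bar>a' - amp t * q' / 2\<bar> \<le> \<bar>a'\<bar> + amp t * \<bar>q'\<bar>"
      proof -
        have "\<bar>amp t * q' / 2\<bar> \<le> amp t * \<bar>q'\<bar>" using am by (simp add: abs_mult)
        then show ?thesis by linarith
      qed
      also have "\<dots> \<le> Ca * A / t + (Ca * A) * (Cq * S)"
        using a' q' am S Cq by (intro add_mono mult_mono) auto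
      also have "\<dots> \<le> Ca * (1 + Cq) * (A * (1 / t + S))"
      proof -
        have "0 \<le> Ca * A * S" "0 \<le> Ca * A * Cq * (1 / t)" using Ca(1) A S Cq(1) t by simp_all
        moreover have "Ca * (1 + Cq) * (A * (1 / t + S)) = Ca * A / t + (Ca * A) * (Cq * S) + (Ca * A * S + Ca * A * Cq * (1 / t))"
          by (simp add: algebra_simps)
        ultimately show ?thesis by linarith
      qed
      finally have 1: "\<bar>a' - amp t * q' / 2\<bar> \<le> Ca * (1 + Cq) * (A * (1 / t + S))" .
      have 2: "e \<le> exp (- (c / 2) * ((norm w)\<^sup>2 / t))"
        using c(2)[OF t, of w] unfolding e_def form_def w_def[symmetric] by simp
      have "\<bar>k'\<bar> = \<bar>a' - amp t * q' / 2\<bar> * R * e" using R by (simp add: k'_def abs_mult e_def)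
      also have "\<dots> \<le> (Ca * (1 + Cq) * (A * (1 / t + S))) * R * exp (- (c / 2) * ((norm w)\<^sup>2 / t))"
        using 1 2 R Ca Cq A S t by (intro mult_mono) (auto simp: e_def)
      finally show ?thesis by (simp add: mult_ac)
    qed
    ultimately show "\<exists>k'. ((\<lambda>t. mehler Q B t x u) has_real_derivative k') (at t) \<and>
     \<bar>k'\<bar> \<le> Ca * (1 + Cq) * exp (Rquad Q B x) * kernel_profile CARD('n) (c / 2) (sqrt t) (norm (u - D t *v x)) (norm x)"
      unfolding kernel_profile_def real_sqrt_pow2[OF less_imp_le[OF t(1)]] S_def A_def R_def w_def add.assoc by blast
  qed
qed

lemma D_displacement: obtains C where "0 < C"
  "\<And>t x. 0 \<le> t \<Longrightarrow> t \<le> 1 \<Longrightarrow> norm (D t *v x - x) \<le> C * t * norm x"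
proof -
  obtain L where L: "1 \<le> L" "\<And>t x. \<bar>t\<bar> \<le> 2 \<Longrightarrow> norm (D_velocity t *v x) \<le> L * norm x"
    by (rule D_bounds) blast
  have "norm (D t *v x - x) \<le> L * t * norm x" if t: "0 \<le> t" "t \<le> 1" for t x
  proof (cases "t = 0")
    case False
    have d: "((\<lambda>t. D t *v x) has_vector_derivative (D_velocity s *v x)) (at s)" for s
      by (rule bounded_linear.has_vector_derivative[OF mv.bounded_linear_left D_deriv])
    have p: "((\<lambda>s. L * norm x * s) has_vector_derivative L * norm x) (at s)" for s
      unfolding has_real_derivative_iff_has_vector_derivative[symmetric] by (auto intro!: derivative_eq_intros)
    have "norm (D t *v x - D 0 *v x) \<le> L * norm x * t - L * norm x * 0"
    proof (rule differentiable_bound_general[OF _ _ _ d p])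
      show "0 < t" using t False by simp
      show "continuous_on {0..t} (\<lambda>t. D t *v x)"
        by (intro mv.continuous_on continuous_on_D continuous_on_const)
      show "continuous_on {0..t} (\<lambda>s. L * norm x * s)" by (intro continuous_intros)
      fix s assume "0 < s" "s < t"
      then show "norm (D_velocity s *v x) \<le> L * norm x"
        using t by (intro L) auto
    qed
    then show ?thesis by (simp add: D_0 mult_ac)
  qed (simp add: D_0)
  then show thesis using that[of L] L by simp
qed

text \<open>Only \<open>1/(1 + \<bar>x\<bar>) \<le> G (\<bar>w\<bar> + \<surd>t)\<close> has to be checked. If \<open>t (1 + \<bar>x\<bar>)\<^sup>2\<close> is small, then \<open>D\<^sub>t x\<close> is still so close
  to \<open>x\<close> that \<open>\<bar>w\<bar>\<close> inherits the lower bound for \<open>\<bar>u - x\<bar>\<close>; otherwise \<open>\<surd>t\<close> is large enough by itself.\<close>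
lemma mehler_deriv_global:
  assumes \<delta>: "0 < \<delta>"
  obtains C where "0 < C"
  "\<And>x u t. 0 < t \<Longrightarrow> t \<le> 1 \<Longrightarrow> \<delta> / (1 + norm x) \<le> norm (u - x) \<Longrightarrow>
     \<exists>k'. ((\<lambda>t. mehler Q B t x u) has_real_derivative k') (at t) \<and>
     \<bar>k'\<bar> \<le> C * exp (Rquad Q B x) * (1 + norm x) * tube_weight x (u - D t *v x)"
proof -
  obtain C c where C: "0 < C" "0 < c"
    "\<And>x u t. 0 < t \<Longrightarrow> t \<le> 1 \<Longrightarrow> \<exists>k'. ((\<lambda>t. mehler Q B t x u) has_real_derivative k') (at t) \<and>
     \<bar>k'\<bar> \<le> C * exp (Rquad Q B x) * kernel_profile CARD('n) c (sqrt t) (norm (u - D t *v x)) (norm x)"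
    by (rule mehler_deriv) blast
  obtain L where L: "0 < L" "\<And>t x. 0 \<le> t \<Longrightarrow> t \<le> 1 \<Longrightarrow> norm (D t *v x - x) \<le> L * t * norm x"
    by (rule D_displacement) blast
  define G where "G = 2 / \<delta> + sqrt (2 * L / \<delta>)"
  have G: "0 \<le> G" using \<delta> L by (simp add: G_def)
  obtain M where M: "0 < M"
    "\<And>\<tau> \<omega> b. 0 < \<tau> \<Longrightarrow> 0 \<le> \<omega> \<Longrightarrow> 1 \<le> b \<Longrightarrow> 1 / b \<le> G * (\<omega> + \<tau>) \<Longrightarrow>
      kernel_profile CARD('n) c \<tau> \<omega> b \<le> M * b * (1 / (1 / b + \<omega>) ^ Suc (CARD('n)))"
    by (rule kernel_profile_le[OF C(2) G, of "CARD('n)"]) blast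
  show thesis
  proof (rule that[of "C * M"])
    show "0 < C * M" using C M by simp
    fix x u :: "real^'n" and t :: real
    assume t: "0 < t" "t \<le> 1" and far: "\<delta> / (1 + norm x) \<le> norm (u - x)"
    define w where "w = norm (u - D t *v x)"
    define b where "b = 1 + norm x"
    define \<tau> where "\<tau> = sqrt t"
    have b: "1 \<le> b" "norm x \<le> b" by (auto simp: b_def)
    have tau: "0 < \<tau>" "\<tau>\<^sup>2 = t" using t by (auto simp: \<tau>_def)
    have w0: "0 \<le> w" by (simp add: w_def)
    have near: "1 / b \<le> G * (w + \<tau>)"
    proof (cases "L * t * b \<le> \<delta> / b / 2")
      case True
      have "\<delta> / b \<le> norm (u - x)" using far by (simp add: b_def)
      also have "\<dots> \<le> w + norm (D t *v x - x)"
        unfolding w_def by (metis norm_triangle_ineq diff_add_cancel add_diff_eq)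
      also have "norm (D t *v x - x) \<le> L * t * b"
        using L(2)[of t x] t L(1) b by (meson less_imp_le mult_left_mono mult_nonneg_nonneg order_trans)
      finally have "\<delta> / b / 2 \<le> w" using True by linarith
      then have "1 / b \<le> 2 / \<delta> * w" using \<delta> b by (simp add: field_simps)
      also have "\<dots> \<le> G * (w + \<tau>)"
        using \<delta> w0 tau L G by (intro mult_mono) (auto simp: G_def)
      finally show ?thesis .
    next
      case False
      have "(1 / b)\<^sup>2 \<le> 2 * L / \<delta> * t" using False b \<delta> by (simp add: power2_eq_square field_simps)
      then have "1 / b \<le> sqrt (2 * L / \<delta> * t)" by (rule real_le_rsqrt)
      also have "\<dots> = sqrt (2 * L / \<delta>) * \<tau>" by (simp only: \<tau>_def real_sqrt_mult[symmetric])
      also have "\<dots> \<le> G * (w + \<tau>)"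
        using \<delta> w0 tau L G by (intro mult_mono) (auto simp: G_def)
      finally show ?thesis .
    qed
    obtain k' where k': "((\<lambda>t. mehler Q B t x u) has_real_derivative k') (at t)"
      "\<bar>k'\<bar> \<le> C * exp (Rquad Q B x) * kernel_profile CARD('n) c \<tau> w (norm x)"
      using C(3)[OF t] unfolding w_def \<tau>_def by blast
    have "kernel_profile CARD('n) c \<tau> w (norm x) \<le> kernel_profile CARD('n) c \<tau> w b"
      unfolding kernel_profile_def using tau t b w0 by (intro mult_right_mono mult_left_mono add_left_mono divide_right_mono) auto
    also have "\<dots> \<le> M * b * (1 / (1 / b + w) ^ Suc (CARD('n)))"
      by (rule M(2)[OF tau(1) w0 b(1) near])
    finally have "\<bar>k'\<bar> \<le> C * exp (Rquad Q B x) * (M * b * (1 / (1 / b + w) ^ Suc (CARD('n))))"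
      using k'(2) C(1) by (meson less_imp_le mult_left_mono mult_nonneg_nonneg exp_ge_zero order_trans)
    also have "\<dots> = C * M * exp (Rquad Q B x) * (1 + norm x) * tube_weight x (u - D t *v x)"
      by (simp add: tube_weight_def b_def w_def mult_ac)
    finally show "\<exists>k'. ((\<lambda>t. mehler Q B t x u) has_real_derivative k') (at t) \<and>
     \<bar>k'\<bar> \<le> C * M * exp (Rquad Q B x) * (1 + norm x) * tube_weight x (u - D t *v x)"
      using k'(1) by blast
  qed
qed

end

section \<open>The variation of the global part\<close>

lemma powr_sum_root_le_sum:
  fixes a :: "'i \<Rightarrow> real"
  assumes "finite I" and a: "\<And>i. i \<in> I \<Longrightarrow> 0 \<le> a i" and p: "1 \<le> p"
  shows "(\<Sum>i\<in>I. a i powr p) powr (1 / p) \<le> (\<Sum>i\<in>I. a i)"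
proof (cases "(\<Sum>i\<in>I. a i) = 0")
  case True
  then have "\<And>i. i \<in> I \<Longrightarrow> a i = 0" using sum_nonneg_eq_0_iff[of I a] assms by auto
  then have "(\<Sum>i\<in>I. a i powr p) = 0" by (intro sum.neutral) simp
  then show ?thesis using True by simp
next
  case False
  define s where "s = (\<Sum>i\<in>I. a i)"
  have s: "0 < s" using False a unfolding s_def by (metis less_eq_real_def sum_nonneg)
  have "a i powr p \<le> s powr p * (a i / s)" if i: "i \<in> I" for i
  proof -
    have "a i \<le> s" unfolding s_def using assms i by (intro member_le_sum) auto
    then have q: "0 \<le> a i / s" "a i / s \<le> 1" using s a[OF i] by auto
    have "(a i / s) powr p \<le> (a i / s) powr 1"
      using q p by (intro powr_mono')
    also have "\<dots> = a i / s" by (rule powr_one[OF q(1)])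
    finally have "s powr p * (a i / s) powr p \<le> s powr p * (a i / s)"
      by (rule mult_left_mono) simp
    moreover have "s powr p * (a i / s) powr p = a i powr p"
      using s a[OF i] by (simp flip: powr_mult)
    ultimately show ?thesis by simp
  qed
  then have "(\<Sum>i\<in>I. a i powr p) \<le> (\<Sum>i\<in>I. s powr p * (a i / s))" by (rule sum_mono)
  also have "\<dots> = s powr p * ((\<Sum>i\<in>I. a i) / s)" by (simp add: sum_distrib_left sum_divide_distrib)
  also have "\<dots> = s powr p" using s by (simp add: s_def)
  finally have "(\<Sum>i\<in>I. a i powr p) powr (1 / p) \<le> (s powr p) powr (1 / p)"
    using p by (intro powr_mono2) (auto intro: sum_nonneg)
  then show ?thesis using p s by (simp add: powr_powr s_def)
qed

lemma continuous_on_of_smooth: "smooth f \<Longrightarrow> continuous_on S f"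
  unfolding smooth_def using Ck.simps(1)[of f] continuous_on_subset by blast

locale localization = stable_drift Q B for Q B :: "real^'n^'n" +
  fixes r rt :: "nat \<Rightarrow> real^'n \<Rightarrow> real"
  assumes r_smooth: "\<And>j. smooth (r j)"
    and r_nonneg: "\<And>j x. 0 \<le> r j x"
    and r_sum: "\<And>x. (\<lambda>j. r j x) sums 1"
    and r_supp: "\<And>j. supp (r j) \<subseteq> ring_set Q B (int j) \<union> ring_set Q B (int j + 1)"
    and rt_smooth: "\<And>j. smooth (rt j)"
    and rt_range: "\<And>j x. rt j x \<in> {0..1}"
    and rt_one: "\<And>j x. x \<in> (\<Union>\<nu>\<in>{int j - 1..int j + 2}. ring_set Q B \<nu>) \<Longrightarrow> rt j x = 1"
begin

abbreviation R :: "real^'n \<Rightarrow> real" where "R \<equiv> Rquad Q B"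
abbreviation \<gamma> :: "(real^'n) measure" where "\<gamma> \<equiv> gauss_inf Q B"

lemma R_nonneg: "0 \<le> R x"
proof -
  obtain c where "0 < c" "\<And>w. c * (norm w)\<^sup>2 \<le> (Qi_inv *v w) \<bullet> w" by (rule Qi_inv_lower) blast
  then have "0 \<le> (Qi_inv *v x) \<bullet> x" by (smt (verit) mult_nonneg_nonneg zero_le_power2)
  then show ?thesis by (simp add: Rquad_eq)
qed

lemma r_nonzero:
  assumes "r j u \<noteq> 0" shows "real j \<le> R u" "R u \<le> real j + 2"
proof -
  have "u \<in> supp (r j)" unfolding supp_def using assms closure_subset by fastforce
  then have "u \<in> ring_set Q B (int j) \<union> ring_set Q B (int j + 1)" using r_supp by blast
  then show "real j \<le> R u" "R u \<le> real j + 2" by (auto simp: ring_set_def)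
qed

text \<open>A finite set of indices outside of which \<open>r j u\<close> vanishes; it makes the series for \<open>\<eta>\<close> a finite sum.\<close>
definition levels :: "real^'n \<Rightarrow> nat set" where "levels u = {..nat \<lceil>R u\<rceil>}"

lemma r_outside_levels: "j \<notin> levels u \<Longrightarrow> r j u = 0"
  using r_nonzero(1)[of j u] by (auto simp: levels_def) linarith

lemma r_finite_sum: "(\<Sum>j\<in>levels u. r j u) = 1"
proof -
  have "(\<Sum>j. r j u) = (\<Sum>j\<in>levels u. r j u)"
    by (rule suminf_finite) (auto simp: r_outside_levels, simp add: levels_def)
  then show ?thesis using sums_unique[OF r_sum[of u]] by simp
qed

lemma eta_finite_sum: "eta r rt x u = (\<Sum>j\<in>levels u. rt j x * r j u)"
  unfolding eta_def by (rule suminf_finite) (auto simp: r_outside_levels, simp add: levels_def)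

lemma eta_range: "0 \<le> eta r rt x u" "eta r rt x u \<le> 1"
proof -
  have "rt j x * r j u \<le> 1 * r j u" for j using rt_range[of j x] r_nonneg[of j u] by (intro mult_right_mono) auto
  then have "eta r rt x u \<le> (\<Sum>j\<in>levels u. r j u)" unfolding eta_finite_sum by (intro sum_mono) simp
  then show "eta r rt x u \<le> 1" by (simp add: r_finite_sum)
  show "0 \<le> eta r rt x u" unfolding eta_finite_sum
    using rt_range r_nonneg by (intro sum_nonneg mult_nonneg_nonneg) auto
qed

text \<open>If \<open>R(x)\<close> and \<open>R(u)\<close> are closer than 1, every \<open>j\<close> with \<open>r j u \<noteq> 0\<close> has \<open>x\<close> in the region where \<open>rt j\<close> equals 1.\<close>
lemma eta_not_one_levels_apart:
  assumes "eta r rt x u \<noteq> 1"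
  shows "1 \<le> \<bar>R u - R x\<bar>"
proof (rule ccontr)
  assume close: "\<not> 1 \<le> \<bar>R u - R x\<bar>"
  have "rt j x * r j u = r j u" for j
  proof (cases "r j u = 0")
    case False
    note j = r_nonzero[OF False]
    \<comment> \<open>From \<open>j \<le> R u \<le> j + 2\<close> and closeness, \<open>j - 1 < R x < j + 3\<close>.\<close>
    define \<nu> where "\<nu> = \<lfloor>R x\<rfloor>"
    have "x \<in> ring_set Q B \<nu>"
      using R_nonneg[of x] unfolding ring_set_def \<nu>_def mem_Collect_eq by (intro conjI; linarith)
    moreover have "\<nu> \<in> {int j - 1..int j + 2}" using close j unfolding \<nu>_def by (simp, linarith)
    ultimately have "rt j x = 1" by (intro rt_one) blast
    then show ?thesis by simp
  qed simp
  then have "eta r rt x u = (\<Sum>j\<in>levels u. r j u)" unfolding eta_finite_sum by (intro sum.cong refl)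
  then show False using assms by (simp add: r_finite_sum)
qed

text \<open>\<open>R\<close> is a quadratic form, so over a distance \<open>d \<le> 1\<close> it changes by at most a multiple of \<open>d (1 + \<bar>x\<bar>)\<close>.\<close>
lemma eta_not_one_far: obtains \<delta> where "0 < \<delta>"
  "\<And>x u. eta r rt x u \<noteq> 1 \<Longrightarrow> \<delta> / (1 + norm x) \<le> norm (u - x)"
proof -
  define K where "K = norm Qi_inv + 1"
  have K: "1 \<le> K" by (simp add: K_def)
  show thesis
  proof (rule that[of "1 / K"])
    show "0 < 1 / K" using K by simp
    fix x u assume "eta r rt x u \<noteq> 1"
    then have 1: "1 \<le> \<bar>R u - R x\<bar>" by (rule eta_not_one_levels_apart)
    define d where "d = norm (u - x)"
    have p: "0 < 1 + norm x" by (simp add: add_pos_nonneg)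
    have "R u - R x = 1/2 * ((Qi_inv *v (u - x)) \<bullet> u + (Qi_inv *v x) \<bullet> (u - x))"
      by (simp add: Rquad_eq mv.diff_right inner_diff_left inner_diff_right)
    then have "2 * \<bar>R u - R x\<bar> = \<bar>(Qi_inv *v (u - x)) \<bullet> u + (Qi_inv *v x) \<bullet> (u - x)\<bar>"
      by (simp only: abs_mult) simp
    also have "\<dots> \<le> \<bar>(Qi_inv *v (u - x)) \<bullet> u\<bar> + \<bar>(Qi_inv *v x) \<bullet> (u - x)\<bar>" by (rule abs_triangle_ineq)
    also have "\<bar>(Qi_inv *v (u - x)) \<bullet> u\<bar> + \<bar>(Qi_inv *v x) \<bullet> (u - x)\<bar> \<le> norm Qi_inv * d * norm u + norm Qi_inv * norm x * d"
      unfolding d_def by (intro add_mono abs_matrix_form_le)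
    also have "\<dots> = norm Qi_inv * (d * (norm u + norm x))" by (simp add: algebra_simps)
    also have "\<dots> \<le> K * (d * (norm u + norm x))" unfolding K_def d_def by (intro mult_right_mono) auto
    also have "\<dots> \<le> K * (d * (2 * norm x + d))"
      using K norm_triangle_ineq[of x "u - x"] unfolding d_def by (intro mult_left_mono) auto
    finally have "2 * \<bar>R u - R x\<bar> \<le> K * (d * (2 * norm x + d))" .
    then have 2: "2 \<le> K * (d * (2 * norm x + d))" by (rule order_trans[rotated]) (use 1 in simp)
    show "1 / K / (1 + norm x) \<le> norm (u - x)"
    proof (cases "d \<ge> 1")
      case True
      have "1 \<le> K * (1 + norm x)" using K mult_mono[of 1 K 1 "1 + norm x"] by simp
      then have "1 / K / (1 + norm x) \<le> 1" using K p by (simp add: field_simps)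
      then show ?thesis using True by (simp add: d_def)
    next
      case False
      have "K * (d * (2 * norm x + d)) \<le> K * (d * (2 * (1 + norm x)))"
        using False K by (intro mult_left_mono) (auto simp: d_def)
      also have "\<dots> = 2 * (K * (d * (1 + norm x)))" by (simp add: algebra_simps)
      finally have "2 * 1 \<le> 2 * (K * (d * (1 + norm x)))" using 2 by (simp only: mult_1_right order_trans)
      then have "1 \<le> K * (d * (1 + norm x))" by (simp only: mult_le_cancel_left_pos zero_less_numeral)
      moreover have "1 / K / q \<le> e" if "1 \<le> K * (e * q)" "0 < q" for e q :: real
        using that K by (simp add: field_simps)
      ultimately show ?thesis using p unfolding d_def by blast
    qed
  qed
qed

lemma continuous_eta: "continuous_on S (\<lambda>x. eta r rt x u)"
  unfolding eta_finite_sum by (intro continuous_intros continuous_on_of_smooth rt_smooth)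

lemma eta_measurable[measurable]: "(\<lambda>u. eta r rt x u) \<in> borel_measurable borel"
proof -
  have [measurable]: "r j \<in> borel_measurable borel" for j
    by (rule borel_measurable_continuous_onI[OF continuous_on_of_smooth[OF r_smooth]])
  show ?thesis unfolding eta_def by measurable
qed

lemma continuous_mehler: "continuous_on S (\<lambda>x. mehler Q B t x u)" "continuous_on S (\<lambda>u. mehler Q B t x u)"
  unfolding mehler_eq form_def
  by (intro continuous_intros mv.continuous_on continuous_on_Rquad)+

lemma mehler_measurable[measurable]: "(\<lambda>u. mehler Q B t x u) \<in> borel_measurable borel"
  by (rule borel_measurable_continuous_onI[OF continuous_mehler(2)])

lemma mehler_bounds:
  assumes t: "0 < t" "t \<le> 1"
  shows "0 \<le> mehler Q B t x u" "mehler Q B t x u \<le> amp t * exp (R x)"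
proof -
  obtain c where c: "0 < c" "\<And>t w. 0 < t \<Longrightarrow> t \<le> 1 \<Longrightarrow> c / t * (norm w)\<^sup>2 \<le> ((Qt_inv t - Qi_inv) *v w) \<bullet> w"
    by (rule form_difference_lower) blast
  have "0 \<le> c / t * (norm (u - D t *v x))\<^sup>2" using c t by simp
  then have "0 \<le> form x u t" unfolding form_def using c(2)[OF t, of "u - D t *v x"] by linarith
  then have "exp (- (1/2) * form x u t) \<le> 1" by simp
  moreover have a: "0 < amp t" using t by (intro amp_pos) auto
  ultimately show "mehler Q B t x u \<le> amp t * exp (R x)"
    unfolding mehler_eq using mult_left_mono[of "exp (- (1/2) * form x u t)" 1 "amp t * exp (R x)"] by simp
  show "0 \<le> mehler Q B t x u" unfolding mehler_eq using a by simp
qed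

lemma gauss_density: obtains k where "0 < k" "\<gamma> = density lborel (\<lambda>x. ennreal (k * exp (- R x)))"
proof
  show "0 < (2 * pi) powr (- real CARD('n) / 2) * det Qi powr (-1/2)" using det_Qi_pos by simp
  show "\<gamma> = density lborel (\<lambda>x. ennreal ((2 * pi) powr (- real CARD('n) / 2) * det Qi powr (-1/2) * exp (- R x)))"
    by (simp add: gauss_inf_def Qi_def Rquad_def)
qed

lemma sets_gamma[measurable_cong, simp]: "sets \<gamma> = sets borel" and space_gamma[simp]: "space \<gamma> = UNIV"
  by (simp_all add: gauss_inf_def)

definition glob :: "real \<Rightarrow> real^'n \<Rightarrow> real^'n \<Rightarrow> real" where
  "glob t x u = mehler Q B t x u * (1 - eta r rt x u)"

lemma H_glob_eq: "H_glob Q B r rt t f x = (LINT u|\<gamma>. glob t x u * f u)"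
  by (simp add: H_glob_def glob_def)

lemma glob_measurable[measurable]: "(\<lambda>u. glob t x u) \<in> borel_measurable borel"
  unfolding glob_def by measurable

lemma abs_glob_le: "0 < t \<Longrightarrow> t \<le> 1 \<Longrightarrow> \<bar>glob t x u\<bar> \<le> amp t * exp (R x)"
proof -
  assume t: "0 < t" "t \<le> 1"
  have "\<bar>glob t x u\<bar> = mehler Q B t x u * (1 - eta r rt x u)"
    using mehler_bounds[OF t, of x u] eta_range[of x u] by (simp add: glob_def abs_mult)
  also have "\<dots> \<le> mehler Q B t x u * 1"
    using mehler_bounds[OF t, of x u] eta_range[of x u] by (intro mult_left_mono) auto
  finally show ?thesis using mehler_bounds[OF t, of x u] by simp
qed

lemma glob_integrable:
  assumes t: "0 < t" "t \<le> 1" and f: "integrable \<gamma> f"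
  shows "integrable \<gamma> (\<lambda>u. glob t x u * f u)"
proof (rule Bochner_Integration.integrable_bound)
  show "integrable \<gamma> (\<lambda>u. amp t * exp (R x) * f u)" using f by simp
  show "(\<lambda>u. glob t x u * f u) \<in> borel_measurable \<gamma>" using f by measurable
  show "AE u in \<gamma>. norm (glob t x u * f u) \<le> norm (amp t * exp (R x) * f u)"
  proof (rule AE_I2)
    fix u
    have "\<bar>glob t x u\<bar> \<le> \<bar>amp t * exp (R x)\<bar>" using abs_glob_le[OF t, of x u] by linarith
    then show "norm (glob t x u * f u) \<le> norm (amp t * exp (R x) * f u)"
      unfolding real_norm_def abs_mult[of _ "f u"] by (rule mult_right_mono) simp
  qed
qed

text \<open>Dominated convergence; the kernel is bounded in \<open>u\<close>, locally uniformly in \<open>x\<close>, because its Gaussian exponent is nonpositive.\<close>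
lemma continuous_H_glob:
  assumes t: "0 < t" "t \<le> 1" and f: "integrable \<gamma> f"
  shows "continuous_on UNIV (\<lambda>x. H_glob Q B r rt t f x)"
  unfolding continuous_on_sequentially comp_def
proof (intro allI ballI impI, elim conjE)
  fix xs :: "nat \<Rightarrow> real^'n" and x
  assume xs: "xs \<longlonglongrightarrow> x"
  have cR: "(\<lambda>n. exp (R (xs n))) \<longlonglongrightarrow> exp (R x)"
    by (intro tendsto_exp continuous_on_tendsto_compose[OF continuous_on_Rquad[of UNIV] xs]) auto
  have "Bseq (\<lambda>n. exp (R (xs n)))" by (rule convergent_imp_Bseq[OF convergentI[OF cR]])
  then obtain K where K: "\<And>n. norm (exp (R (xs n))) \<le> K" unfolding Bseq_def by blast
  show "(\<lambda>n. H_glob Q B r rt t f (xs n)) \<longlonglongrightarrow> H_glob Q B r rt t f x"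
    unfolding H_glob_eq
  proof (rule integral_dominated_convergence)
    show "(\<lambda>u. glob t x u * f u) \<in> borel_measurable \<gamma>" using f by measurable
    show "(\<lambda>u. glob t (xs n) u * f u) \<in> borel_measurable \<gamma>" for n using f by measurable
    show "integrable \<gamma> (\<lambda>u. amp t * K * \<bar>f u\<bar>)" using f by simp
    show "AE u in \<gamma>. (\<lambda>n. glob t (xs n) u * f u) \<longlonglongrightarrow> glob t x u * f u"
    proof (rule AE_I2)
      fix u
      have "continuous_on UNIV (\<lambda>x. glob t x u * f u)"
        unfolding glob_def by (intro continuous_intros continuous_mehler continuous_eta)
      from continuous_on_tendsto_compose[OF this xs]
      show "(\<lambda>n. glob t (xs n) u * f u) \<longlonglongrightarrow> glob t x u * f u" by simp
    qed
    show "AE u in \<gamma>. norm (glob t (xs n) u * f u) \<le> amp t * K * \<bar>f u\<bar>" for n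
    proof (rule AE_I2)
      fix u
      have "\<bar>glob t (xs n) u\<bar> \<le> amp t * exp (R (xs n))" by (rule abs_glob_le[OF t])
      also have "\<dots> \<le> amp t * K" using K[of n] amp_pos[of t] t by (intro mult_left_mono) simp_all
      finally show "norm (glob t (xs n) u * f u) \<le> amp t * K * \<bar>f u\<bar>"
        by (simp add: abs_mult mult_right_mono)
    qed
  qed
qed

text \<open>The supremum runs over uncountably many partitions, but each partition contributes a continuous function of \<open>x\<close>, and a supremum of continuous functions has open superlevel sets.\<close>
lemma variation_level_set_open:
  assumes f: "integrable \<gamma> f" and \<rho>: "1 \<le> \<rho>"
  shows "open {x. ennreal \<alpha> < variation_seminorm \<rho> {0<..1} (\<lambda>t. H_glob Q B r rt t f x)}"
proof -
  define P where "P = {(N::nat, t::nat \<Rightarrow> real). (\<forall>i\<le>N. t i \<in> {0<..1}) \<and> (\<forall>i<N. t i < t (Suc i))}"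
  define v :: "nat \<times> (nat \<Rightarrow> real) \<Rightarrow> real^'n \<Rightarrow> real" where "v = (\<lambda>(N, t) x. (\<Sum>i=1..N. \<bar>H_glob Q B r rt (t i) f x - H_glob Q B r rt (t (i - 1)) f x\<bar> powr \<rho>) powr (1 / \<rho>))"
  have "{x. ennreal \<alpha> < variation_seminorm \<rho> {0<..1} (\<lambda>t. H_glob Q B r rt t f x)}
     = (\<Union>p\<in>P. {x. ennreal \<alpha> < ennreal (v p x)})"
    unfolding variation_seminorm_def P_def[symmetric] less_SUP_iff v_def by (auto simp: split_beta)
  moreover have "open {x. ennreal \<alpha> < ennreal (v p x)}" if p: "p \<in> P" for p
  proof -
    obtain N t where pN: "p = (N, t)" by (cases p)
    have ti: "0 < t i \<and> t i \<le> 1" if "i \<le> N" for i using p that by (auto simp: P_def pN)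
    have "continuous_on UNIV (v p)"
      unfolding v_def pN prod.case
      by (intro continuous_on_powr' continuous_intros continuous_H_glob f ballI)
        (use ti \<rho> in \<open>auto intro!: sum_nonneg\<close>)
    then have "continuous_on UNIV (\<lambda>x. ennreal (v p x))" by (intro continuous_on_ennreal)
    then show ?thesis by (intro open_Collect_less continuous_on_const)
  qed
  ultimately show ?thesis by auto
qed

text \<open>Comparing the kernel with a primitive \<open>G\<close> of the weight on each interval of the partition makes the sum telescope; this holds uniformly in the partition.\<close>
lemma kernel_variation_le:
  fixes L \<kappa> :: real
  assumes flow: "expanding_flow (\<lambda>t x. D t *v x) R L \<kappa>"
  obtains C where "0 < C"
    "\<And>N t x u. (\<forall>i\<le>N. t i \<in> {0<..1}) \<Longrightarrow> (\<forall>i<N. t i < t (Suc i)) \<Longrightarrow>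
      ennreal (\<Sum>i=1..N. \<bar>glob (t i) x u - glob (t (i - 1)) x u\<bar>)
      \<le> ennreal (C * exp (R x) * (1 + norm x)) * expanding_flow.tube (\<lambda>t x. D t *v x) 1 x u"
proof -
  interpret expanding_flow "\<lambda>t x. D t *v x" R L \<kappa> by (rule flow)
  obtain \<delta> where \<delta>: "0 < \<delta>" "\<And>x u. eta r rt x u \<noteq> 1 \<Longrightarrow> \<delta> / (1 + norm x) \<le> norm (u - x)"
    by (rule eta_not_one_far) blast
  obtain C where C: "0 < C"
    "\<And>x u t. 0 < t \<Longrightarrow> t \<le> 1 \<Longrightarrow> \<delta> / (1 + norm x) \<le> norm (u - x) \<Longrightarrow>
     \<exists>k'. ((\<lambda>t. mehler Q B t x u) has_real_derivative k') (at t) \<and>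
     \<bar>k'\<bar> \<le> C * exp (R x) * (1 + norm x) * tube_weight x (u - D t *v x)"
    by (rule mehler_deriv_global[OF \<delta>(1)]) blast
  have "ennreal (\<Sum>i=1..N. \<bar>glob (t i) x u - glob (t (i - 1)) x u\<bar>)
      \<le> ennreal (C * exp (R x) * (1 + norm x)) * tube 1 x u"
    if ti: "\<forall>i\<le>N. t i \<in> {0<..1}" and inc: "\<forall>i<N. t i < t (Suc i)" for N t x u
  proof (cases "eta r rt x u = 1")
    case True
    then show ?thesis by (simp add: glob_def)
  next
    case False
    define c where "c = C * exp (R x) * (1 + norm x)"
    have c: "0 < c" using C by (simp add: c_def add_pos_nonneg)
    define W where "W s = tube_weight x (u - D s *v x)" for s
    have W0: "0 \<le> W s" for s by (simp add: W_def tube_weight_nonneg)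
    have "continuous_on UNIV (\<lambda>s. (x, u - D s *v x))"
      by (intro continuous_intros mv.continuous_on continuous_on_D)
    from continuous_on_compose2[OF continuous_on_tube_weight this]
    have "continuous_on UNIV W" unfolding W_def[abs_def] by simp
    then have Wc: "continuous_on S W" for S by (rule continuous_on_subset) simp
    define G where "G s = integral {0..s} W" for s
    have G': "(G has_vector_derivative W s) (at s)" if "0 < s" "s < 2" for s
      using integral_has_vector_derivative[OF Wc[of "{0..2}"], of s] that
      by (simp add: G_def[abs_def] at_within_Icc_at)
    define k where "k s = mehler Q B s x u" for s
    have "\<exists>k'. \<forall>s\<in>{0<..1}. (k has_real_derivative k' s) (at s) \<and> \<bar>k' s\<bar> \<le> c * W s"
      using C(2)[OF _ _ \<delta>(2)[OF False]] unfolding k_def[abs_def] c_def W_def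
      by (intro bchoice ballI) auto
    then obtain k' where "\<forall>s\<in>{0<..1}. (k has_real_derivative k' s) (at s) \<and> \<bar>k' s\<bar> \<le> c * W s" by blast
    then have k': "\<And>s. 0 < s \<Longrightarrow> s \<le> 1 \<Longrightarrow> (k has_real_derivative k' s) (at s)"
      "\<And>s. 0 < s \<Longrightarrow> s \<le> 1 \<Longrightarrow> \<bar>k' s\<bar> \<le> c * W s" by auto
    have step: "\<bar>k b - k a\<bar> \<le> c * G b - c * G a" if ab: "0 < a" "a < b" "b \<le> 1" for a b
    proof -
      have "norm (k b - k a) \<le> c * G b - c * G a"
      proof (rule differentiable_bound_general[OF ab(2)])
        show "continuous_on {a..b} k"
          using ab by (intro continuous_at_imp_continuous_on ballI DERIV_isCont[OF k'(1)]) auto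
        have "isCont G s" if "s \<in> {a..b}" for s
          using that ab by (intro has_vector_derivative_continuous[OF G']) auto
        then show "continuous_on {a..b} (\<lambda>s. c * G s)"
          by (intro continuous_intros continuous_at_imp_continuous_on) auto
        fix s assume s: "a < s" "s < b"
        then show "(k has_vector_derivative k' s) (at s)"
          using k'(1)[of s] ab by (simp add: has_real_derivative_iff_has_vector_derivative)
        show "((\<lambda>s. c * G s) has_vector_derivative c * W s) (at s)"
          using s ab by (intro has_vector_derivative_mult_right G') auto
        show "norm (k' s) \<le> c * W s" using s ab k'(2)[of s] by simp
      qed
      then show ?thesis by simp
    qed
    have "(\<Sum>i=1..N. \<bar>glob (t i) x u - glob (t (i - 1)) x u\<bar>) \<le> (\<Sum>i=1..N. c * G (t i) - c * G (t (i - 1)))"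
    proof (rule sum_mono)
      fix i assume i: "i \<in> {1..N}"
      then obtain m where m: "i = Suc m" "m < N" by (cases i) auto
      have "\<bar>glob (t i) x u - glob (t (i - 1)) x u\<bar> = \<bar>k (t i) - k (t m)\<bar> * (1 - eta r rt x u)"
        using eta_range[of x u] by (simp add: glob_def k_def m abs_mult flip: left_diff_distrib)
      also have "\<dots> \<le> \<bar>k (t i) - k (t m)\<bar> * 1" using eta_range[of x u] by (intro mult_left_mono) auto
      also have "\<dots> \<le> c * G (t i) - c * G (t m)"
        using ti inc m step[of "t m" "t i"] by auto
      finally show "\<bar>glob (t i) x u - glob (t (i - 1)) x u\<bar> \<le> c * G (t i) - c * G (t (i - 1))" by (simp add: m)
    qed
    also have "\<dots> = c * G (t N) - c * G (t 0)"
      using sum_telescope''[of 0 N "\<lambda>i. c * G (t i)"] by (simp add: atLeastSucAtMost_greaterThanAtMost)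
    also have "\<dots> \<le> c * G 1"
    proof -
      have G0: "0 \<le> G s" for s unfolding G_def
        by (intro integral_nonneg integrable_continuous_real Wc) (auto intro: W0)
      have "G (t N) \<le> G 1" unfolding G_def
        using ti by (intro integral_subset_le integrable_continuous_real Wc) (auto intro: W0)
      then have "c * G (t N) \<le> c * G 1" using c by (intro mult_left_mono) auto
      moreover have "0 \<le> c * G (t 0)" using c G0 by simp
      ultimately show ?thesis by linarith
    qed
    finally have 1: "(\<Sum>i=1..N. \<bar>glob (t i) x u - glob (t (i - 1)) x u\<bar>) \<le> c * G 1" .
    have "tube 1 x u = (\<integral>\<^sup>+s. ennreal (indicator {0..1} s * W s) \<partial>lborel)"
      unfolding tube_def W_def by (rule nn_integral_cong) (simp add: indicator_def)
    also have "\<dots> = ennreal (G 1)"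
      unfolding G_def
      by (intro nn_integral_has_integral_lebesgue integrable_integral integrable_continuous_real Wc W0)
    finally have "ennreal c * tube 1 x u = ennreal (c * G 1)" using c by (simp add: ennreal_mult')
    then show ?thesis using 1 by (simp add: c_def ennreal_leI)
  qed
  then show thesis using that C(1) by blast
qed

theorem variation_weak_type:
  assumes \<rho>: "1 \<le> \<rho>"
  shows "weak_type_1_1 \<gamma> (\<lambda>f x. variation_seminorm \<rho> {0<..1} (\<lambda>t. H_glob Q B r rt t f x))"
proof -
  obtain L \<kappa> where flow: "expanding_flow (\<lambda>t x. D t *v x) R L \<kappa>" by (rule exists_expanding_flow)
  interpret expanding_flow "\<lambda>t x. D t *v x" R L \<kappa> by (rule flow)
  obtain k where k: "0 < k" "\<gamma> = density lborel (\<lambda>x. ennreal (k * exp (- R x)))" by (rule gauss_density)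
  obtain C1 where C1: "0 < C1" "\<And>f \<alpha>. f \<in> borel_measurable borel \<Longrightarrow> 0 < \<alpha> \<Longrightarrow>
    {x. ennreal \<alpha> < tube_op \<gamma> f x} \<in> sets borel \<and>
    emeasure \<gamma> {x. ennreal \<alpha> < tube_op \<gamma> f x}
      \<le> ennreal (C1 / \<alpha>) * (\<integral>\<^sup>+u. f u \<partial>\<gamma>)"
    using tube_operator_weak_type[OF k(1)] unfolding k(2)[symmetric] by blast
  obtain C2 where C2: "0 < C2"
    "\<And>N t x u. (\<forall>i\<le>N. t i \<in> {0<..1}) \<Longrightarrow> (\<forall>i<N. t i < t (Suc i)) \<Longrightarrow>
      ennreal (\<Sum>i=1..N. \<bar>glob (t i) x u - glob (t (i - 1)) x u\<bar>)
      \<le> ennreal (C2 * exp (R x) * (1 + norm x)) * tube 1 x u"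
    by (rule kernel_variation_le[OF flow]) blast
  have main: "variation_seminorm \<rho> {0<..1} (\<lambda>t. H_glob Q B r rt t f x)
     \<le> ennreal C2 * tube_op \<gamma> (\<lambda>u. ennreal \<bar>f u\<bar>) x"
    if f: "integrable \<gamma> f" for f x
    unfolding variation_seminorm_def
  proof (rule SUP_least, clarify)
    fix N and t :: "nat \<Rightarrow> real"
    assume t: "\<forall>i\<le>N. t i \<in> {0<..1}" "\<forall>i<N. t i < t (Suc i)"
    have fm[measurable]: "f \<in> borel_measurable borel" using f by (simp add: borel_measurable_integrable cong: measurable_cong_sets)
    define d where "d i u = \<bar>(glob (t i) x u - glob (t (i - 1)) x u) * f u\<bar>" for i u
    have d0: "0 \<le> d i u" for i u by (simp add: d_def)
    have int: "integrable \<gamma> (\<lambda>u. glob (t i) x u * f u)" if "i \<le> N" for i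
      using t that by (intro glob_integrable f) auto
    have int_d: "integrable \<gamma> (d i)" if "i \<in> {1..N}" for i
    proof -
      have "integrable \<gamma> (\<lambda>u. \<bar>glob (t i) x u * f u - glob (t (i - 1)) x u * f u\<bar>)"
        using that by (intro integrable_abs Bochner_Integration.integrable_diff int) auto
      then show ?thesis by (simp only: d_def[abs_def] left_diff_distrib)
    qed
    have "\<bar>H_glob Q B r rt (t i) f x - H_glob Q B r rt (t (i - 1)) f x\<bar> \<le> (LINT u|\<gamma>. d i u)" if i: "i \<in> {1..N}" for i
    proof -
      have "H_glob Q B r rt (t i) f x - H_glob Q B r rt (t (i - 1)) f x
         = (LINT u|\<gamma>. (glob (t i) x u - glob (t (i - 1)) x u) * f u)"
        unfolding H_glob_eq left_diff_distrib
        using i by (intro Bochner_Integration.integral_diff[symmetric] int) auto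
      then show ?thesis unfolding d_def by (simp add: integral_abs_bound)
    qed
    then have "(\<Sum>i=1..N. \<bar>H_glob Q B r rt (t i) f x - H_glob Q B r rt (t (i - 1)) f x\<bar>) \<le> (\<Sum>i=1..N. LINT u|\<gamma>. d i u)"
      by (rule sum_mono)
    also have "\<dots> = (LINT u|\<gamma>. (\<Sum>i=1..N. d i u))"
      using int_d by (intro Bochner_Integration.integral_sum[symmetric]) auto
    finally have 1: "(\<Sum>i=1..N. \<bar>H_glob Q B r rt (t i) f x - H_glob Q B r rt (t (i - 1)) f x\<bar>) \<le> (LINT u|\<gamma>. (\<Sum>i=1..N. d i u))" .
    have "ennreal ((\<Sum>i=1..N. \<bar>H_glob Q B r rt (t i) f x - H_glob Q B r rt (t (i - 1)) f x\<bar> powr \<rho>) powr (1 / \<rho>))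
       \<le> ennreal (LINT u|\<gamma>. (\<Sum>i=1..N. d i u))"
      using 1 by (intro ennreal_leI order_trans[OF powr_sum_root_le_sum]) (use \<rho> in auto)
    also have "\<dots> = (\<integral>\<^sup>+u. ennreal (\<Sum>i=1..N. d i u) \<partial>\<gamma>)"
      using int_d by (intro nn_integral_eq_integral[symmetric] Bochner_Integration.integrable_sum) (auto intro!: sum_nonneg AE_I2 simp: d0)
    also have "\<dots> \<le> (\<integral>\<^sup>+u. ennreal (C2 * (exp (R x) * (1 + norm x))) * (tube 1 x u * ennreal \<bar>f u\<bar>) \<partial>\<gamma>)"
    proof (rule nn_integral_mono)
      fix u
      have "ennreal (\<Sum>i=1..N. d i u) = ennreal (\<Sum>i=1..N. \<bar>glob (t i) x u - glob (t (i - 1)) x u\<bar>) * ennreal \<bar>f u\<bar>"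
        by (subst ennreal_mult[symmetric]) (auto simp: d_def abs_mult sum_distrib_right intro: sum_nonneg)
      also have "\<dots> \<le> ennreal (C2 * exp (R x) * (1 + norm x)) * tube 1 x u * ennreal \<bar>f u\<bar>"
        by (intro mult_right_mono C2(2) t) auto
      finally show "ennreal (\<Sum>i=1..N. d i u) \<le> ennreal (C2 * (exp (R x) * (1 + norm x))) * (tube 1 x u * ennreal \<bar>f u\<bar>)"
        by (simp add: mult.assoc)
    qed
    also have "\<dots> = ennreal (C2 * (exp (R x) * (1 + norm x))) * (\<integral>\<^sup>+u. tube 1 x u * ennreal \<bar>f u\<bar> \<partial>\<gamma>)"
      by (rule nn_integral_cmult) measurable
    also have "\<dots> = ennreal C2 * tube_op \<gamma> (\<lambda>u. ennreal \<bar>f u\<bar>) x"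
      using C2(1) by (simp add: tube_op_def ennreal_mult' mult.assoc)
    finally show "ennreal ((\<Sum>i=1..N. \<bar>H_glob Q B r rt (t i) f x - H_glob Q B r rt (t (i - 1)) f x\<bar> powr \<rho>) powr (1 / \<rho>))
       \<le> ennreal C2 * tube_op \<gamma> (\<lambda>u. ennreal \<bar>f u\<bar>) x" .
  qed
  show ?thesis
    unfolding weak_type_1_1_def
  proof (rule exI[of _ "C1 * C2"], intro conjI allI impI)
    show "0 < C1 * C2" using C1 C2 by simp
    fix f :: "real^'n \<Rightarrow> real" and \<alpha> :: real
    assume f: "integrable \<gamma> f" and \<alpha>: "0 < \<alpha>"
    let ?V = "\<lambda>x. variation_seminorm \<rho> {0<..1} (\<lambda>t. H_glob Q B r rt t f x)"
    let ?S = "{x. ennreal (\<alpha> / C2) < tube_op \<gamma> (\<lambda>u. ennreal \<bar>f u\<bar>) x}"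
    show "{x \<in> space \<gamma>. ennreal \<alpha> < ?V x} \<in> sets \<gamma>"
      using variation_level_set_open[OF f \<rho>, of \<alpha>] by simp
    have fm: "(\<lambda>u. ennreal \<bar>f u\<bar>) \<in> borel_measurable borel"
      using f by (simp add: borel_measurable_integrable cong: measurable_cong_sets)
    note S = C1(2)[OF fm divide_pos_pos[OF \<alpha> C2(1)]]
    have "{x \<in> space \<gamma>. ennreal \<alpha> < ?V x} \<subseteq> ?S"
    proof clarify
      fix x assume "ennreal \<alpha> < ?V x"
      also note main[OF f, of x]
      finally have "ennreal C2 * ennreal (\<alpha> / C2) < ennreal C2 * tube_op \<gamma> (\<lambda>u. ennreal \<bar>f u\<bar>) x"
        using C2(1) \<alpha> by (simp flip: ennreal_mult)
      then show "ennreal (\<alpha> / C2) < tube_op \<gamma> (\<lambda>u. ennreal \<bar>f u\<bar>) x"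
        by (meson mult_left_mono not_le zero_le)
    qed
    then have "emeasure \<gamma> {x \<in> space \<gamma>. ennreal \<alpha> < ?V x} \<le> emeasure \<gamma> ?S"
      using S by (intro emeasure_mono) auto
    also have "\<dots> \<le> ennreal (C1 / (\<alpha> / C2)) * (\<integral>\<^sup>+u. ennreal \<bar>f u\<bar> \<partial>\<gamma>)" using S by blast
    also have "(\<integral>\<^sup>+u. ennreal \<bar>f u\<bar> \<partial>\<gamma>) = ennreal (LINT u|\<gamma>. \<bar>f u\<bar>)"
      using f by (intro nn_integral_eq_integral) auto
    also have "ennreal (C1 / (\<alpha> / C2)) * \<dots> = ennreal (C1 * C2 / \<alpha> * (LINT x|\<gamma>. \<bar>f x\<bar>))"
      using C1 C2 \<alpha> by (subst ennreal_mult) auto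
    finally show "emeasure \<gamma> {x \<in> space \<gamma>. ennreal \<alpha> < ?V x} \<le> ennreal (C1 * C2 / \<alpha> * (LINT x|\<gamma>. \<bar>f x\<bar>))" .
  qed
qed

end

theorem theorem6p1:
  fixes Q B :: "real^'n^'n"
    and r rt :: "nat \<Rightarrow> real^'n \<Rightarrow> real"
    and c \<rho> :: real
  assumes Q: "symmetric_pos_def Q"
    and B: "\<And>z. complex_eigenvalue B z \<Longrightarrow> Re z < 0"
    and r_smooth: "\<And>j. smooth (r j)"
    and r_nonneg: "\<And>j x. 0 \<le> r j x"
    and r_sum: "\<And>x. (\<lambda>j. r j x) sums 1"
    and r_supp: "\<And>j. supp (r j) \<subseteq> ring_set Q B (int j) \<union> ring_set Q B (int j + 1)"
    and r_grad: "\<And>j x. norm (gradient (r j) x) \<le> c * (1 + norm x)"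
    and rt_smooth: "\<And>j. smooth (rt j)"
    and rt_compact: "\<And>j. compact (supp (rt j))"
    and rt_range: "\<And>j x. rt j x \<in> {0..1}"
    and rt_one: "\<And>j x. x \<in> (\<Union>\<nu>\<in>{int j - 1..int j + 2}. ring_set Q B \<nu>) \<Longrightarrow> rt j x = 1"
    and rt_supp: "\<And>j. supp (rt j) \<subseteq> (\<Union>\<nu>\<in>{int j - 2..int j + 3}. ring_set Q B \<nu>)"
    and rt_grad: "\<And>j x. norm (gradient (rt j) x) \<le> c * (1 + norm x)"
    and rho: "1 \<le> \<rho>"
  shows "weak_type_1_1 (gauss_inf Q B)
    (\<lambda>f x. variation_seminorm \<rho> {0<..1} (\<lambda>t. H_glob Q B r rt t f x))"
proof -
  interpret localization Q B r rt
    by unfold_locales (use Q B r_smooth r_nonneg r_sum r_supp rt_smooth rt_range rt_one in auto)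
  show ?thesis by (rule variation_weak_type[OF rho])
qed

end
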